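(* Let $R$ be a Banach ring. Given an infinite filtering ordered set $I$ and a functor $I\to\mathrm{Ban}_R$, $i\mapsto W_i$, such that the corresponding object $W=\text{``}\mathrm{colim}"_{i\in I}W_i$ is nuclear in $\mathrm{Ind}(\mathrm{Ban}_R)$, there is a filtered category $K$ with the same cardinality of objects and morphisms as $I$, a functor $K\to\mathrm{Ban}_R$, $k\mapsto P_k$, with corresponding object $P=\text{``}\mathrm{colim}"_{k\in K}P_k$, and an isomorphism $W\cong P$, such that each Banach module $P_k$ is a countable coproduct in $\mathrm{Ban}^{\le1}_R$ of weighted copies of $R$ and the transition morphisms of the system $\{P_k\}$ (attached to non-identity morphisms of $K$) are nuclear.
   Context: A Banach ring $R$ is a commutative unital ring with a function $|\cdot|:R\to\mathbb{R}_{\ge0}$ with $|a|=0$ iff $a=0$, $|a+b|\le|a|+|b|$, $|ab|\le C|a||b|$ for some constant $C>0$, complete for $|a-b|$. A Banach $R$-module is an $R$-module $M$ with a complete norm satisfying the triangle inequality and $\|am\|\le C|a|\|m\|$ for some $C>0$. $\mathrm{Ban}_R$ is the category of Banach $R$-modules and bounded $R$-linear maps; it is closed symmetric monoidal with the completed projective tensor product $\widehat{\otimes}_R$, unit $R$, and internal Hom $\underline{\mathrm{Hom}}(V,W)$ the bounded maps with operator norm; $V^\vee=\underline{\mathrm{Hom}}(V,R)$. $\mathrm{Ban}^{\le1}_R$ has the same objects and the morphisms of norm $\le1$; its coproduct is $\coprod^{\le1}_{s}V_s=\{(v_s):\sum_s\|v_s\|<\infty\}$ with norm $\sum_s\|v_s\|$.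 For $r>0$, the weighted copy $R_r$ of $R$ is $R$ with norm $r|\cdot|$. A morphism $V\to W$ in $\mathrm{Ban}_R$ is nuclear if it lies in the image of $\mathrm{Hom}(R,V^\vee\widehat{\otimes}_RW)\to\mathrm{Hom}(R,\underline{\mathrm{Hom}}(V,W))=\mathrm{Hom}(V,W)$. $\mathrm{Ind}(\mathrm{Ban}_R)$ is the ind-completion, with $\widehat{\otimes}_R$ and $\underline{\mathrm{Hom}}$ extended by $(\text{``}\mathrm{colim}"E_i)\widehat{\otimes}_R(\text{``}\mathrm{colim}"F_j)=\text{``}\mathrm{colim}"_{(i,j)}E_i\widehat{\otimes}_RF_j$ and $\underline{\mathrm{Hom}}(\text{``}\mathrm{colim}"E_i,\text{``}\mathrm{colim}"F_j)=\lim_i\text{``}\mathrm{colim}"_j\underline{\mathrm{Hom}}(E_i,F_j)$. An object $V$ of $\mathrm{Ind}(\mathrm{Ban}_R)$ is nuclear if for every $X\in\mathrm{Ban}_R$ the natural morphism $X^\vee\widehat{\otimes}_RV\to\underline{\mathrm{Hom}}(X,V)$ is an isomorphism. *)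

theory Defs
  imports
    "HOL-Library.FuncSet"
    "HOL-Library.Equipollence"
    "HOL-Analysis.Infinite_Sum"
    "HOL-Algebra.Module"
begin

section \<open>Banach rings and Banach modules\<close>

record 'a normed_ring = "'a ring" +
  rnorm :: "'a \<Rightarrow> real"

record ('a, 'm) normed_module = "('a, 'm) module" +
  mnorm :: "'m \<Rightarrow> real"

definition complete_norm :: "('b, 'c) ring_scheme \<Rightarrow> ('b \<Rightarrow> real) \<Rightarrow> bool" where
  "complete_norm G N \<longleftrightarrow>
     (\<forall>x\<in>carrier G. 0 \<le> N x \<and> (N x = 0 \<longleftrightarrow> x = \<zero>\<^bsub>G\<^esub>)) \<and>
     (\<forall>x\<in>carrier G. \<forall>y\<in>carrier G. N (x \<oplus>\<^bsub>G\<^esub> y) \<le> N x + N y) \<and>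
     (\<forall>s. range s \<subseteq> carrier G \<longrightarrow>
        (\<forall>e>0. \<exists>n0. \<forall>m\<ge>n0. \<forall>n\<ge>n0. N (s m \<ominus>\<^bsub>G\<^esub> s n) < e) \<longrightarrow>
        (\<exists>l\<in>carrier G. (\<lambda>n. N (s n \<ominus>\<^bsub>G\<^esub> l)) \<longlonglongrightarrow> 0))"

text \<open>The zero ring is a Banach ring.  The norm is only submultiplicative up to a constant.\<close>

definition banach_ring :: "'a normed_ring \<Rightarrow> bool" where
  "banach_ring R \<longleftrightarrow>
     cring R \<and> complete_norm R (rnorm R) \<and>
     (\<exists>C>0. \<forall>a\<in>carrier R. \<forall>b\<in>carrier R.
        rnorm R (a \<otimes>\<^bsub>R\<^esub> b) \<le> C * rnorm R a * rnorm R b)"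

definition banach_module :: "'a normed_ring \<Rightarrow> ('a, 'm) normed_module \<Rightarrow> bool" where
  "banach_module R M \<longleftrightarrow>
     Module.module R M \<and> complete_norm M (mnorm M) \<and>
     (\<exists>C>0. \<forall>a\<in>carrier R. \<forall>x\<in>carrier M.
        mnorm M (a \<odot>\<^bsub>M\<^esub> x) \<le> C * rnorm R a * mnorm M x)"

text \<open>Morphisms are extensional functions on the carrier, so that equality of morphisms is
  equality in HOL; they compose by \<^const>\<open>compose\<close>.  The modules may live on different types.\<close>

definition bounded_hom ::
  "'a normed_ring \<Rightarrow> ('a, 'm) normed_module \<Rightarrow> ('a, 'n) normed_module \<Rightarrow> ('m \<Rightarrow> 'n) set" where
  "bounded_hom R M N =
     {f \<in> carrier M \<rightarrow>\<^sub>E carrier N.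
        (\<forall>x\<in>carrier M. \<forall>y\<in>carrier M. f (x \<oplus>\<^bsub>M\<^esub> y) = f x \<oplus>\<^bsub>N\<^esub> f y) \<and>
        (\<forall>a\<in>carrier R. \<forall>x\<in>carrier M. f (a \<odot>\<^bsub>M\<^esub> x) = a \<odot>\<^bsub>N\<^esub> f x) \<and>
        (\<exists>C. \<forall>x\<in>carrier M. mnorm N (f x) \<le> C * mnorm M x)}"

definition op_norm ::
  "('a, 'm) normed_module \<Rightarrow> ('a, 'n) normed_module \<Rightarrow> ('m \<Rightarrow> 'n) \<Rightarrow> real" where
  "op_norm M N f = Inf {C. 0 \<le> C \<and> (\<forall>x\<in>carrier M. mnorm N (f x) \<le> C * mnorm M x)}"

text \<open>The fields \<^const>\<open>mult\<close> and \<^const>\<open>one\<close> are inherited from the library's module record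
  and play no role.\<close>

definition internal_hom ::
  "'a normed_ring \<Rightarrow> ('a, 'm) normed_module \<Rightarrow> ('a, 'n) normed_module
     \<Rightarrow> ('a, 'm \<Rightarrow> 'n) normed_module" where
  "internal_hom R M N =
     \<lparr>carrier = bounded_hom R M N, mult = undefined, one = undefined,
      zero = (\<lambda>x\<in>carrier M. \<zero>\<^bsub>N\<^esub>),
      add = (\<lambda>f g. \<lambda>x\<in>carrier M. f x \<oplus>\<^bsub>N\<^esub> g x),
      smult = (\<lambda>a f. \<lambda>x\<in>carrier M. a \<odot>\<^bsub>N\<^esub> f x),
      mnorm = op_norm M N\<rparr>"

definition weighted_copy :: "'a normed_ring \<Rightarrow> real \<Rightarrow> ('a, 'a) normed_module" where
  "weighted_copy R r =
     \<lparr>carrier = carrier R, mult = undefined, one = undefined,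
      zero = \<zero>\<^bsub>R\<^esub>, add = add R, smult = mult R, mnorm = (\<lambda>a. r * rnorm R a)\<rparr>"

abbreviation unit_module :: "'a normed_ring \<Rightarrow> ('a, 'a) normed_module" where
  "unit_module R \<equiv> weighted_copy R 1"

definition dual :: "'a normed_ring \<Rightarrow> ('a, 'm) normed_module \<Rightarrow> ('a, 'm \<Rightarrow> 'a) normed_module" where
  "dual R M = internal_hom R M (unit_module R)"

text \<open>The coproduct in the category of Banach modules and maps of norm at most 1.\<close>

definition coprod_le1 ::
  "'s set \<Rightarrow> ('s \<Rightarrow> ('a, 'm) normed_module) \<Rightarrow> ('a, 's \<Rightarrow> 'm) normed_module" where
  "coprod_le1 S V =
     \<lparr>carrier = {v \<in> (\<Pi>\<^sub>E s\<in>S. carrier (V s)). (\<lambda>s. mnorm (V s) (v s)) summable_on S},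
      mult = undefined, one = undefined,
      zero = (\<lambda>s\<in>S. \<zero>\<^bsub>V s\<^esub>),
      add = (\<lambda>v w. \<lambda>s\<in>S. v s \<oplus>\<^bsub>V s\<^esub> w s),
      smult = (\<lambda>a v. \<lambda>s\<in>S. a \<odot>\<^bsub>V s\<^esub> v s),
      mnorm = (\<lambda>v. \<Sum>\<^sub>\<infinity>s\<in>S. mnorm (V s) (v s))\<rparr>"


section \<open>The completed projective tensor product\<close>

text \<open>An element of the algebraic tensor product \<open>M \<otimes> N\<close> over \<open>R\<close> is represented by a list of
  pairs \<open>[(m\<^sub>1, n\<^sub>1), \<dots>]\<close>, standing for the sum of the elementary tensors \<open>m\<^sub>i \<otimes> n\<^sub>i\<close>.
  The following relation is equality in \<open>M \<otimes> N\<close>: it is the congruence on the free commutative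
  monoid on pairs generated by biadditivity and balancedness.  The quotient is a group,
  because \<open>(\<ominus> m) \<otimes> n\<close> is inverse to \<open>m \<otimes> n\<close>.\<close>

inductive tensor_eq ::
  "'a normed_ring \<Rightarrow> ('a, 'm) normed_module \<Rightarrow> ('a, 'n) normed_module
     \<Rightarrow> ('m \<times> 'n) list \<Rightarrow> ('m \<times> 'n) list \<Rightarrow> bool"
  for R M N where
  refl: "set xs \<subseteq> carrier M \<times> carrier N \<Longrightarrow> tensor_eq R M N xs xs"
| sym: "tensor_eq R M N xs ys \<Longrightarrow> tensor_eq R M N ys xs"
| trans: "tensor_eq R M N xs ys \<Longrightarrow> tensor_eq R M N ys zs \<Longrightarrow> tensor_eq R M N xs zs"
| append: "tensor_eq R M N xs xs' \<Longrightarrow> tensor_eq R M N ys ys' \<Longrightarrow>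
    tensor_eq R M N (xs @ ys) (xs' @ ys')"
| commute: "set xs \<subseteq> carrier M \<times> carrier N \<Longrightarrow> set ys \<subseteq> carrier M \<times> carrier N \<Longrightarrow>
    tensor_eq R M N (xs @ ys) (ys @ xs)"
| zero: "n \<in> carrier N \<Longrightarrow> tensor_eq R M N [(\<zero>\<^bsub>M\<^esub>, n)] []"
| add_left: "m \<in> carrier M \<Longrightarrow> m' \<in> carrier M \<Longrightarrow> n \<in> carrier N \<Longrightarrow>
    tensor_eq R M N [(m \<oplus>\<^bsub>M\<^esub> m', n)] [(m, n), (m', n)]"
| add_right: "m \<in> carrier M \<Longrightarrow> n \<in> carrier N \<Longrightarrow> n' \<in> carrier N \<Longrightarrow>
    tensor_eq R M N [(m, n \<oplus>\<^bsub>N\<^esub> n')] [(m, n), (m, n')]"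
| balanced: "a \<in> carrier R \<Longrightarrow> m \<in> carrier M \<Longrightarrow> n \<in> carrier N \<Longrightarrow>
    tensor_eq R M N [(a \<odot>\<^bsub>M\<^esub> m, n)] [(m, a \<odot>\<^bsub>N\<^esub> n)]"

definition proj_seminorm ::
  "'a normed_ring \<Rightarrow> ('a, 'm) normed_module \<Rightarrow> ('a, 'n) normed_module
     \<Rightarrow> ('m \<times> 'n) list \<Rightarrow> real" where
  "proj_seminorm R M N xs =
     Inf {(\<Sum>(m, n)\<leftarrow>ys. mnorm M m * mnorm N n) | ys. tensor_eq R M N xs ys}"

definition proj_dist ::
  "'a normed_ring \<Rightarrow> ('a, 'm) normed_module \<Rightarrow> ('a, 'n) normed_module
     \<Rightarrow> ('m \<times> 'n) list \<Rightarrow> ('m \<times> 'n) list \<Rightarrow> real" where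
  "proj_dist R M N xs ys = proj_seminorm R M N (xs @ map (\<lambda>(m, n). (\<ominus>\<^bsub>M\<^esub> m, n)) ys)"

definition tensor_cauchy ::
  "'a normed_ring \<Rightarrow> ('a, 'm) normed_module \<Rightarrow> ('a, 'n) normed_module
     \<Rightarrow> (nat \<Rightarrow> ('m \<times> 'n) list) set" where
  "tensor_cauchy R M N =
     {s. (\<forall>k. set (s k) \<subseteq> carrier M \<times> carrier N) \<and>
         (\<forall>e>0. \<exists>k0. \<forall>k\<ge>k0. \<forall>l\<ge>k0. proj_dist R M N (s k) (s l) < e)}"

definition tensor_null_rel ::
  "'a normed_ring \<Rightarrow> ('a, 'm) normed_module \<Rightarrow> ('a, 'n) normed_module
     \<Rightarrow> (nat \<Rightarrow> ('m \<times> 'n) list) rel" where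
  "tensor_null_rel R M N =
     {(s, t). s \<in> tensor_cauchy R M N \<and> t \<in> tensor_cauchy R M N \<and>
              (\<lambda>k. proj_dist R M N (s k) (t k)) \<longlonglongrightarrow> 0}"

text \<open>The completion consists of Cauchy sequences modulo null sequences.\<close>

definition ctensor ::
  "'a normed_ring \<Rightarrow> ('a, 'm) normed_module \<Rightarrow> ('a, 'n) normed_module
     \<Rightarrow> ('a, (nat \<Rightarrow> ('m \<times> 'n) list) set) normed_module" where
  "ctensor R M N =
     \<lparr>carrier = tensor_cauchy R M N // tensor_null_rel R M N,
      mult = undefined, one = undefined,
      zero = tensor_null_rel R M N `` {\<lambda>k. []},
      add = (\<lambda>p q. \<Union>s\<in>p. \<Union>t\<in>q. tensor_null_rel R M N `` {\<lambda>k. s k @ t k}),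
      smult = (\<lambda>a p. \<Union>s\<in>p. tensor_null_rel R M N `` {\<lambda>k. map (\<lambda>(m, n). (a \<odot>\<^bsub>M\<^esub> m, n)) (s k)}),
      mnorm = (\<lambda>p. THE c. \<forall>s\<in>p. (\<lambda>k. proj_seminorm R M N (s k)) \<longlonglongrightarrow> c)\<rparr>"

definition pure_tensor ::
  "'a normed_ring \<Rightarrow> ('a, 'm) normed_module \<Rightarrow> ('a, 'n) normed_module
     \<Rightarrow> 'm \<Rightarrow> 'n \<Rightarrow> (nat \<Rightarrow> ('m \<times> 'n) list) set" where
  "pure_tensor R M N m n = tensor_null_rel R M N `` {\<lambda>k. [(m, n)]}"

text \<open>The bounded linear map out of the completed tensor product that is induced by a bounded
  bilinear map \<open>b\<close>; it is unique because elementary tensors span a dense submodule.\<close>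

definition tensor_lift ::
  "'a normed_ring \<Rightarrow> ('a, 'm) normed_module \<Rightarrow> ('a, 'n) normed_module \<Rightarrow> ('a, 'u) normed_module
     \<Rightarrow> ('m \<Rightarrow> 'n \<Rightarrow> 'u) \<Rightarrow> (nat \<Rightarrow> ('m \<times> 'n) list) set \<Rightarrow> 'u" where
  "tensor_lift R M N U b =
     (THE f. f \<in> bounded_hom R (ctensor R M N) U \<and>
             (\<forall>m\<in>carrier M. \<forall>n\<in>carrier N. f (pure_tensor R M N m n) = b m n))"

text \<open>The canonical map from \<open>X\<^sup>\<or> \<otimes> V\<close> to the internal Hom, sending \<open>l \<otimes> v\<close> to \<open>x \<mapsto> l(x) v\<close>.\<close>

definition canonical_map ::
  "'a normed_ring \<Rightarrow> ('a, 'm) normed_module \<Rightarrow> ('a, 'n) normed_module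
     \<Rightarrow> (nat \<Rightarrow> (('m \<Rightarrow> 'a) \<times> 'n) list) set \<Rightarrow> 'm \<Rightarrow> 'n" where
  "canonical_map R X V =
     tensor_lift R (dual R X) V (internal_hom R X V) (\<lambda>l v. \<lambda>x\<in>carrier X. l x \<odot>\<^bsub>V\<^esub> v)"

text \<open>The identification of \<open>Hom(R, Hom(V, W))\<close> with \<open>Hom(V, W)\<close> is evaluation at \<open>1\<close>.\<close>

definition nuclear_map ::
  "'a normed_ring \<Rightarrow> ('a, 'm) normed_module \<Rightarrow> ('a, 'n) normed_module \<Rightarrow> ('m \<Rightarrow> 'n) \<Rightarrow> bool" where
  "nuclear_map R V W f \<longleftrightarrow>
     f \<in> bounded_hom R V W \<and>
     (\<exists>h\<in>bounded_hom R (unit_module R) (ctensor R (dual R V) W).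
        f = compose (carrier R) (canonical_map R V W) h \<one>\<^bsub>R\<^esub>)"


section \<open>Small categories\<close>

record ('o, 'h) cat =
  Ob :: "'o set"
  Ar :: "'h set"
  Dom :: "'h \<Rightarrow> 'o"
  Cod :: "'h \<Rightarrow> 'o"
  Idt :: "'o \<Rightarrow> 'h"
  Cmp :: "'h \<Rightarrow> 'h \<Rightarrow> 'h"  \<comment> \<open>\<open>Cmp C g f\<close> is \<open>g\<close> after \<open>f\<close>\<close>

definition category :: "('o, 'h) cat \<Rightarrow> bool" where
  "category C \<longleftrightarrow>
     (\<forall>f\<in>Ar C. Dom C f \<in> Ob C \<and> Cod C f \<in> Ob C) \<and>
     (\<forall>i\<in>Ob C. Idt C i \<in> Ar C \<and> Dom C (Idt C i) = i \<and> Cod C (Idt C i) = i) \<and>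
     (\<forall>f\<in>Ar C. \<forall>g\<in>Ar C. Dom C g = Cod C f \<longrightarrow>
        Cmp C g f \<in> Ar C \<and> Dom C (Cmp C g f) = Dom C f \<and> Cod C (Cmp C g f) = Cod C g) \<and>
     (\<forall>f\<in>Ar C. Cmp C f (Idt C (Dom C f)) = f \<and> Cmp C (Idt C (Cod C f)) f = f) \<and>
     (\<forall>f\<in>Ar C. \<forall>g\<in>Ar C. \<forall>h\<in>Ar C. Dom C g = Cod C f \<longrightarrow> Dom C h = Cod C g \<longrightarrow>
        Cmp C h (Cmp C g f) = Cmp C (Cmp C h g) f)"

definition filtered_category :: "('o, 'h) cat \<Rightarrow> bool" where
  "filtered_category C \<longleftrightarrow>
     category C \<and> Ob C \<noteq> {} \<and>
     (\<forall>i\<in>Ob C. \<forall>j\<in>Ob C. \<exists>f\<in>Ar C. \<exists>g\<in>Ar C.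
        Dom C f = i \<and> Dom C g = j \<and> Cod C f = Cod C g) \<and>
     (\<forall>f\<in>Ar C. \<forall>g\<in>Ar C. Dom C f = Dom C g \<longrightarrow> Cod C f = Cod C g \<longrightarrow>
        (\<exists>h\<in>Ar C. Dom C h = Cod C f \<and> Cmp C h f = Cmp C h g))"

definition poset_cat :: "'i set \<Rightarrow> 'i rel \<Rightarrow> ('i, 'i \<times> 'i) cat" where
  "poset_cat I ord_rel =
     \<lparr>Ob = I, Ar = ord_rel, Dom = fst, Cod = snd, Idt = (\<lambda>i. (i, i)),
      Cmp = (\<lambda>g f. (fst f, snd g))\<rparr>"


section \<open>Ind-objects of the category of Banach modules\<close>

text \<open>An ind-object is given by a filtered category \<open>idx\<close> and a functor from it to Banach
  modules, with object part \<open>obj\<close> and arrow part \<open>tr\<close>.\<close>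

record ('o, 'h, 'a, 'm) ind_obj =
  idx :: "('o, 'h) cat"
  obj :: "'o \<Rightarrow> ('a, 'm) normed_module"
  tr :: "'h \<Rightarrow> 'm \<Rightarrow> 'm"

definition ban_functor :: "'a normed_ring \<Rightarrow> ('o, 'h, 'a, 'm) ind_obj \<Rightarrow> bool" where
  "ban_functor R E \<longleftrightarrow>
     (\<forall>i\<in>Ob (idx E). banach_module R (obj E i)) \<and>
     (\<forall>f\<in>Ar (idx E).
        tr E f \<in> bounded_hom R (obj E (Dom (idx E) f)) (obj E (Cod (idx E) f))) \<and>
     (\<forall>i\<in>Ob (idx E). tr E (Idt (idx E) i) = (\<lambda>x\<in>carrier (obj E i). x)) \<and>
     (\<forall>f\<in>Ar (idx E). \<forall>g\<in>Ar (idx E). Dom (idx E) g = Cod (idx E) f \<longrightarrow>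
        tr E (Cmp (idx E) g f) = compose (carrier (obj E (Dom (idx E) f))) (tr E g) (tr E f))"

text \<open>Morphisms of ind-objects are the elements of \<open>lim\<^sub>i colim\<^sub>j Hom(E\<^sub>i, F\<^sub>j)\<close>.  For a Banach module
  \<open>A\<close>, the filtered colimit of sets \<open>colim\<^sub>j Hom(A, F\<^sub>j)\<close> consists of classes of pairs
  \<open>(j, g)\<close> with \<open>g\<close> in \<open>Hom(A, F\<^sub>j)\<close>.\<close>

definition colim_rel ::
  "'a normed_ring \<Rightarrow> ('a, 'm) normed_module \<Rightarrow> ('o, 'h, 'a, 'n) ind_obj
     \<Rightarrow> ('o \<times> ('m \<Rightarrow> 'n)) rel" where
  "colim_rel R A F =
     {((j, g), (j', g')).
        j \<in> Ob (idx F) \<and> j' \<in> Ob (idx F) \<and>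
        g \<in> bounded_hom R A (obj F j) \<and> g' \<in> bounded_hom R A (obj F j') \<and>
        (\<exists>u\<in>Ar (idx F). \<exists>u'\<in>Ar (idx F).
           Dom (idx F) u = j \<and> Dom (idx F) u' = j' \<and> Cod (idx F) u = Cod (idx F) u' \<and>
           compose (carrier A) (tr F u) g = compose (carrier A) (tr F u') g')}"

definition colim_hom ::
  "'a normed_ring \<Rightarrow> ('a, 'm) normed_module \<Rightarrow> ('o, 'h, 'a, 'n) ind_obj
     \<Rightarrow> ('o \<times> ('m \<Rightarrow> 'n)) set set" where
  "colim_hom R A F = (SIGMA j:Ob (idx F). bounded_hom R A (obj F j)) // colim_rel R A F"

definition ind_hom ::
  "'a normed_ring \<Rightarrow> ('i, 'u, 'a, 'm) ind_obj \<Rightarrow> ('j, 'v, 'a, 'n) ind_obj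
     \<Rightarrow> ('i \<Rightarrow> ('j \<times> ('m \<Rightarrow> 'n)) set) set" where
  "ind_hom R E F =
     {\<phi> \<in> (\<Pi>\<^sub>E i\<in>Ob (idx E). colim_hom R (obj E i) F).
        \<forall>u\<in>Ar (idx E). \<forall>(j, g)\<in>\<phi> (Cod (idx E) u).
          (j, compose (carrier (obj E (Dom (idx E) u))) g (tr E u)) \<in> \<phi> (Dom (idx E) u)}"

definition ind_id ::
  "'a normed_ring \<Rightarrow> ('i, 'u, 'a, 'm) ind_obj \<Rightarrow> 'i \<Rightarrow> ('i \<times> ('m \<Rightarrow> 'm)) set" where
  "ind_id R E = (\<lambda>i\<in>Ob (idx E). colim_rel R (obj E i) E `` {(i, \<lambda>x\<in>carrier (obj E i). x)})"

definition ind_comp ::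
  "'a normed_ring \<Rightarrow> ('i, 'u, 'a, 'm) ind_obj \<Rightarrow> ('k, 'w, 'a, 'p) ind_obj
     \<Rightarrow> ('j \<Rightarrow> ('k \<times> ('n \<Rightarrow> 'p)) set) \<Rightarrow> ('i \<Rightarrow> ('j \<times> ('m \<Rightarrow> 'n)) set)
     \<Rightarrow> 'i \<Rightarrow> ('k \<times> ('m \<Rightarrow> 'p)) set" where
  "ind_comp R E G \<psi> \<phi> =
     (\<lambda>i\<in>Ob (idx E). \<Union>(j, g)\<in>\<phi> i. \<Union>(k, h)\<in>\<psi> j.
        colim_rel R (obj E i) G `` {(k, compose (carrier (obj E i)) h g)})"

definition ind_iso ::
  "'a normed_ring \<Rightarrow> ('i, 'u, 'a, 'm) ind_obj \<Rightarrow> ('j, 'v, 'a, 'n) ind_obj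
     \<Rightarrow> ('i \<Rightarrow> ('j \<times> ('m \<Rightarrow> 'n)) set) \<Rightarrow> bool" where
  "ind_iso R E F \<phi> \<longleftrightarrow>
     \<phi> \<in> ind_hom R E F \<and>
     (\<exists>\<psi>\<in>ind_hom R F E.
        ind_comp R E E \<psi> \<phi> = ind_id R E \<and> ind_comp R F F \<phi> \<psi> = ind_id R F)"

text \<open>The tensor product of a Banach module \<open>Y\<close> with an ind-object, and the internal Hom from a
  Banach module \<open>X\<close> to an ind-object.  A Banach module is a constant ind-object indexed by the
  one-point category, so in both cases the formulas for ind-objects give a formal colimit over
  the index category of \<open>V\<close>.\<close>

definition ind_tensor ::
  "'a normed_ring \<Rightarrow> ('a, 'y) normed_module \<Rightarrow> ('o, 'h, 'a, 'm) ind_obj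
     \<Rightarrow> ('o, 'h, 'a, (nat \<Rightarrow> ('y \<times> 'm) list) set) ind_obj" where
  "ind_tensor R Y V =
     \<lparr>idx = idx V,
      obj = (\<lambda>j. ctensor R Y (obj V j)),
      tr = (\<lambda>u. let M = obj V (Dom (idx V) u); N = obj V (Cod (idx V) u) in
              tensor_lift R Y M (ctensor R Y N) (\<lambda>y m. pure_tensor R Y N y (tr V u m)))\<rparr>"

definition ind_internal_hom ::
  "'a normed_ring \<Rightarrow> ('a, 'x) normed_module \<Rightarrow> ('o, 'h, 'a, 'm) ind_obj
     \<Rightarrow> ('o, 'h, 'a, 'x \<Rightarrow> 'm) ind_obj" where
  "ind_internal_hom R X V =
     \<lparr>idx = idx V,
      obj = (\<lambda>j. internal_hom R X (obj V j)),
      tr = (\<lambda>u. \<lambda>g\<in>bounded_hom R X (obj V (Dom (idx V) u)). compose (carrier X) (tr V u) g)\<rparr>"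

definition ind_canonical_map ::
  "'a normed_ring \<Rightarrow> ('a, 'x) normed_module \<Rightarrow> ('o, 'h, 'a, 'm) ind_obj
     \<Rightarrow> 'o \<Rightarrow> ('o \<times> ((nat \<Rightarrow> (('x \<Rightarrow> 'a) \<times> 'm) list) set \<Rightarrow> 'x \<Rightarrow> 'm)) set" where
  "ind_canonical_map R X V =
     (\<lambda>j\<in>Ob (idx V).
        colim_rel R (ctensor R (dual R X) (obj V j)) (ind_internal_hom R X V)
          `` {(j, canonical_map R X (obj V j))})"

text \<open>The type \<open>'m\<close> that carries the modules of \<open>V\<close> plays the role of the universe: the test
  object \<open>X\<close> ranges over all Banach modules on subsets of \<open>'m\<close>, which include all \<open>obj V j\<close>.
  Any set of Banach modules can be transported to one sufficiently large type.\<close>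

definition ind_nuclear :: "'a normed_ring \<Rightarrow> ('o, 'h, 'a, 'm) ind_obj \<Rightarrow> bool" where
  "ind_nuclear R V \<longleftrightarrow>
     (\<forall>X :: ('a, 'm) normed_module. banach_module R X \<longrightarrow>
        ind_iso R (ind_tensor R (dual R X) V) (ind_internal_hom R X V) (ind_canonical_map R X V))"

end

theory Submission
  imports Defs "HOL-Library.Multiset"
begin

text \<open>
  The argument has two ingredients.

  \<^bold>\<open>Nuclear maps factor through coproducts.\<close>  An element of the completed tensor product of the dual
  of \<open>V\<close> with \<open>W\<close> is a series \<open>\<Sum> l\<^sub>i \<otimes> w\<^sub>i\<close> with \<open>\<Sum> \<parallel>l\<^sub>i\<parallel> \<parallel>w\<^sub>i\<parallel>\<close> finite (\<open>series_representation\<close>), so a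
  nuclear map is \<open>x \<mapsto> \<Sum> l\<^sub>i(x) w\<^sub>i\<close> (\<open>nuclear_map_iff\<close>).  Choose weights \<open>r\<^sub>i > 0\<close> with \<open>r\<^sub>i \<ge> \<parallel>w\<^sub>i\<parallel>\<close> and
  \<open>\<Sum> \<parallel>l\<^sub>i\<parallel> r\<^sub>i\<close> finite, and let \<open>P\<close> be the coproduct of the weighted copies of \<open>R\<close> with these weights.  The
  nuclear map is then the composite of \<open>x \<mapsto> (l\<^sub>i(x))\<^sub>i\<close> from \<open>V\<close> to \<open>P\<close> and \<open>(y\<^sub>i)\<^sub>i \<mapsto> \<Sum> y\<^sub>i w\<^sub>i\<close> from \<open>P\<close>
  to \<open>W\<close>, and the first of these is itself nuclear (\<open>nuclear_map_factorization\<close>).  This needs the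
  universal property of the completed tensor product (\<open>tensor_lift_eq\<close>), because the canonical map
  to the internal Hom is specified by it.

  \<^bold>\<open>Terms of a nuclear system map to later terms by nuclear maps.\<close>  Applying nuclearity of the
  ind-object to \<open>X = W i\<close> and to the identity of \<open>W i\<close> gives an index \<open>s i \<ge> i\<close> such that the transition
  map from \<open>W i\<close> to \<open>W (s i)\<close> is a nuclear map to some \<open>W j\<close> followed by a transition map.  So it
  is also a composite of a nuclear map \<open>a i\<close> to a coproduct \<open>P i\<close> of weighted copies of \<open>R\<close> and a
  bounded map \<open>b i\<close> from \<open>P i\<close> to \<open>W (s i)\<close> (\<open>ind_nuclear_factorization\<close>).

  The modules \<open>P i\<close> are now interleaved with the given system.  The new index set consists of
  pairs \<open>(i, m)\<close> in \<open>I \<times> \<nat>\<close>, where \<open>(i, m) < (j, n)\<close> means \<open>s i \<le> j\<close> and \<open>m < n\<close>; the transition map is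
  the composite \<open>P i \<rightarrow> W (s i) \<rightarrow> W j \<rightarrow> P j\<close>, nuclear because its last factor is.  The maps \<open>a i\<close> and \<open>b i\<close>
  are compatible with the transition maps in the colimit and induce inverse isomorphisms of
  ind-objects (\<open>ind_isoI\<close>).  The second coordinate ensures that there is always a strictly larger index.  Since \<open>I\<close> is infinite, \<open>I\<close>, \<open>I \<times> \<nat>\<close>
  and every reflexive relation on \<open>I\<close> have the same cardinality.
\<close>

section \<open>Limits and series in Banach modules\<close>

lemma cauchy_scale:
  fixes f d :: "nat \<Rightarrow> nat \<Rightarrow> real"
  assumes d: "\<And>e. e > 0 \<Longrightarrow> \<exists>n0. \<forall>m\<ge>n0. \<forall>n\<ge>n0. d m n < e"
    and f: "0 \<le> D" "\<And>m n. f m n \<le> D * d m n" and e: "e > 0"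
  shows "\<exists>n0. \<forall>m\<ge>n0. \<forall>n\<ge>n0. f m n < e"
proof -
  have "e / (D + 1) > 0" using e f(1) by simp
  from d[OF this] obtain n0 where n0: "\<And>m n. m \<ge> n0 \<Longrightarrow> n \<ge> n0 \<Longrightarrow> d m n < e / (D + 1)" by blast
  have "f m n < e" if "m \<ge> n0" "n \<ge> n0" for m n
  proof -
    have "D * d m n \<le> D * (e / (D + 1))" using n0[OF that] f(1) by (intro mult_left_mono) auto
    also have "\<dots> < e" using f(1) e by (simp add: field_simps)
    finally show ?thesis using f(2)[of m n] by simp
  qed
  then show ?thesis by blast
qed

text \<open>Cauchy's criterion for the partial sums of a series, for a distance that is symmetric only up to
  a constant.\<close>

lemma cauchy_partial_sums:
  fixes f :: "nat \<Rightarrow> nat \<Rightarrow> real"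
  assumes g: "summable g" and le: "\<And>m n. m \<le> n \<Longrightarrow> f n m \<le> (\<Sum>i=m..<n. g i)"
    and sym: "C > 0" "\<And>m n. f m n \<le> C * f n m" and e: "e > 0"
  shows "\<exists>n0. \<forall>m\<ge>n0. \<forall>n\<ge>n0. f m n < e"
proof -
  define d where "d = e / (C + 1)"
  have d: "d > 0" "C * d < e" "d \<le> e" using sym(1) e by (auto simp: d_def field_simps)
  from g d(1) obtain N where N: "\<And>m n. m \<ge> N \<Longrightarrow> norm (\<Sum>i=m..<n. g i) < d"
    unfolding summable_Cauchy by blast
  have small: "f n m < d" if "m \<le> n" "N \<le> m" for m n
    using N[OF that(2), of n] le[OF that(1)] by (simp add: abs_less_iff)
  have "f m n < e" if "m \<ge> N" "n \<ge> N" for m n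
  proof (cases "n \<le> m")
    case True
    with small[of n m] that d show ?thesis by simp
  next
    case False
    then have "C * f n m < C * d" using small[of m n] that sym(1) by simp
    with sym(2)[of m n] d show ?thesis by linarith
  qed
  then show ?thesis by blast
qed

text \<open>A Banach module over a Banach ring.\<close>

locale banach_mod =
  fixes R :: "'a normed_ring" and M :: "('a, 'm) normed_module"
  assumes banach_ring: "banach_ring R" and banach_module: "banach_module R M"

sublocale banach_mod \<subseteq> Module.module R M
  using banach_module by (simp add: banach_module_def)

context banach_mod
begin

lemma complete_norm: "complete_norm M (mnorm M)"
  using banach_module by (simp add: banach_module_def)

lemma norm_nonneg [simp]: "x \<in> carrier M \<Longrightarrow> 0 \<le> mnorm M x"
  using complete_norm by (simp add: complete_norm_def)

lemma norm_eq_zero_iff: "x \<in> carrier M \<Longrightarrow> mnorm M x = 0 \<longleftrightarrow> x = \<zero>\<^bsub>M\<^esub>"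
  using complete_norm by (simp add: complete_norm_def)

lemma norm_zero [simp]: "mnorm M \<zero>\<^bsub>M\<^esub> = 0"
  by (simp add: norm_eq_zero_iff)

lemma norm_triangle:
  "x \<in> carrier M \<Longrightarrow> y \<in> carrier M \<Longrightarrow> mnorm M (x \<oplus>\<^bsub>M\<^esub> y) \<le> mnorm M x + mnorm M y"
  using complete_norm by (simp add: complete_norm_def)

lemma rnorm_nonneg [simp]: "a \<in> carrier R \<Longrightarrow> 0 \<le> rnorm R a"
  using banach_ring by (simp add: banach_ring_def complete_norm_def)

lemma smult_bound:
  obtains C where "C > 0"
    "\<And>a x. a \<in> carrier R \<Longrightarrow> x \<in> carrier M \<Longrightarrow> mnorm M (a \<odot>\<^bsub>M\<^esub> x) \<le> C * rnorm R a * mnorm M x"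
  using banach_module by (auto simp: banach_module_def)

lemma minus_eq_smult: "x \<in> carrier M \<Longrightarrow> \<ominus>\<^bsub>M\<^esub> x = (\<ominus>\<^bsub>R\<^esub> \<one>\<^bsub>R\<^esub>) \<odot>\<^bsub>M\<^esub> x"
  by (simp add: smult_l_minus)

text \<open>The axioms do not make the norm symmetric, but \<open>\<ominus> x = (\<ominus> 1) x\<close> makes it symmetric up to a
  constant.\<close>

lemma minus_bound:
  obtains C where "C > 0" "\<And>x. x \<in> carrier M \<Longrightarrow> mnorm M (\<ominus>\<^bsub>M\<^esub> x) \<le> C * mnorm M x"
proof -
  obtain C where C: "C > 0"
    "\<And>a x. a \<in> carrier R \<Longrightarrow> x \<in> carrier M \<Longrightarrow> mnorm M (a \<odot>\<^bsub>M\<^esub> x) \<le> C * rnorm R a * mnorm M x"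
    by (rule smult_bound) blast
  show ?thesis
  proof
    show "0 < C * (rnorm R (\<ominus>\<^bsub>R\<^esub> \<one>\<^bsub>R\<^esub>) + 1)"
      using C(1) by (intro mult_pos_pos) (auto simp: add_nonneg_pos)
    fix x assume x: "x \<in> carrier M"
    have "mnorm M (\<ominus>\<^bsub>M\<^esub> x) \<le> C * rnorm R (\<ominus>\<^bsub>R\<^esub> \<one>\<^bsub>R\<^esub>) * mnorm M x"
      using C(2)[of "\<ominus>\<^bsub>R\<^esub> \<one>\<^bsub>R\<^esub>" x] x by (simp add: minus_eq_smult)
    also have "\<dots> \<le> C * (rnorm R (\<ominus>\<^bsub>R\<^esub> \<one>\<^bsub>R\<^esub>) + 1) * mnorm M x"
      using C(1) x by (intro mult_right_mono mult_left_mono) auto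
    finally show "mnorm M (\<ominus>\<^bsub>M\<^esub> x) \<le> C * (rnorm R (\<ominus>\<^bsub>R\<^esub> \<one>\<^bsub>R\<^esub>) + 1) * mnorm M x" .
  qed
qed

lemma diff_split:
  "x \<in> carrier M \<Longrightarrow> y \<in> carrier M \<Longrightarrow> z \<in> carrier M \<Longrightarrow>
    x \<ominus>\<^bsub>M\<^esub> z = (x \<ominus>\<^bsub>M\<^esub> y) \<oplus>\<^bsub>M\<^esub> (y \<ominus>\<^bsub>M\<^esub> z)"
  by (simp add: M.minus_eq M.a_assoc M.r_neg2 M.r_neg1)

lemma diff_self [simp]: "x \<in> carrier M \<Longrightarrow> x \<ominus>\<^bsub>M\<^esub> x = \<zero>\<^bsub>M\<^esub>"
  by (simp add: M.minus_eq M.r_neg)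

lemma diff_add_cancel:
  "x \<in> carrier M \<Longrightarrow> y \<in> carrier M \<Longrightarrow> (x \<ominus>\<^bsub>M\<^esub> y) \<oplus>\<^bsub>M\<^esub> y = x"
  by (simp add: M.minus_eq M.a_assoc M.l_neg)

lemma diff_triangle:
  "x \<in> carrier M \<Longrightarrow> y \<in> carrier M \<Longrightarrow> z \<in> carrier M \<Longrightarrow>
    mnorm M (x \<ominus>\<^bsub>M\<^esub> z) \<le> mnorm M (x \<ominus>\<^bsub>M\<^esub> y) + mnorm M (y \<ominus>\<^bsub>M\<^esub> z)"
  by (subst diff_split[of x y z]) (auto intro: norm_triangle)

lemma diff_add_diff:
  "x \<in> carrier M \<Longrightarrow> y \<in> carrier M \<Longrightarrow> x' \<in> carrier M \<Longrightarrow> y' \<in> carrier M \<Longrightarrow>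
    (x \<oplus>\<^bsub>M\<^esub> y) \<ominus>\<^bsub>M\<^esub> (x' \<oplus>\<^bsub>M\<^esub> y') = (x \<ominus>\<^bsub>M\<^esub> x') \<oplus>\<^bsub>M\<^esub> (y \<ominus>\<^bsub>M\<^esub> y')"
  by (simp add: M.minus_eq M.minus_add M.a_ac)

lemma minus_diff:
  "x \<in> carrier M \<Longrightarrow> y \<in> carrier M \<Longrightarrow> \<ominus>\<^bsub>M\<^esub> (x \<ominus>\<^bsub>M\<^esub> y) = y \<ominus>\<^bsub>M\<^esub> x"
  by (simp add: M.minus_eq M.minus_add M.a_comm)

lemma smult_diff:
  "a \<in> carrier R \<Longrightarrow> x \<in> carrier M \<Longrightarrow> y \<in> carrier M \<Longrightarrow>
    a \<odot>\<^bsub>M\<^esub> (x \<ominus>\<^bsub>M\<^esub> y) = a \<odot>\<^bsub>M\<^esub> x \<ominus>\<^bsub>M\<^esub> a \<odot>\<^bsub>M\<^esub> y"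
  by (simp add: M.minus_eq smult_r_distr smult_r_minus)

lemma norm_le_diff:
  assumes "x \<in> carrier M" "y \<in> carrier M"
  shows "mnorm M x \<le> mnorm M (x \<ominus>\<^bsub>M\<^esub> y) + mnorm M y"
  using norm_triangle[of "x \<ominus>\<^bsub>M\<^esub> y" y] assms by (simp add: diff_add_cancel)

lemma norm_finsum_le:
  assumes "finite A" "\<And>i. i \<in> A \<Longrightarrow> y i \<in> carrier M"
  shows "mnorm M (finsum M y A) \<le> (\<Sum>i\<in>A. mnorm M (y i))"
  using assms
proof (induction A rule: finite_induct)
  case (insert i A)
  then have "finsum M y (insert i A) = y i \<oplus>\<^bsub>M\<^esub> finsum M y A" and "finsum M y A \<in> carrier M"
    by (auto intro!: finsum_insert finsum_closed)
  with insert norm_triangle[of "y i" "finsum M y A"] show ?case by simp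
qed simp

end

lemma null_squeeze:
  fixes f g :: "nat \<Rightarrow> real"
  assumes "\<And>n. 0 \<le> f n" "\<And>n. f n \<le> g n" "g \<longlonglongrightarrow> 0"
  shows "f \<longlonglongrightarrow> 0"
  by (rule tendsto_sandwich[of "\<lambda>_. 0" f sequentially g]) (simp_all add: assms)

text \<open>Convergence of a sequence of elements.  The difference is taken in the order used in
  \<^const>\<open>complete_norm\<close>; this matters only up to a constant.\<close>

definition tends :: "('a, 'm) normed_module \<Rightarrow> (nat \<Rightarrow> 'm) \<Rightarrow> 'm \<Rightarrow> bool" where
  "tends M s l \<longleftrightarrow> (\<forall>n. s n \<in> carrier M) \<and> l \<in> carrier M \<and> (\<lambda>n. mnorm M (s n \<ominus>\<^bsub>M\<^esub> l)) \<longlonglongrightarrow> 0"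

context banach_mod
begin

lemma tendsD:
  assumes "tends M s l"
  shows "s n \<in> carrier M" "l \<in> carrier M" "(\<lambda>n. mnorm M (s n \<ominus>\<^bsub>M\<^esub> l)) \<longlonglongrightarrow> 0"
  using assms by (auto simp: tends_def)

lemma tends_sandwich:
  assumes "\<And>n. s n \<in> carrier M" "l \<in> carrier M"
    and "\<And>n. mnorm M (s n \<ominus>\<^bsub>M\<^esub> l) \<le> c n" "c \<longlonglongrightarrow> 0"
  shows "tends M s l"
  unfolding tends_def using assms null_squeeze[of "\<lambda>n. mnorm M (s n \<ominus>\<^bsub>M\<^esub> l)" c] by simp

lemma tends_rev:
  assumes "tends M s l"
  shows "(\<lambda>n. mnorm M (l \<ominus>\<^bsub>M\<^esub> s n)) \<longlonglongrightarrow> 0"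
proof -
  obtain C where C: "C > 0" "\<And>x. x \<in> carrier M \<Longrightarrow> mnorm M (\<ominus>\<^bsub>M\<^esub> x) \<le> C * mnorm M x"
    by (rule minus_bound) blast
  show ?thesis
  proof (rule null_squeeze)
    show "mnorm M (l \<ominus>\<^bsub>M\<^esub> s n) \<le> C * mnorm M (s n \<ominus>\<^bsub>M\<^esub> l)" for n
      using C(2)[of "s n \<ominus>\<^bsub>M\<^esub> l"] tendsD[OF assms] by (simp add: minus_diff)
    show "(\<lambda>n. C * mnorm M (s n \<ominus>\<^bsub>M\<^esub> l)) \<longlonglongrightarrow> 0"
      using tendsto_mult_left[OF tendsD(3)[OF assms], of C] by simp
  qed (use tendsD[OF assms] in simp)
qed

text \<open>Two sequences whose difference tends to zero have the same limit.\<close>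

lemma tends_transfer:
  assumes "tends M s l" "\<And>n. t n \<in> carrier M" "(\<lambda>n. mnorm M (t n \<ominus>\<^bsub>M\<^esub> s n)) \<longlonglongrightarrow> 0"
  shows "tends M t l"
proof (rule tends_sandwich)
  show "mnorm M (t n \<ominus>\<^bsub>M\<^esub> l) \<le> mnorm M (t n \<ominus>\<^bsub>M\<^esub> s n) + mnorm M (s n \<ominus>\<^bsub>M\<^esub> l)" for n
    using tendsD[OF assms(1)] assms(2) by (intro diff_triangle) auto
  show "(\<lambda>n. mnorm M (t n \<ominus>\<^bsub>M\<^esub> s n) + mnorm M (s n \<ominus>\<^bsub>M\<^esub> l)) \<longlonglongrightarrow> 0"
    using tendsto_add[OF assms(3) tendsD(3)[OF assms(1)]] by simp
qed (use tendsD[OF assms(1)] assms(2) in auto)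

lemma tends_const: "l \<in> carrier M \<Longrightarrow> tends M (\<lambda>n. l) l"
  by (auto simp: tends_def)

lemma tends_norm_le:
  assumes "tends M s l" "\<And>n. mnorm M (s n) \<le> c n" "c \<longlonglongrightarrow> b"
  shows "mnorm M l \<le> b"
proof (rule LIMSEQ_le_const)
  show "(\<lambda>n. mnorm M (l \<ominus>\<^bsub>M\<^esub> s n) + c n) \<longlonglongrightarrow> b"
    using tendsto_add[OF tends_rev[OF assms(1)] assms(3)] by simp
  have "mnorm M l \<le> mnorm M (l \<ominus>\<^bsub>M\<^esub> s n) + c n" for n
    using norm_le_diff[of l "s n"] tendsD[OF assms(1)] assms(2)[of n] by fastforce
  then show "\<exists>N. \<forall>n\<ge>N. mnorm M l \<le> mnorm M (l \<ominus>\<^bsub>M\<^esub> s n) + c n" by blast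
qed

lemma tends_add:
  assumes "tends M s l" "tends M t m"
  shows "tends M (\<lambda>n. s n \<oplus>\<^bsub>M\<^esub> t n) (l \<oplus>\<^bsub>M\<^esub> m)"
proof (rule tends_sandwich)
  note D = tendsD[OF assms(1)] tendsD[OF assms(2)]
  show "mnorm M (s n \<oplus>\<^bsub>M\<^esub> t n \<ominus>\<^bsub>M\<^esub> (l \<oplus>\<^bsub>M\<^esub> m)) \<le> mnorm M (s n \<ominus>\<^bsub>M\<^esub> l) + mnorm M (t n \<ominus>\<^bsub>M\<^esub> m)" for n
    using D by (simp add: diff_add_diff norm_triangle)
  show "(\<lambda>n. mnorm M (s n \<ominus>\<^bsub>M\<^esub> l) + mnorm M (t n \<ominus>\<^bsub>M\<^esub> m)) \<longlonglongrightarrow> 0"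
    using tendsto_add[OF D(3,6)] by simp
qed (use tendsD[OF assms(1)] tendsD[OF assms(2)] in auto)

lemma tends_smult:
  assumes "a \<in> carrier R" "tends M s l"
  shows "tends M (\<lambda>n. a \<odot>\<^bsub>M\<^esub> s n) (a \<odot>\<^bsub>M\<^esub> l)"
proof -
  obtain C where C: "C > 0"
    "\<And>a x. a \<in> carrier R \<Longrightarrow> x \<in> carrier M \<Longrightarrow> mnorm M (a \<odot>\<^bsub>M\<^esub> x) \<le> C * rnorm R a * mnorm M x"
    by (rule smult_bound) blast
  note D = tendsD[OF assms(2)]
  show ?thesis
  proof (rule tends_sandwich)
    show "mnorm M (a \<odot>\<^bsub>M\<^esub> s n \<ominus>\<^bsub>M\<^esub> a \<odot>\<^bsub>M\<^esub> l) \<le> C * rnorm R a * mnorm M (s n \<ominus>\<^bsub>M\<^esub> l)" for n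
      using C(2)[OF assms(1), of "s n \<ominus>\<^bsub>M\<^esub> l"] D assms(1) by (simp add: smult_diff)
    show "(\<lambda>n. C * rnorm R a * mnorm M (s n \<ominus>\<^bsub>M\<^esub> l)) \<longlonglongrightarrow> 0"
      using tendsto_mult_left[OF D(3), of "C * rnorm R a"] by simp
  qed (use D assms(1) in auto)
qed

lemma tends_unique:
  assumes "tends M s l" "tends M s m"
  shows "l = m"
proof -
  note D = tendsD[OF assms(1)] tendsD[OF assms(2)]
  have "mnorm M (l \<ominus>\<^bsub>M\<^esub> m) \<le> 0"
  proof (rule LIMSEQ_le_const)
    show "(\<lambda>n. mnorm M (l \<ominus>\<^bsub>M\<^esub> s n) + mnorm M (s n \<ominus>\<^bsub>M\<^esub> m)) \<longlonglongrightarrow> 0"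
      using tendsto_add[OF tends_rev[OF assms(1)] D(6)] by simp
    show "\<exists>N. \<forall>n\<ge>N. mnorm M (l \<ominus>\<^bsub>M\<^esub> m) \<le> mnorm M (l \<ominus>\<^bsub>M\<^esub> s n) + mnorm M (s n \<ominus>\<^bsub>M\<^esub> m)"
      using D by (blast intro: diff_triangle)
  qed
  moreover have "l \<ominus>\<^bsub>M\<^esub> m \<in> carrier M" using D by simp
  ultimately have "l \<ominus>\<^bsub>M\<^esub> m = \<zero>\<^bsub>M\<^esub>"
    using norm_eq_zero_iff norm_nonneg order_antisym by metis
  then show ?thesis using D diff_add_cancel[of l m] by simp
qed

lemma cauchy_tends:
  assumes "\<And>n. s n \<in> carrier M"
    and "\<And>e. e > 0 \<Longrightarrow> \<exists>n0. \<forall>m\<ge>n0. \<forall>n\<ge>n0. mnorm M (s m \<ominus>\<^bsub>M\<^esub> s n) < e"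
  obtains l where "tends M s l"
proof -
  have "\<exists>l\<in>carrier M. (\<lambda>n. mnorm M (s n \<ominus>\<^bsub>M\<^esub> l)) \<longlonglongrightarrow> 0"
    using complete_norm assms unfolding complete_norm_def by blast
  with assms(1) that show ?thesis by (auto simp: tends_def)
qed

lemma finsum_diff:
  fixes m n :: nat
  assumes "m \<le> n" "\<And>i. y i \<in> carrier M"
  shows "finsum M y {..<n} \<ominus>\<^bsub>M\<^esub> finsum M y {..<m} = finsum M y {m..<n}"
proof -
  have "{..<n} = {m..<n} \<union> {..<m}" "{m..<n} \<inter> {..<m} = {}" using assms(1) by auto
  then have "finsum M y {..<n} = finsum M y {m..<n} \<oplus>\<^bsub>M\<^esub> finsum M y {..<m}"
    using assms(2) by (simp add: finsum_Un_disjoint Pi_def)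
  then show ?thesis using assms(2) by (simp add: M.minus_eq M.a_assoc M.r_neg finsum_closed Pi_def)
qed

lemma tends_series:
  assumes y: "\<And>i. y i \<in> carrier M" and sm: "summable (\<lambda>i. mnorm M (y i))"
  obtains l where "tends M (\<lambda>k. finsum M y {..<k}) l" "mnorm M l \<le> (\<Sum>i. mnorm M (y i))"
proof -
  let ?s = "\<lambda>k. finsum M y {..<k}"
  have s: "?s k \<in> carrier M" for k using y by (auto intro: finsum_closed)
  obtain C where C: "C > 0" "\<And>x. x \<in> carrier M \<Longrightarrow> mnorm M (\<ominus>\<^bsub>M\<^esub> x) \<le> C * mnorm M x"
    by (rule minus_bound) blast
  have "\<exists>n0. \<forall>m\<ge>n0. \<forall>n\<ge>n0. mnorm M (?s m \<ominus>\<^bsub>M\<^esub> ?s n) < e" if "e > 0" for e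
  proof (rule cauchy_partial_sums[OF sm _ C(1) _ that])
    show "mnorm M (?s n \<ominus>\<^bsub>M\<^esub> ?s m) \<le> (\<Sum>i=m..<n. mnorm M (y i))" if "m \<le> n" for m n
      using that y norm_finsum_le[of "{m..<n}" y] by (simp add: finsum_diff)
    show "mnorm M (?s m \<ominus>\<^bsub>M\<^esub> ?s n) \<le> C * mnorm M (?s n \<ominus>\<^bsub>M\<^esub> ?s m)" for m n
      using C(2)[of "?s n \<ominus>\<^bsub>M\<^esub> ?s m"] s by (simp add: minus_diff)
  qed
  then obtain l where l: "tends M ?s l" using cauchy_tends[of ?s] s by metis
  moreover have "mnorm M l \<le> (\<Sum>i. mnorm M (y i))"
  proof (rule tends_norm_le[OF l])
    show "mnorm M (?s n) \<le> (\<Sum>i<n. mnorm M (y i))" for n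
      using y by (intro norm_finsum_le) auto
    show "(\<lambda>n. \<Sum>i<n. mnorm M (y i)) \<longlonglongrightarrow> (\<Sum>i. mnorm M (y i))"
      by (rule summable_LIMSEQ[OF sm])
  qed
  ultimately show ?thesis by (rule that)
qed

end


section \<open>Bounded homomorphisms and the internal Hom\<close>

locale banach_mod_pair = M: banach_mod R M + N: banach_mod R N
  for R :: "'a normed_ring" and M :: "('a, 'm) normed_module" and N :: "('a, 'n) normed_module"
begin

lemma bounded_homD:
  assumes "f \<in> bounded_hom R M N"
  shows "x \<in> carrier M \<Longrightarrow> f x \<in> carrier N"
    and "x \<in> carrier M \<Longrightarrow> y \<in> carrier M \<Longrightarrow> f (x \<oplus>\<^bsub>M\<^esub> y) = f x \<oplus>\<^bsub>N\<^esub> f y"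
    and "a \<in> carrier R \<Longrightarrow> x \<in> carrier M \<Longrightarrow> f (a \<odot>\<^bsub>M\<^esub> x) = a \<odot>\<^bsub>N\<^esub> f x"
    and "f \<in> extensional (carrier M)"
  using assms by (auto simp: bounded_hom_def PiE_iff)

lemma bounded_homI:
  assumes "f \<in> extensional (carrier M)"
    and "\<And>x. x \<in> carrier M \<Longrightarrow> f x \<in> carrier N"
    and "\<And>x y. x \<in> carrier M \<Longrightarrow> y \<in> carrier M \<Longrightarrow> f (x \<oplus>\<^bsub>M\<^esub> y) = f x \<oplus>\<^bsub>N\<^esub> f y"
    and "\<And>a x. a \<in> carrier R \<Longrightarrow> x \<in> carrier M \<Longrightarrow> f (a \<odot>\<^bsub>M\<^esub> x) = a \<odot>\<^bsub>N\<^esub> f x"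
    and "\<And>x. x \<in> carrier M \<Longrightarrow> mnorm N (f x) \<le> C * mnorm M x"
  shows "f \<in> bounded_hom R M N"
  unfolding bounded_hom_def PiE_iff using assms by blast

lemma bounded_hom_zero: "f \<in> bounded_hom R M N \<Longrightarrow> f \<zero>\<^bsub>M\<^esub> = \<zero>\<^bsub>N\<^esub>"
  using bounded_homD(3)[of f "\<zero>\<^bsub>R\<^esub>" "\<zero>\<^bsub>M\<^esub>"] bounded_homD(1)[of f "\<zero>\<^bsub>M\<^esub>"] by simp

lemma bounded_hom_minus:
  "f \<in> bounded_hom R M N \<Longrightarrow> x \<in> carrier M \<Longrightarrow> f (\<ominus>\<^bsub>M\<^esub> x) = \<ominus>\<^bsub>N\<^esub> f x"
  using bounded_homD(3)[of f "\<ominus>\<^bsub>R\<^esub> \<one>\<^bsub>R\<^esub>" x]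
  by (simp add: bounded_homD(1) M.minus_eq_smult N.minus_eq_smult)

lemma bounded_hom_diff:
  "f \<in> bounded_hom R M N \<Longrightarrow> x \<in> carrier M \<Longrightarrow> y \<in> carrier M \<Longrightarrow>
    f (x \<ominus>\<^bsub>M\<^esub> y) = f x \<ominus>\<^bsub>N\<^esub> f y"
  by (simp add: M.M.minus_eq N.M.minus_eq bounded_homD bounded_hom_minus)

lemma op_norm_nonneg: "f \<in> bounded_hom R M N \<Longrightarrow> 0 \<le> op_norm M N f"
  and op_norm_bound:
    "f \<in> bounded_hom R M N \<Longrightarrow> x \<in> carrier M \<Longrightarrow> mnorm N (f x) \<le> op_norm M N f * mnorm M x"
proof -
  assume f: "f \<in> bounded_hom R M N"
  let ?B = "{C. 0 \<le> C \<and> (\<forall>x\<in>carrier M. mnorm N (f x) \<le> C * mnorm M x)}"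
  obtain C where C: "\<forall>x\<in>carrier M. mnorm N (f x) \<le> C * mnorm M x"
    using f by (auto simp: bounded_hom_def)
  have "mnorm N (f x) \<le> max C 0 * mnorm M x" if "x \<in> carrier M" for x
    using C that mult_right_mono[of C "max C 0" "mnorm M x"] by fastforce
  then have ne: "?B \<noteq> {}" by (auto intro: exI[of _ "max C 0"])
  then show nn: "0 \<le> op_norm M N f" unfolding op_norm_def by (intro cInf_greatest) auto
  assume x: "x \<in> carrier M"
  show "mnorm N (f x) \<le> op_norm M N f * mnorm M x"
  proof (cases "mnorm M x = 0")
    case True
    then show ?thesis using x M.norm_eq_zero_iff[of x] f by (simp add: bounded_hom_zero)
  next
    case False
    then have pos: "mnorm M x > 0" using M.norm_nonneg[OF x] by linarith
    have "mnorm N (f x) / mnorm M x \<le> op_norm M N f"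
      unfolding op_norm_def using ne pos x by (intro cInf_greatest) (auto simp: field_simps)
    then show ?thesis using pos by (simp add: field_simps)
  qed
qed

lemma op_norm_le:
  assumes "0 \<le> C" "\<And>x. x \<in> carrier M \<Longrightarrow> mnorm N (f x) \<le> C * mnorm M x"
  shows "op_norm M N f \<le> C"
  unfolding op_norm_def using assms by (intro cInf_lower) (auto intro: bdd_belowI[of _ 0])

end

lemma bounded_hom_compose:
  assumes "banach_ring R" "banach_module R X" "banach_module R Y" "banach_module R Z"
    and f: "f \<in> bounded_hom R X Y" and g: "g \<in> bounded_hom R Y Z"
  shows "compose (carrier X) g f \<in> bounded_hom R X Z"
    and "op_norm X Z (compose (carrier X) g f) \<le> op_norm Y Z g * op_norm X Y f"
proof -
  interpret XY: banach_mod_pair R X Y using assms by unfold_locales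
  interpret YZ: banach_mod_pair R Y Z using assms by unfold_locales
  interpret XZ: banach_mod_pair R X Z using assms by unfold_locales
  have le: "mnorm Z (compose (carrier X) g f x) \<le> op_norm Y Z g * op_norm X Y f * mnorm X x"
    if x: "x \<in> carrier X" for x
  proof -
    have "mnorm Z (g (f x)) \<le> op_norm Y Z g * mnorm Y (f x)"
      using YZ.op_norm_bound[OF g, of "f x"] XY.bounded_homD(1)[OF f x] .
    also have "\<dots> \<le> op_norm Y Z g * (op_norm X Y f * mnorm X x)"
      by (intro mult_left_mono XY.op_norm_bound f x YZ.op_norm_nonneg g)
    finally show ?thesis using x by (simp add: compose_def mult.assoc)
  qed
  show "compose (carrier X) g f \<in> bounded_hom R X Z"
    by (rule XZ.bounded_homI[OF _ _ _ _ le])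
      (auto simp: compose_def XY.bounded_homD[OF f] YZ.bounded_homD[OF g] extensional_def)
  show "op_norm X Z (compose (carrier X) g f) \<le> op_norm Y Z g * op_norm X Y f"
    by (rule XZ.op_norm_le[OF _ le]) (auto simp: XY.op_norm_nonneg[OF f] YZ.op_norm_nonneg[OF g])
qed

context banach_mod
begin

lemma tends_diff:
  assumes "tends M s l" "tends M t m"
  shows "tends M (\<lambda>n. s n \<ominus>\<^bsub>M\<^esub> t n) (l \<ominus>\<^bsub>M\<^esub> m)"
proof -
  have "tends M (\<lambda>n. s n \<oplus>\<^bsub>M\<^esub> (\<ominus>\<^bsub>R\<^esub> \<one>\<^bsub>R\<^esub>) \<odot>\<^bsub>M\<^esub> t n) (l \<oplus>\<^bsub>M\<^esub> (\<ominus>\<^bsub>R\<^esub> \<one>\<^bsub>R\<^esub>) \<odot>\<^bsub>M\<^esub> m)"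
    by (intro tends_add tends_smult assms) simp
  then show ?thesis
    using tendsD(1,2)[OF assms(2)] by (simp add: M.minus_eq minus_eq_smult)
qed

lemma tends_shift:
  assumes "tends M s l"
  shows "tends M (\<lambda>n. s (n + k)) l"
  using assms LIMSEQ_ignore_initial_segment[of "\<lambda>n. mnorm M (s n \<ominus>\<^bsub>M\<^esub> l)" 0 k]
  by (simp add: tends_def)

end

lemma internal_hom_simps [simp]:
  "carrier (internal_hom R M N) = bounded_hom R M N"
  "\<zero>\<^bsub>internal_hom R M N\<^esub> = (\<lambda>x\<in>carrier M. \<zero>\<^bsub>N\<^esub>)"
  "f \<oplus>\<^bsub>internal_hom R M N\<^esub> g = (\<lambda>x\<in>carrier M. f x \<oplus>\<^bsub>N\<^esub> g x)"
  "a \<odot>\<^bsub>internal_hom R M N\<^esub> f = (\<lambda>x\<in>carrier M. a \<odot>\<^bsub>N\<^esub> f x)"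
  "mnorm (internal_hom R M N) = op_norm M N"
  by (simp_all add: internal_hom_def)

context banach_mod_pair
begin

lemma bounded_hom_ext:
  "f \<in> bounded_hom R M N \<Longrightarrow> g \<in> bounded_hom R M N \<Longrightarrow> (\<And>x. x \<in> carrier M \<Longrightarrow> f x = g x) \<Longrightarrow> f = g"
  using bounded_homD(4) by (metis extensionalityI)

abbreviation H :: "('a, 'm \<Rightarrow> 'n) normed_module" where
  "H \<equiv> internal_hom R M N"

lemma bounded_hom_zero_mem: "(\<lambda>x\<in>carrier M. \<zero>\<^bsub>N\<^esub>) \<in> bounded_hom R M N"
  by (rule bounded_homI[where C = 0]) auto

lemma bounded_hom_add:
  assumes f: "f \<in> bounded_hom R M N" and g: "g \<in> bounded_hom R M N"
  shows "(\<lambda>x\<in>carrier M. f x \<oplus>\<^bsub>N\<^esub> g x) \<in> bounded_hom R M N" (is "?h \<in> _")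
    and "op_norm M N (\<lambda>x\<in>carrier M. f x \<oplus>\<^bsub>N\<^esub> g x) \<le> op_norm M N f + op_norm M N g"
proof -
  note D = bounded_homD[OF f] bounded_homD[OF g]
  have le: "mnorm N (?h x) \<le> (op_norm M N f + op_norm M N g) * mnorm M x" if x: "x \<in> carrier M" for x
    using N.norm_triangle[of "f x" "g x"] D(1,5)[OF x] op_norm_bound[OF f x] op_norm_bound[OF g x] x
    by (simp add: algebra_simps)
  show "?h \<in> bounded_hom R M N"
  proof (rule bounded_homI[OF _ _ _ _ le])
    show "?h (x \<oplus>\<^bsub>M\<^esub> y) = ?h x \<oplus>\<^bsub>N\<^esub> ?h y" if "x \<in> carrier M" "y \<in> carrier M" for x y
      using that by (simp add: D N.a_ac)
  qed (auto simp: D N.smult_r_distr extensional_def)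
  show "op_norm M N ?h \<le> op_norm M N f + op_norm M N g"
    by (rule op_norm_le[OF _ le]) (simp_all add: op_norm_nonneg f g)
qed

lemma bounded_hom_smult:
  assumes a: "a \<in> carrier R" and f: "f \<in> bounded_hom R M N"
    and C: "C > 0" "\<And>b x. b \<in> carrier R \<Longrightarrow> x \<in> carrier N \<Longrightarrow> mnorm N (b \<odot>\<^bsub>N\<^esub> x) \<le> C * rnorm R b * mnorm N x"
  shows "(\<lambda>x\<in>carrier M. a \<odot>\<^bsub>N\<^esub> f x) \<in> bounded_hom R M N" (is "?h \<in> _")
    and "op_norm M N (\<lambda>x\<in>carrier M. a \<odot>\<^bsub>N\<^esub> f x) \<le> C * rnorm R a * op_norm M N f"
proof -
  note D = bounded_homD[OF f]
  have nn: "0 \<le> C * rnorm R a" using C(1) a by simp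
  have le: "mnorm N (?h x) \<le> C * rnorm R a * op_norm M N f * mnorm M x" if x: "x \<in> carrier M" for x
  proof -
    have "mnorm N (?h x) \<le> C * rnorm R a * mnorm N (f x)"
      using C(2)[OF a D(1)[OF x]] x by simp
    also have "\<dots> \<le> C * rnorm R a * (op_norm M N f * mnorm M x)"
      by (intro mult_left_mono op_norm_bound f x nn)
    finally show ?thesis by (simp add: mult.assoc)
  qed
  show "?h \<in> bounded_hom R M N"
  proof (rule bounded_homI[OF _ _ _ _ le])
    show "?h (b \<odot>\<^bsub>M\<^esub> x) = b \<odot>\<^bsub>N\<^esub> ?h x" if "b \<in> carrier R" "x \<in> carrier M" for b x
      using that a by (simp add: D N.smult_assoc1[symmetric] M.R.m_comm)
  qed (auto simp: D a N.smult_r_distr extensional_def)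
  show "op_norm M N ?h \<le> C * rnorm R a * op_norm M N f"
    by (rule op_norm_le[OF _ le]) (use nn op_norm_nonneg[OF f] in simp_all)
qed

lemma bounded_hom_smult_mem:
  assumes a: "a \<in> carrier R" and f: "f \<in> bounded_hom R M N"
  shows "(\<lambda>x\<in>carrier M. a \<odot>\<^bsub>N\<^esub> f x) \<in> bounded_hom R M N"
  by (rule N.smult_bound) (rule bounded_hom_smult(1)[OF a f])

lemma internal_hom_module: "Module.module R H"
proof (rule moduleI)
  show "cring R" by (rule M.R.is_cring)
  show "abelian_group H"
  proof (rule abelian_groupI)
    fix f assume f: "f \<in> carrier H"
    let ?g = "\<lambda>x\<in>carrier M. (\<ominus>\<^bsub>R\<^esub> \<one>\<^bsub>R\<^esub>) \<odot>\<^bsub>N\<^esub> f x"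
    have "?g \<oplus>\<^bsub>H\<^esub> f = \<zero>\<^bsub>H\<^esub>"
      using f by (auto simp: fun_eq_iff bounded_homD(1) N.smult_l_minus N.M.l_neg)
    moreover have "?g \<in> carrier H"
      using f bounded_hom_smult_mem by simp
    ultimately show "\<exists>g\<in>carrier H. g \<oplus>\<^bsub>H\<^esub> f = \<zero>\<^bsub>H\<^esub>"
      by blast
    show "\<zero>\<^bsub>H\<^esub> \<oplus>\<^bsub>H\<^esub> f = f"
      using f bounded_hom_zero_mem bounded_hom_add(1)[OF bounded_hom_zero_mem, of f]
      by (intro bounded_hom_ext) (simp_all add: bounded_homD(1))
  qed (auto simp: bounded_hom_add bounded_hom_zero_mem fun_eq_iff bounded_homD(1) N.a_ac
      dest: bounded_homD(4) extensional_arb)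
  show "\<one>\<^bsub>R\<^esub> \<odot>\<^bsub>H\<^esub> f = f" if "f \<in> carrier H" for f
    using that bounded_hom_smult_mem[of "\<one>\<^bsub>R\<^esub>" f]
    by (intro bounded_hom_ext) (simp_all add: bounded_homD(1))
qed (auto simp: bounded_hom_smult_mem fun_eq_iff bounded_homD(1,4) N.smult_l_distr N.smult_r_distr
      N.smult_assoc1 extensional_def)

lemma internal_hom_diff:
  assumes "f \<in> bounded_hom R M N" "g \<in> bounded_hom R M N"
  shows "f \<ominus>\<^bsub>H\<^esub> g = (\<lambda>x\<in>carrier M. f x \<ominus>\<^bsub>N\<^esub> g x)"
proof -
  interpret IH: Module.module R H by (rule internal_hom_module)
  have "\<ominus>\<^bsub>H\<^esub> g = (\<ominus>\<^bsub>R\<^esub> \<one>\<^bsub>R\<^esub>) \<odot>\<^bsub>H\<^esub> g"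
    using assms by (subst IH.smult_l_minus) (simp_all del: internal_hom_simps(4))
  then show ?thesis
    using assms by (simp add: IH.minus_eq N.M.minus_eq fun_eq_iff bounded_homD(1) N.smult_l_minus)
qed

text \<open>A Cauchy sequence of bounded maps converges to its pointwise limit.\<close>

lemma internal_hom_complete:
  assumes s: "\<And>n. s n \<in> bounded_hom R M N"
    and cauchy: "\<And>e. e > 0 \<Longrightarrow> \<exists>n0. \<forall>m\<ge>n0. \<forall>n\<ge>n0. op_norm M N (s m \<ominus>\<^bsub>H\<^esub> s n) < e"
  shows "\<exists>l\<in>bounded_hom R M N. (\<lambda>n. op_norm M N (s n \<ominus>\<^bsub>H\<^esub> l)) \<longlonglongrightarrow> 0"
proof -
  interpret IH: Module.module R H by (rule internal_hom_module)
  have dmem: "f \<ominus>\<^bsub>H\<^esub> g \<in> bounded_hom R M N"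
    if "f \<in> bounded_hom R M N" "g \<in> bounded_hom R M N" for f g
    using IH.minus_closed[of f g] that by simp
  have le: "mnorm N (f x \<ominus>\<^bsub>N\<^esub> g x) \<le> op_norm M N (f \<ominus>\<^bsub>H\<^esub> g) * mnorm M x"
    if "f \<in> bounded_hom R M N" "g \<in> bounded_hom R M N" "x \<in> carrier M" for f g x
    using op_norm_bound[OF dmem[OF that(1,2)] that(3)] that by (simp add: internal_hom_diff)
  have ex: "\<exists>y. tends N (\<lambda>n. s n x) y" if x: "x \<in> carrier M" for x
  proof -
    have "\<exists>n0. \<forall>m\<ge>n0. \<forall>n\<ge>n0. mnorm N (s m x \<ominus>\<^bsub>N\<^esub> s n x) < e" if "e > 0" for e
    proof (rule cauchy_scale[OF cauchy _ _ that])
      show "mnorm N (s m x \<ominus>\<^bsub>N\<^esub> s n x) \<le> mnorm M x * op_norm M N (s m \<ominus>\<^bsub>H\<^esub> s n)" for m n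
        using le[OF s s x] by (simp add: mult.commute)
    qed (use x in simp_all)
    then show ?thesis using N.cauchy_tends[of "\<lambda>n. s n x"] bounded_homD(1)[OF s x] by metis
  qed
  define l where "l = (\<lambda>x\<in>carrier M. THE y. tends N (\<lambda>n. s n x) y)"
  have l: "tends N (\<lambda>n. s n x) (l x)" if x: "x \<in> carrier M" for x
    using ex[OF x] N.tends_unique by (simp add: l_def x) (metis theI)
  have bnd: "mnorm N (s n x \<ominus>\<^bsub>N\<^esub> l x) \<le> e * mnorm M x"
    if n0: "\<And>m n. m \<ge> n0 \<Longrightarrow> n \<ge> n0 \<Longrightarrow> op_norm M N (s m \<ominus>\<^bsub>H\<^esub> s n) < e"
      and n: "n \<ge> n0" and x: "x \<in> carrier M" for n0 n e x
  proof (rule N.tends_norm_le)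
    show "tends N (\<lambda>m. s n x \<ominus>\<^bsub>N\<^esub> s (m + n0) x) (s n x \<ominus>\<^bsub>N\<^esub> l x)"
      by (intro N.tends_diff N.tends_const N.tends_shift[OF l[OF x]] bounded_homD(1)[OF s x])
    show "mnorm N (s n x \<ominus>\<^bsub>N\<^esub> s (m + n0) x) \<le> e * mnorm M x" for m
      using le[OF s s x, of n "m + n0"] n0[OF n, of "m + n0"] x
        mult_right_mono[of "op_norm M N (s n \<ominus>\<^bsub>H\<^esub> s (m + n0))" e "mnorm M x"]
      by simp
  qed simp
  have lmem: "l \<in> bounded_hom R M N"
  proof -
    obtain n0 where n0: "\<And>m n. m \<ge> n0 \<Longrightarrow> n \<ge> n0 \<Longrightarrow>
        op_norm M N (s m \<ominus>\<^bsub>H\<^esub> s n) < 1"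
      using cauchy[of 1] by auto
    show ?thesis
    proof (rule bounded_homI)
      show "l \<in> extensional (carrier M)" by (simp add: l_def)
      show "l x \<in> carrier N" if "x \<in> carrier M" for x using l[OF that] N.tendsD by blast
      show "l (x \<oplus>\<^bsub>M\<^esub> y) = l x \<oplus>\<^bsub>N\<^esub> l y" if "x \<in> carrier M" "y \<in> carrier M" for x y
        using N.tends_unique[OF l[of "x \<oplus>\<^bsub>M\<^esub> y"]] N.tends_add[OF l[of x] l[of y]] that
        by (simp add: bounded_homD(2)[OF s])
      show "l (a \<odot>\<^bsub>M\<^esub> x) = a \<odot>\<^bsub>N\<^esub> l x" if "a \<in> carrier R" "x \<in> carrier M" for a x
        using N.tends_unique[OF l[of "a \<odot>\<^bsub>M\<^esub> x"]] N.tends_smult[OF _ l[of x], of a] that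
        by (simp add: bounded_homD(3)[OF s])
      show "mnorm N (l x) \<le> (1 + op_norm M N (s n0)) * mnorm M x" if x: "x \<in> carrier M" for x
      proof (rule N.tends_norm_le[OF N.tends_shift[OF l[OF x]]])
        show "mnorm N (s (m + n0) x) \<le> (1 + op_norm M N (s n0)) * mnorm M x" for m
        proof -
          have "mnorm N (s (m + n0) x) \<le> mnorm N (s (m + n0) x \<ominus>\<^bsub>N\<^esub> s n0 x) + mnorm N (s n0 x)"
            by (intro N.norm_le_diff bounded_homD(1)[OF s x])
          also have "\<dots> \<le> 1 * mnorm M x + op_norm M N (s n0) * mnorm M x"
            using le[OF s s x, of "m + n0" n0] op_norm_bound[OF s x, of n0] x n0[of "m + n0" n0]
              mult_right_mono[of "op_norm M N (s (m + n0) \<ominus>\<^bsub>H\<^esub> s n0)" 1 "mnorm M x"]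
            by simp
          finally show ?thesis by (simp add: algebra_simps)
        qed
      qed simp
    qed
  qed
  have "(\<lambda>n. op_norm M N (s n \<ominus>\<^bsub>H\<^esub> l)) \<longlonglongrightarrow> 0"
  proof (rule LIMSEQ_I)
    fix e :: real assume e: "e > 0"
    then obtain n0 where n0: "\<And>m n. m \<ge> n0 \<Longrightarrow> n \<ge> n0 \<Longrightarrow>
        op_norm M N (s m \<ominus>\<^bsub>H\<^esub> s n) < e / 2"
      using cauchy[of "e / 2"] by auto
    have "op_norm M N (s n \<ominus>\<^bsub>H\<^esub> l) \<le> e / 2" if "n \<ge> n0" for n
      using bnd[OF n0 that] e by (intro op_norm_le) (auto simp: internal_hom_diff s lmem)
    then show "\<exists>n0. \<forall>n\<ge>n0. norm (op_norm M N (s n \<ominus>\<^bsub>H\<^esub> l) - 0) < e"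
      using e op_norm_nonneg[OF dmem[OF s lmem]] by (intro exI[of _ n0]) fastforce
  qed
  with lmem show ?thesis by blast
qed

lemma internal_hom_banach: "banach_module R H"
proof -
  have zero_iff: "op_norm M N f = 0 \<longleftrightarrow> f = (\<lambda>x\<in>carrier M. \<zero>\<^bsub>N\<^esub>)" if f: "f \<in> bounded_hom R M N" for f
  proof
    assume "op_norm M N f = 0"
    have "f x = \<zero>\<^bsub>N\<^esub>" if x: "x \<in> carrier M" for x
    proof -
      have "mnorm N (f x) \<le> 0" using op_norm_bound[OF f x] \<open>op_norm M N f = 0\<close> by simp
      then have "mnorm N (f x) = 0" using bounded_homD(1)[OF f x] by (intro order_antisym) simp_all
      then show ?thesis using bounded_homD(1)[OF f x] by (simp add: N.norm_eq_zero_iff)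
    qed
    then show "f = (\<lambda>x\<in>carrier M. \<zero>\<^bsub>N\<^esub>)"
      by (intro bounded_hom_ext f bounded_hom_zero_mem) simp
  next
    assume "f = (\<lambda>x\<in>carrier M. \<zero>\<^bsub>N\<^esub>)"
    then have "op_norm M N f \<le> 0" by (intro op_norm_le) auto
    with op_norm_nonneg[OF f] show "op_norm M N f = 0" by simp
  qed
  have "complete_norm H (mnorm H)"
    unfolding complete_norm_def
    by (intro conjI ballI allI impI)
      (auto simp: op_norm_nonneg zero_iff bounded_hom_add range_subsetD intro!: internal_hom_complete)
  moreover obtain C where "C > 0"
    "\<And>b x. b \<in> carrier R \<Longrightarrow> x \<in> carrier N \<Longrightarrow> mnorm N (b \<odot>\<^bsub>N\<^esub> x) \<le> C * rnorm R b * mnorm N x"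
    by (rule N.smult_bound) blast
  ultimately show ?thesis
    unfolding banach_module_def using internal_hom_module bounded_hom_smult(2)[of _ _ C] by auto
qed

end

subsection \<open>Weighted copies of the ring\<close>

lemma weighted_copy_simps [simp]:
  "carrier (weighted_copy R r) = carrier R"
  "\<zero>\<^bsub>weighted_copy R r\<^esub> = \<zero>\<^bsub>R\<^esub>"
  "a \<oplus>\<^bsub>weighted_copy R r\<^esub> b = a \<oplus>\<^bsub>R\<^esub> b"
  "a \<odot>\<^bsub>weighted_copy R r\<^esub> b = a \<otimes>\<^bsub>R\<^esub> b"
  "mnorm (weighted_copy R r) a = r * rnorm R a"
  by (simp_all add: weighted_copy_def)

lemma weighted_copy_module:
  assumes "banach_ring R"
  shows "Module.module R (weighted_copy R r)"
proof -
  interpret cring R using assms by (simp add: banach_ring_def)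
  show ?thesis
    by (rule moduleI[OF is_cring abelian_groupI])
      (auto simp: a_ac l_distr r_distr m_assoc intro: bexI[of _ "\<ominus>\<^bsub>R\<^esub> _"] l_neg)
qed

lemma weighted_copy_diff:
  assumes "banach_ring R" "a \<in> carrier R" "b \<in> carrier R"
  shows "a \<ominus>\<^bsub>weighted_copy R r\<^esub> b = a \<ominus>\<^bsub>R\<^esub> b"
proof -
  interpret cring R using assms by (simp add: banach_ring_def)
  interpret W: Module.module R "weighted_copy R r" using assms(1) by (rule weighted_copy_module)
  have "\<ominus>\<^bsub>weighted_copy R r\<^esub> b = (\<ominus>\<^bsub>R\<^esub> \<one>\<^bsub>R\<^esub>) \<odot>\<^bsub>weighted_copy R r\<^esub> b"
    using assms by (subst W.smult_l_minus) (simp_all del: weighted_copy_simps(4))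
  then show ?thesis using assms by (simp add: W.minus_eq minus_eq l_minus)
qed

lemma weighted_copy_banach:
  fixes R :: "'a normed_ring"
  assumes R: "banach_ring R" and r: "r > 0"
  shows "banach_module R (weighted_copy R r)"
proof -
  interpret cring R using R by (simp add: banach_ring_def)
  have cn: "complete_norm R (rnorm R)" using R by (simp add: banach_ring_def)
  have "complete_norm (weighted_copy R r) (mnorm (weighted_copy R r))"
    unfolding complete_norm_def
  proof (intro conjI ballI allI impI)
    fix s :: "nat \<Rightarrow> 'a" assume s: "range s \<subseteq> carrier (weighted_copy R r)"
      and cau: "\<forall>e>0. \<exists>n0. \<forall>m\<ge>n0. \<forall>n\<ge>n0. mnorm (weighted_copy R r) (s m \<ominus>\<^bsub>weighted_copy R r\<^esub> s n) < e"
    have sm: "s n \<in> carrier R" for n using s by auto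
    have "\<exists>n0. \<forall>m\<ge>n0. \<forall>n\<ge>n0. rnorm R (s m \<ominus>\<^bsub>R\<^esub> s n) < e" if "e > 0" for e
    proof -
      have "r * e > 0" using r that by simp
      with cau obtain n0 where "\<forall>m\<ge>n0. \<forall>n\<ge>n0. r * rnorm R (s m \<ominus>\<^bsub>R\<^esub> s n) < r * e"
        by (auto simp: weighted_copy_diff[OF R sm sm])
      then show ?thesis using r by auto
    qed
    moreover have "range s \<subseteq> carrier R \<longrightarrow>
        (\<forall>e>0. \<exists>n0. \<forall>m\<ge>n0. \<forall>n\<ge>n0. rnorm R (s m \<ominus>\<^bsub>R\<^esub> s n) < e) \<longrightarrow>
        (\<exists>l\<in>carrier R. (\<lambda>n. rnorm R (s n \<ominus>\<^bsub>R\<^esub> l)) \<longlonglongrightarrow> 0)"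
      using cn unfolding complete_norm_def by blast
    ultimately obtain l where l: "l \<in> carrier R" "(\<lambda>n. rnorm R (s n \<ominus>\<^bsub>R\<^esub> l)) \<longlonglongrightarrow> 0"
      using s by auto
    then have "(\<lambda>n. mnorm (weighted_copy R r) (s n \<ominus>\<^bsub>weighted_copy R r\<^esub> l)) \<longlonglongrightarrow> 0"
      using tendsto_mult_left[OF l(2), of r] by (simp add: weighted_copy_diff[OF R sm])
    with l(1) show "\<exists>l\<in>carrier (weighted_copy R r).
        (\<lambda>n. mnorm (weighted_copy R r) (s n \<ominus>\<^bsub>weighted_copy R r\<^esub> l)) \<longlonglongrightarrow> 0" by auto
  next
    fix x y assume "x \<in> carrier (weighted_copy R r)" "y \<in> carrier (weighted_copy R r)"
    then have "rnorm R (x \<oplus>\<^bsub>R\<^esub> y) \<le> rnorm R x + rnorm R y" using cn by (simp add: complete_norm_def)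
    then show "mnorm (weighted_copy R r) (x \<oplus>\<^bsub>weighted_copy R r\<^esub> y)
        \<le> mnorm (weighted_copy R r) x + mnorm (weighted_copy R r) y"
      using r by (simp add: distrib_left[symmetric])
  qed (use cn r in \<open>auto simp: complete_norm_def\<close>)
  moreover obtain C where C: "C > 0"
    "\<And>a b. a \<in> carrier R \<Longrightarrow> b \<in> carrier R \<Longrightarrow> rnorm R (a \<otimes>\<^bsub>R\<^esub> b) \<le> C * rnorm R a * rnorm R b"
    using R by (auto simp: banach_ring_def)
  have "r * rnorm R (a \<otimes>\<^bsub>R\<^esub> b) \<le> C * rnorm R a * (r * rnorm R b)"
    if "a \<in> carrier R" "b \<in> carrier R" for a b
    using mult_left_mono[OF C(2)[OF that], of r] r by (simp add: mult_ac)
  ultimately show ?thesis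
    unfolding banach_module_def using weighted_copy_module[OF R] C(1) by auto
qed

lemma dual_banach:
  assumes "banach_ring R" "banach_module R M"
  shows "banach_module R (dual R M)"
proof -
  interpret banach_mod_pair R M "unit_module R"
    using assms by (unfold_locales) (auto intro: weighted_copy_banach)
  show ?thesis unfolding dual_def by (rule internal_hom_banach)
qed

section \<open>The completed projective tensor product\<close>

text \<open>The norm of a representing list, of which the projective seminorm is the infimum.\<close>

definition rep_norm :: "('a, 'm) normed_module \<Rightarrow> ('a, 'n) normed_module \<Rightarrow> ('m \<times> 'n) list \<Rightarrow> real" where
  "rep_norm M N xs = (\<Sum>(m, n)\<leftarrow>xs. mnorm M m * mnorm N n)"

text \<open>The negative and the scalar multiples of a tensor, on representing lists: they act on the
  left factors.\<close>

definition neg_rep :: "('a, 'm) normed_module \<Rightarrow> ('m \<times> 'n) list \<Rightarrow> ('m \<times> 'n) list" where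
  "neg_rep M xs = map (\<lambda>(m, n). (\<ominus>\<^bsub>M\<^esub> m, n)) xs"

definition smult_rep :: "('a, 'm) normed_module \<Rightarrow> 'a \<Rightarrow> ('m \<times> 'n) list \<Rightarrow> ('m \<times> 'n) list" where
  "smult_rep M a xs = map (\<lambda>(m, n). (a \<odot>\<^bsub>M\<^esub> m, n)) xs"

lemma rep_norm_simps [simp]:
  "rep_norm M N [] = 0"
  "rep_norm M N (x # xs) = mnorm M (fst x) * mnorm N (snd x) + rep_norm M N xs"
  "rep_norm M N (xs @ ys) = rep_norm M N xs + rep_norm M N ys"
  by (simp_all add: rep_norm_def case_prod_unfold)

lemma rep_norm_map: "rep_norm M N (map z [k..<l]) = (\<Sum>i=k..<l. mnorm M (fst (z i)) * mnorm N (snd (z i)))"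
  by (simp add: rep_norm_def case_prod_unfold o_def interv_sum_list_conv_sum_set_nat)

lemma neg_rep_simps [simp]:
  "neg_rep M [] = []"
  "neg_rep M (x # xs) = (\<ominus>\<^bsub>M\<^esub> fst x, snd x) # neg_rep M xs"
  "neg_rep M (xs @ ys) = neg_rep M xs @ neg_rep M ys"
  by (simp_all add: neg_rep_def case_prod_unfold)

lemma smult_rep_simps [simp]:
  "smult_rep M a [] = []"
  "smult_rep M a (x # xs) = (a \<odot>\<^bsub>M\<^esub> fst x, snd x) # smult_rep M a xs"
  "smult_rep M a (xs @ ys) = smult_rep M a xs @ smult_rep M a ys"
  by (simp_all add: smult_rep_def case_prod_unfold)

lemma proj_dist_eq: "proj_dist R M N xs ys = proj_seminorm R M N (xs @ neg_rep M ys)"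
  by (simp add: proj_dist_def neg_rep_def)

context banach_mod_pair
begin

text \<open>The lists that represent a tensor.\<close>

abbreviation valid :: "('m \<times> 'n) list \<Rightarrow> bool" where
  "valid xs \<equiv> set xs \<subseteq> carrier M \<times> carrier N"

abbreviation teq :: "('m \<times> 'n) list \<Rightarrow> ('m \<times> 'n) list \<Rightarrow> bool" where
  "teq \<equiv> tensor_eq R M N"

abbreviation psn :: "('m \<times> 'n) list \<Rightarrow> real" where
  "psn \<equiv> proj_seminorm R M N"

abbreviation pdist :: "('m \<times> 'n) list \<Rightarrow> ('m \<times> 'n) list \<Rightarrow> real" where
  "pdist \<equiv> proj_dist R M N"

lemma valid_neg_rep [simp]: "valid xs \<Longrightarrow> valid (neg_rep M xs)"
  by (auto simp: neg_rep_def)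

lemma valid_smult_rep [simp]: "a \<in> carrier R \<Longrightarrow> valid xs \<Longrightarrow> valid (smult_rep M a xs)"
  by (auto simp: smult_rep_def)

lemma neg_rep_eq_smult: "valid xs \<Longrightarrow> neg_rep M xs = smult_rep M (\<ominus>\<^bsub>R\<^esub> \<one>\<^bsub>R\<^esub>) xs"
  by (auto simp: neg_rep_def smult_rep_def M.minus_eq_smult)

lemma neg_rep_neg_rep: "valid xs \<Longrightarrow> neg_rep M (neg_rep M xs) = xs"
  by (induction xs) auto

lemma smult_neg_rep:
  "a \<in> carrier R \<Longrightarrow> valid xs \<Longrightarrow> smult_rep M a (neg_rep M xs) = neg_rep M (smult_rep M a xs)"
  by (induction xs) (auto simp: M.smult_r_minus)

lemma rep_norm_nonneg: "valid xs \<Longrightarrow> 0 \<le> rep_norm M N xs"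
  by (induction xs) auto

declare tensor_eq.trans [trans]

lemma teq_valid: "teq xs ys \<Longrightarrow> valid xs \<and> valid ys"
  by (induction rule: tensor_eq.induct) auto

text \<open>A tensor does not depend on the order of its summands.  Identities between sums of tensors
  are proved below by rearranging lists in this way.\<close>

lemma teq_perm: "valid xs \<Longrightarrow> mset xs = mset ys \<Longrightarrow> teq xs ys"
proof (induction xs arbitrary: ys)
  case (Cons x xs)
  then obtain as bs where ys: "ys = as @ x # bs"
    by (metis list.set_intros(1) set_mset_mset split_list)
  have "set (as @ x # bs) = set (x # xs)"
    using mset_eq_setD[OF Cons.prems(2)] by (simp only: ys)
  then have "valid (as @ x # bs)" "valid (x # xs)" using Cons.prems(1) by (simp_all only:)
  then have v: "valid as" "valid bs" "valid [x]" and "valid xs" by auto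
  moreover have "mset xs = mset (as @ bs)" using Cons.prems(2) ys by simp
  ultimately have "teq xs (as @ bs)" by (intro Cons.IH)
  then have "teq ([x] @ xs) ([x] @ as @ bs)"
    using v by (intro tensor_eq.append tensor_eq.refl)
  also have "[x] @ as @ bs = ([x] @ as) @ bs" by simp
  also have "teq \<dots> ((as @ [x]) @ bs)"
    using v by (intro tensor_eq.append tensor_eq.refl tensor_eq.commute)
  finally show ?case using ys by simp
qed (auto intro: tensor_eq.refl)

lemma teq_smult:
  assumes a: "a \<in> carrier R" and "teq xs ys"
  shows "teq (smult_rep M a xs) (smult_rep M a ys)"
  using assms(2)
proof (induction rule: tensor_eq.induct)
  fix b m n assume *: "b \<in> carrier R" "m \<in> carrier M" "n \<in> carrier N"
  then have "a \<odot>\<^bsub>M\<^esub> (b \<odot>\<^bsub>M\<^esub> m) = b \<odot>\<^bsub>M\<^esub> (a \<odot>\<^bsub>M\<^esub> m)"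
    using a by (simp add: M.smult_assoc1[symmetric] M.R.m_comm)
  with * a show "teq (smult_rep M a [(b \<odot>\<^bsub>M\<^esub> m, n)]) (smult_rep M a [(m, b \<odot>\<^bsub>N\<^esub> n)])"
    by (simp add: tensor_eq.balanced)
next
  fix xs assume "valid xs"
  then show "teq (smult_rep M a xs) (smult_rep M a xs)" using a by (intro tensor_eq.refl valid_smult_rep)
next
  fix xs ys assume "valid xs" "valid ys"
  then show "teq (smult_rep M a (xs @ ys)) (smult_rep M a (ys @ xs))"
    using a tensor_eq.commute[of "smult_rep M a xs" M N "smult_rep M a ys"] by simp
qed (use a in \<open>auto intro: tensor_eq.intros simp: M.smult_r_distr\<close>)

lemma teq_neg_cancel: "valid xs \<Longrightarrow> teq (xs @ neg_rep M xs) []"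
proof (induction xs)
  case (Cons x xs)
  obtain m n where x: "x = (m, n)" by (cases x)
  then have mn: "m \<in> carrier M" "n \<in> carrier N" and v: "valid xs" using Cons.prems by auto
  let ?c = "[(m, n), (\<ominus>\<^bsub>M\<^esub> m, n)]"
  have "teq ((x # xs) @ neg_rep M (x # xs)) (?c @ (xs @ neg_rep M xs))"
    using Cons.prems valid_neg_rep[OF v] by (intro teq_perm) (auto simp: x)
  also have "teq \<dots> ([] @ [])"
  proof (rule tensor_eq.append[OF _ Cons.IH[OF v]])
    have "teq ?c [(m \<oplus>\<^bsub>M\<^esub> \<ominus>\<^bsub>M\<^esub> m, n)]"
      using mn by (intro tensor_eq.sym[OF tensor_eq.add_left]) auto
    also have "teq \<dots> []" using mn by (simp add: M.M.r_neg tensor_eq.zero)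
    finally show "teq ?c []" .
  qed
  finally show ?case by simp
qed (auto intro: tensor_eq.refl)

lemma teq_append_cancel: "valid xs \<Longrightarrow> teq ys [] \<Longrightarrow> teq (xs @ ys) xs"
  using tensor_eq.append[OF tensor_eq.refl, of xs M N R ys "[]"] by simp

lemma psn_eq: "psn xs = Inf (rep_norm M N ` {ys. teq xs ys})"
  unfolding proj_seminorm_def rep_norm_def by (simp add: setcompr_eq_image)

lemma psn_le: "teq xs ys \<Longrightarrow> psn xs \<le> rep_norm M N ys"
  unfolding psn_eq
proof (rule cINF_lower)
  show "bdd_below (rep_norm M N ` {ys. teq xs ys})"
    by (rule bdd_belowI2[of _ 0]) (simp add: rep_norm_nonneg teq_valid)
qed simp

lemma psn_approx:
  assumes "valid xs" "e > 0"
  obtains ys where "teq xs ys" "rep_norm M N ys < psn xs + e"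
proof -
  have "teq xs xs" using assms(1) by (rule tensor_eq.refl)
  moreover have "Inf (rep_norm M N ` {ys. teq xs ys}) < psn xs + e" using assms(2) by (simp add: psn_eq)
  ultimately show ?thesis using that cInf_lessD[of "rep_norm M N ` {ys. teq xs ys}"] by blast
qed

lemma psn_nonneg:
  assumes "valid xs"
  shows "0 \<le> psn xs"
proof -
  have "teq xs xs" using assms by (rule tensor_eq.refl)
  then show ?thesis unfolding psn_eq
    by (intro cINF_greatest) (auto simp: rep_norm_nonneg dest: teq_valid)
qed

lemma psn_cong: "teq xs ys \<Longrightarrow> psn xs = psn ys"
  unfolding proj_seminorm_def by (meson tensor_eq.sym tensor_eq.trans)

lemma psn_le_rep_norm: "valid xs \<Longrightarrow> psn xs \<le> rep_norm M N xs"
  by (intro psn_le tensor_eq.refl)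

lemma psn_Nil [simp]: "psn [] = 0"
  using psn_le_rep_norm[of "[]"] psn_nonneg[of "[]"] by simp

lemma psn_append:
  assumes "valid xs" "valid ys"
  shows "psn (xs @ ys) \<le> psn xs + psn ys"
proof (rule field_le_epsilon)
  fix e :: real assume "e > 0"
  then have e: "e / 2 > 0" by simp
  obtain xs' where x: "teq xs xs'" "rep_norm M N xs' < psn xs + e / 2"
    using psn_approx[OF assms(1) e] .
  obtain ys' where y: "teq ys ys'" "rep_norm M N ys' < psn ys + e / 2"
    using psn_approx[OF assms(2) e] .
  show "psn (xs @ ys) \<le> psn xs + psn ys + e"
    using psn_le[OF tensor_eq.append[OF x(1) y(1)]] x(2) y(2) by simp
qed

lemma psn_smult_bound:
  obtains C where "C > 0"
    "\<And>a xs. a \<in> carrier R \<Longrightarrow> valid xs \<Longrightarrow> psn (smult_rep M a xs) \<le> C * rnorm R a * psn xs"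
proof -
  obtain C where C: "C > 0"
    "\<And>a x. a \<in> carrier R \<Longrightarrow> x \<in> carrier M \<Longrightarrow> mnorm M (a \<odot>\<^bsub>M\<^esub> x) \<le> C * rnorm R a * mnorm M x"
    by (rule M.smult_bound) blast
  have rep: "rep_norm M N (smult_rep M a xs) \<le> C * rnorm R a * rep_norm M N xs"
    if a: "a \<in> carrier R" and xs: "valid xs" for a xs
    using xs
  proof (induction xs)
    case (Cons x xs)
    then have "mnorm M (a \<odot>\<^bsub>M\<^esub> fst x) * mnorm N (snd x) \<le> (C * rnorm R a * mnorm M (fst x)) * mnorm N (snd x)"
      using a by (intro mult_right_mono C) auto
    with Cons show ?case by (simp add: algebra_simps)
  qed simp
  show ?thesis
  proof (rule that[OF C(1)])
    fix a xs assume a: "a \<in> carrier R" and xs: "valid xs"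
    define D where "D = C * rnorm R a"
    have D: "D \<ge> 0" using C(1) a by (simp add: D_def)
    show "psn (smult_rep M a xs) \<le> C * rnorm R a * psn xs"
    proof (rule field_le_epsilon)
      fix e :: real assume e: "e > 0"
      have "e / (D + 1) > 0" using e D by simp
      from psn_approx[OF xs this] obtain ys where
        y: "teq xs ys" "rep_norm M N ys < psn xs + e / (D + 1)" .
      have "psn (smult_rep M a xs) \<le> rep_norm M N (smult_rep M a ys)"
        by (rule psn_le[OF teq_smult[OF a y(1)]])
      also have "\<dots> \<le> D * rep_norm M N ys" using rep[OF a] teq_valid[OF y(1)] by (simp add: D_def)
      also have "\<dots> \<le> D * (psn xs + e / (D + 1))" using y(2) D by (intro mult_left_mono) auto
      also have "\<dots> \<le> D * psn xs + e" using D e by (simp add: field_simps)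
      finally show "psn (smult_rep M a xs) \<le> C * rnorm R a * psn xs + e" by (simp add: D_def)
    qed
  qed
qed

lemma psn_neg_bound:
  obtains C where "C > 0" "\<And>xs. valid xs \<Longrightarrow> psn (neg_rep M xs) \<le> C * psn xs"
proof -
  obtain C where C: "C > 0"
    "\<And>a xs. a \<in> carrier R \<Longrightarrow> valid xs \<Longrightarrow> psn (smult_rep M a xs) \<le> C * rnorm R a * psn xs"
    by (rule psn_smult_bound) blast
  define r where "r = rnorm R (\<ominus>\<^bsub>R\<^esub> \<one>\<^bsub>R\<^esub>)"
  have r: "r \<ge> 0" by (simp add: r_def)
  show ?thesis
  proof (rule that)
    show "C * (r + 1) > 0" using C(1) r by simp
    fix xs assume xs: "valid xs"
    have "psn (neg_rep M xs) \<le> C * r * psn xs"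
      using C(2)[OF _ xs, of "\<ominus>\<^bsub>R\<^esub> \<one>\<^bsub>R\<^esub>"] xs by (simp add: neg_rep_eq_smult r_def)
    also have "\<dots> \<le> C * (r + 1) * psn xs"
      using C(1) psn_nonneg[OF xs] by (intro mult_right_mono mult_left_mono) auto
    finally show "psn (neg_rep M xs) \<le> C * (r + 1) * psn xs" .
  qed
qed

lemma pdist_nonneg: "valid xs \<Longrightarrow> valid ys \<Longrightarrow> 0 \<le> pdist xs ys"
  using psn_nonneg[of "xs @ neg_rep M ys"] valid_neg_rep[of ys] by (simp add: proj_dist_eq)

lemma pdist_teq: "teq xs ys \<Longrightarrow> pdist xs ys = 0"
proof -
  assume t: "teq xs ys"
  then have "teq (xs @ neg_rep M ys) (ys @ neg_rep M ys)"
    using teq_valid[OF t] by (intro tensor_eq.append tensor_eq.refl) auto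
  also have "teq \<dots> []" using teq_valid[OF t] by (intro teq_neg_cancel) auto
  finally show ?thesis using psn_cong by (fastforce simp: proj_dist_eq)
qed

lemma pdist_triangle:
  assumes "valid xs" "valid ys" "valid zs"
  shows "pdist xs zs \<le> pdist xs ys + pdist ys zs"
proof -
  have v: "valid (neg_rep M ys)" "valid (neg_rep M zs)" using assms by simp_all
  have "teq ((xs @ neg_rep M zs) @ (ys @ neg_rep M ys)) (xs @ neg_rep M zs)"
    using assms v by (intro teq_append_cancel teq_neg_cancel) auto
  moreover have "teq ((xs @ neg_rep M zs) @ (ys @ neg_rep M ys)) ((xs @ neg_rep M ys) @ (ys @ neg_rep M zs))"
    using assms v by (intro teq_perm) auto
  ultimately have "psn (xs @ neg_rep M zs) = psn ((xs @ neg_rep M ys) @ (ys @ neg_rep M zs))"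
    using psn_cong by metis
  also have "\<dots> \<le> psn (xs @ neg_rep M ys) + psn (ys @ neg_rep M zs)"
    using assms v by (intro psn_append) auto
  finally show ?thesis by (simp add: proj_dist_eq)
qed

lemma pdist_sym_bound:
  obtains C where "C > 0" "\<And>xs ys. valid xs \<Longrightarrow> valid ys \<Longrightarrow> pdist ys xs \<le> C * pdist xs ys"
proof -
  obtain C where C: "C > 0" "\<And>xs. valid xs \<Longrightarrow> psn (neg_rep M xs) \<le> C * psn xs"
    by (rule psn_neg_bound) blast
  show ?thesis
  proof (rule that[OF C(1)])
    fix xs ys assume v: "valid xs" "valid ys"
    then have v': "valid (neg_rep M xs)" "valid (neg_rep M ys)" by simp_all
    have "teq (ys @ neg_rep M xs) (neg_rep M (xs @ neg_rep M ys))"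
      using v v' by (intro teq_perm) (auto simp: neg_rep_neg_rep)
    then have "pdist ys xs = psn (neg_rep M (xs @ neg_rep M ys))" by (simp add: proj_dist_eq psn_cong)
    also have "\<dots> \<le> C * pdist xs ys" unfolding proj_dist_eq using v v' by (intro C) auto
    finally show "pdist ys xs \<le> C * pdist xs ys" .
  qed
qed

lemma psn_le_pdist:
  assumes "valid xs" "valid ys"
  shows "psn xs \<le> psn ys + pdist xs ys"
proof -
  have v: "valid (neg_rep M ys)" using assms by simp
  have "teq (xs @ (ys @ neg_rep M ys)) xs"
    using assms v by (intro teq_append_cancel teq_neg_cancel) auto
  moreover have "teq (xs @ (ys @ neg_rep M ys)) (ys @ (xs @ neg_rep M ys))"
    using assms v by (intro teq_perm) auto
  ultimately have "psn xs = psn (ys @ (xs @ neg_rep M ys))" using psn_cong by metis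
  also have "\<dots> \<le> psn ys + pdist xs ys"
    unfolding proj_dist_eq using assms v by (intro psn_append) auto
  finally show ?thesis .
qed

lemma pdist_append:
  assumes "valid xs" "valid ys" "valid xs'" "valid ys'"
  shows "pdist (xs @ ys) (xs' @ ys') \<le> pdist xs xs' + pdist ys ys'"
proof -
  have v: "valid (neg_rep M xs')" "valid (neg_rep M ys')" using assms by simp_all
  have "teq ((xs @ ys) @ neg_rep M (xs' @ ys')) ((xs @ neg_rep M xs') @ (ys @ neg_rep M ys'))"
    using assms v by (intro teq_perm) auto
  then have "pdist (xs @ ys) (xs' @ ys') = psn ((xs @ neg_rep M xs') @ (ys @ neg_rep M ys'))"
    by (simp add: proj_dist_eq psn_cong)
  also have "\<dots> \<le> pdist xs xs' + pdist ys ys'"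
    unfolding proj_dist_eq using assms v by (intro psn_append) auto
  finally show ?thesis .
qed

lemma pdist_smult_bound:
  obtains C where "C > 0"
    "\<And>a xs ys. a \<in> carrier R \<Longrightarrow> valid xs \<Longrightarrow> valid ys \<Longrightarrow>
      pdist (smult_rep M a xs) (smult_rep M a ys) \<le> C * rnorm R a * pdist xs ys"
proof -
  obtain C where C: "C > 0"
    "\<And>a xs. a \<in> carrier R \<Longrightarrow> valid xs \<Longrightarrow> psn (smult_rep M a xs) \<le> C * rnorm R a * psn xs"
    by (rule psn_smult_bound) blast
  show ?thesis
  proof (rule that[OF C(1)])
    fix a xs ys assume *: "a \<in> carrier R" "valid xs" "valid ys"
    have "valid (xs @ neg_rep M ys)" using * valid_neg_rep[of ys] by simp
    from C(2)[OF *(1) this] show "pdist (smult_rep M a xs) (smult_rep M a ys) \<le> C * rnorm R a * pdist xs ys"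
      using * by (simp add: proj_dist_eq smult_neg_rep)
  qed
qed

lemma pdist_prefix:
  assumes "valid xs" "valid ys"
  shows "pdist (xs @ ys) xs \<le> rep_norm M N ys"
proof -
  have v: "valid (neg_rep M xs)" using assms by simp
  have "teq ((xs @ ys) @ neg_rep M xs) (ys @ (xs @ neg_rep M xs))"
    using assms v by (intro teq_perm) auto
  also have "teq \<dots> ys" using assms by (intro teq_append_cancel teq_neg_cancel)
  finally show ?thesis unfolding proj_dist_eq by (rule psn_le)
qed

subsection \<open>Classes of Cauchy sequences\<close>

abbreviation TC :: "(nat \<Rightarrow> ('m \<times> 'n) list) set" where
  "TC \<equiv> tensor_cauchy R M N"

abbreviation null_rel :: "(nat \<Rightarrow> ('m \<times> 'n) list) rel" where
  "null_rel \<equiv> tensor_null_rel R M N"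

text \<open>The element of the completed tensor product given by a Cauchy sequence of lists.\<close>

definition tclass :: "(nat \<Rightarrow> ('m \<times> 'n) list) \<Rightarrow> (nat \<Rightarrow> ('m \<times> 'n) list) set" where
  "tclass s = null_rel `` {s}"

lemma cauchy_valid: "s \<in> TC \<Longrightarrow> valid (s k)"
  by (simp add: tensor_cauchy_def)

lemma cauchyD: "s \<in> TC \<Longrightarrow> e > 0 \<Longrightarrow> \<exists>k0. \<forall>k\<ge>k0. \<forall>l\<ge>k0. pdist (s k) (s l) < e"
  by (simp add: tensor_cauchy_def)

lemma cauchyI:
  assumes "\<And>k. valid (s k)" "\<And>e. e > 0 \<Longrightarrow> \<exists>k0. \<forall>k\<ge>k0. \<forall>l\<ge>k0. pdist (s k) (s l) < e"
  shows "s \<in> TC"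
  using assms by (simp add: tensor_cauchy_def)

lemma null_relI:
  assumes "s \<in> TC" "t \<in> TC" "\<And>k. pdist (s k) (t k) \<le> c k" "c \<longlonglongrightarrow> 0"
  shows "(s, t) \<in> null_rel"
proof -
  have "(\<lambda>k. pdist (s k) (t k)) \<longlonglongrightarrow> 0"
    by (rule null_squeeze[OF _ assms(3,4)]) (simp add: pdist_nonneg cauchy_valid assms)
  then show ?thesis using assms by (simp add: tensor_null_rel_def)
qed

lemma null_relD:
  assumes "(s, t) \<in> null_rel"
  shows "s \<in> TC" "t \<in> TC" "(\<lambda>k. pdist (s k) (t k)) \<longlonglongrightarrow> 0"
  using assms by (auto simp: tensor_null_rel_def)

lemma equiv_null_rel: "equiv TC null_rel"
proof (rule equivI)
  show "null_rel \<subseteq> TC \<times> TC" by (auto dest: null_relD)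
  show "refl_on TC null_rel"
    by (rule refl_onI) (auto intro!: null_relI[where c = "\<lambda>_. 0"] simp: pdist_teq tensor_eq.refl cauchy_valid)
  show "sym null_rel"
  proof (rule symI)
    fix s t assume st: "(s, t) \<in> null_rel"
    note D = null_relD[OF st]
    obtain C where C: "C > 0" "\<And>xs ys. valid xs \<Longrightarrow> valid ys \<Longrightarrow> pdist ys xs \<le> C * pdist xs ys"
      by (rule pdist_sym_bound) blast
    show "(t, s) \<in> null_rel"
    proof (rule null_relI)
      show "pdist (t k) (s k) \<le> C * pdist (s k) (t k)" for k
        by (intro C cauchy_valid D)
      show "(\<lambda>k. C * pdist (s k) (t k)) \<longlonglongrightarrow> 0"
        using tendsto_mult_left[OF D(3), of C] by simp
    qed (use D in auto)
  qed
  show "trans null_rel"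
  proof (rule transI)
    fix s t u assume "(s, t) \<in> null_rel" "(t, u) \<in> null_rel"
    note D = null_relD[OF this(1)] null_relD[OF this(2)]
    show "(s, u) \<in> null_rel"
    proof (rule null_relI)
      show "pdist (s k) (u k) \<le> pdist (s k) (t k) + pdist (t k) (u k)" for k
        by (intro pdist_triangle cauchy_valid D)
      show "(\<lambda>k. pdist (s k) (t k) + pdist (t k) (u k)) \<longlonglongrightarrow> 0"
        using tendsto_add[OF D(3,6)] by simp
    qed (use D in auto)
  qed
qed

lemma tclass_eq_iff: "s \<in> TC \<Longrightarrow> t \<in> TC \<Longrightarrow> tclass s = tclass t \<longleftrightarrow> (s, t) \<in> null_rel"
  unfolding tclass_def using equiv_null_rel by (simp add: eq_equiv_class_iff)

lemma in_tclass: "s \<in> TC \<Longrightarrow> s \<in> tclass s"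
  unfolding tclass_def by (rule equiv_class_self[OF equiv_null_rel])

lemma null_rel_teq: "s \<in> TC \<Longrightarrow> t \<in> TC \<Longrightarrow> (\<And>k. teq (s k) (t k)) \<Longrightarrow> (s, t) \<in> null_rel"
  by (rule null_relI[where c = "\<lambda>_. 0"]) (auto simp: pdist_teq)

lemma cauchy_const: "valid xs \<Longrightarrow> (\<lambda>k. xs) \<in> TC"
  by (rule cauchyI) (auto simp: pdist_teq tensor_eq.refl)

lemma cauchy_append:
  assumes "s \<in> TC" "t \<in> TC"
  shows "(\<lambda>k. s k @ t k) \<in> TC"
proof (rule cauchyI)
  note v = cauchy_valid[OF assms(1)] cauchy_valid[OF assms(2)]
  fix e :: real assume "e > 0"
  then have e: "e / 2 > 0" by simp
  obtain k0 where k0: "\<And>k l. k \<ge> k0 \<Longrightarrow> l \<ge> k0 \<Longrightarrow> pdist (s k) (s l) < e / 2"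
    using cauchyD[OF assms(1) e] by blast
  obtain k1 where k1: "\<And>k l. k \<ge> k1 \<Longrightarrow> l \<ge> k1 \<Longrightarrow> pdist (t k) (t l) < e / 2"
    using cauchyD[OF assms(2) e] by blast
  have "pdist (s k @ t k) (s l @ t l) < e" if "k \<ge> max k0 k1" "l \<ge> max k0 k1" for k l
    using pdist_append[OF v(1)[of k] v(2)[of k] v(1)[of l] v(2)[of l]] k0[of k l] k1[of k l] that by simp
  then show "\<exists>k0. \<forall>k\<ge>k0. \<forall>l\<ge>k0. pdist (s k @ t k) (s l @ t l) < e" by blast
qed (use cauchy_valid[OF assms(1)] cauchy_valid[OF assms(2)] in auto)

lemma null_rel_append:
  assumes "(s, s') \<in> null_rel" "(t, t') \<in> null_rel"
  shows "(\<lambda>k. s k @ t k, \<lambda>k. s' k @ t' k) \<in> null_rel"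
proof -
  note D = null_relD[OF assms(1)] null_relD[OF assms(2)]
  show ?thesis
  proof (rule null_relI)
    show "pdist (s k @ t k) (s' k @ t' k) \<le> pdist (s k) (s' k) + pdist (t k) (t' k)" for k
      by (intro pdist_append cauchy_valid D)
    show "(\<lambda>k. pdist (s k) (s' k) + pdist (t k) (t' k)) \<longlonglongrightarrow> 0"
      using tendsto_add[OF D(3,6)] by simp
  qed (intro cauchy_append D)+
qed

lemma cauchy_smult:
  assumes a: "a \<in> carrier R" and s: "s \<in> TC"
  shows "(\<lambda>k. smult_rep M a (s k)) \<in> TC"
proof (rule cauchyI)
  obtain C where C: "C > 0"
    "\<And>a xs ys. a \<in> carrier R \<Longrightarrow> valid xs \<Longrightarrow> valid ys \<Longrightarrow>
      pdist (smult_rep M a xs) (smult_rep M a ys) \<le> C * rnorm R a * pdist xs ys"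
    by (rule pdist_smult_bound) blast
  show "\<exists>k0. \<forall>k\<ge>k0. \<forall>l\<ge>k0. pdist (smult_rep M a (s k)) (smult_rep M a (s l)) < e" if "e > 0" for e
    by (rule cauchy_scale[OF cauchyD[OF s] _ C(2)[OF a cauchy_valid[OF s] cauchy_valid[OF s]] that])
      (use C(1) a in simp_all)
qed (simp add: a cauchy_valid[OF s])

lemma null_rel_smult:
  assumes a: "a \<in> carrier R" and st: "(s, t) \<in> null_rel"
  shows "(\<lambda>k. smult_rep M a (s k), \<lambda>k. smult_rep M a (t k)) \<in> null_rel"
proof -
  note D = null_relD[OF st]
  obtain C where C: "C > 0"
    "\<And>a xs ys. a \<in> carrier R \<Longrightarrow> valid xs \<Longrightarrow> valid ys \<Longrightarrow>
      pdist (smult_rep M a xs) (smult_rep M a ys) \<le> C * rnorm R a * pdist xs ys"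
    by (rule pdist_smult_bound) blast
  show ?thesis
  proof (rule null_relI)
    show "pdist (smult_rep M a (s k)) (smult_rep M a (t k)) \<le> C * rnorm R a * pdist (s k) (t k)" for k
      by (intro C a cauchy_valid D)
    show "(\<lambda>k. C * rnorm R a * pdist (s k) (t k)) \<longlonglongrightarrow> 0"
      using tendsto_mult_left[OF D(3), of "C * rnorm R a"] by simp
  qed (intro cauchy_smult a D)+
qed

lemma ctensor_carrier: "p \<in> carrier (ctensor R M N) \<longleftrightarrow> (\<exists>s\<in>TC. p = tclass s)"
  by (auto simp: ctensor_def quotient_def tclass_def)

lemma tclass_carrier [simp]: "s \<in> TC \<Longrightarrow> tclass s \<in> carrier (ctensor R M N)"
  by (auto simp: ctensor_carrier)

lemma ctensor_add:
  assumes "s \<in> TC" "t \<in> TC"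
  shows "tclass s \<oplus>\<^bsub>ctensor R M N\<^esub> tclass t = tclass (\<lambda>k. s k @ t k)"
proof -
  have "congruent2 null_rel null_rel (\<lambda>s t. tclass (\<lambda>k. s k @ t k))"
  proof (rule congruent2I')
    fix s s' t t' assume *: "(s, s') \<in> null_rel" "(t, t') \<in> null_rel"
    note D = null_relD[OF *(1)] null_relD[OF *(2)]
    show "tclass (\<lambda>k. s k @ t k) = tclass (\<lambda>k. s' k @ t' k)"
      by (simp add: tclass_eq_iff cauchy_append D null_rel_append *)
  qed
  from UN_equiv_class2[OF equiv_null_rel equiv_null_rel this assms] show ?thesis
    by (simp add: ctensor_def tclass_def)
qed

lemma ctensor_smult:
  assumes "a \<in> carrier R" "s \<in> TC"
  shows "a \<odot>\<^bsub>ctensor R M N\<^esub> tclass s = tclass (\<lambda>k. smult_rep M a (s k))"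
proof -
  have "congruent null_rel (\<lambda>s. tclass (\<lambda>k. smult_rep M a (s k)))"
  proof (rule congruentI)
    fix s t assume *: "(s, t) \<in> null_rel"
    note D = null_relD[OF *]
    show "tclass (\<lambda>k. smult_rep M a (s k)) = tclass (\<lambda>k. smult_rep M a (t k))"
      by (simp add: tclass_eq_iff cauchy_smult D null_rel_smult * assms)
  qed
  from UN_equiv_class[OF equiv_null_rel this assms(2)] show ?thesis
    by (simp add: ctensor_def tclass_def smult_rep_def)
qed

text \<open>The definite description in the norm of the completed tensor product is meaningful: the
  seminorms along a Cauchy sequence converge, and the limit depends only on its class.\<close>

lemma ctensor_norm:
  assumes s: "s \<in> TC"
  shows "(\<lambda>k. psn (s k)) \<longlonglongrightarrow> mnorm (ctensor R M N) (tclass s)"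
proof -
  have "Cauchy (\<lambda>k. psn (s k))"
  proof (rule metric_CauchyI)
    fix e :: real assume "e > 0"
    from cauchyD[OF s this] obtain k0 where k0: "\<And>k l. k \<ge> k0 \<Longrightarrow> l \<ge> k0 \<Longrightarrow> pdist (s k) (s l) < e"
      by blast
    have "dist (psn (s k)) (psn (s l)) < e" if "k \<ge> k0" "l \<ge> k0" for k l
      using psn_le_pdist[OF cauchy_valid[OF s] cauchy_valid[OF s], of k l]
        psn_le_pdist[OF cauchy_valid[OF s] cauchy_valid[OF s], of l k] k0[of k l] k0[of l k] that
      by (simp add: dist_real_def abs_less_iff)
    then show "\<exists>k0. \<forall>k\<ge>k0. \<forall>l\<ge>k0. dist (psn (s k)) (psn (s l)) < e" by blast
  qed
  then obtain c where c: "(\<lambda>k. psn (s k)) \<longlonglongrightarrow> c"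
    by (auto simp: Cauchy_convergent_iff convergent_def)
  have "(\<lambda>k. psn (t k)) \<longlonglongrightarrow> c" if t: "t \<in> tclass s" for t
  proof -
    have st: "(s, t) \<in> null_rel" using t by (simp add: tclass_def)
    then have ts: "(t, s) \<in> null_rel" using equiv_null_rel by (auto elim: equivE dest: symD)
    note D = null_relD[OF st] null_relD[OF ts]
    show ?thesis
    proof (rule tendsto_sandwich)
      show "\<forall>\<^sub>F k in sequentially. psn (s k) - pdist (s k) (t k) \<le> psn (t k)"
        using psn_le_pdist[OF cauchy_valid[OF D(1)] cauchy_valid[OF D(2)]]
        by (intro always_eventually) (simp add: algebra_simps)
      show "\<forall>\<^sub>F k in sequentially. psn (t k) \<le> psn (s k) + pdist (t k) (s k)"
        using psn_le_pdist[OF cauchy_valid[OF D(2)] cauchy_valid[OF D(1)]]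
        by (intro always_eventually) simp
      show "(\<lambda>k. psn (s k) - pdist (s k) (t k)) \<longlonglongrightarrow> c"
        using tendsto_diff[OF c D(3)] by simp
      show "(\<lambda>k. psn (s k) + pdist (t k) (s k)) \<longlonglongrightarrow> c"
        using tendsto_add[OF c D(6)] by simp
    qed
  qed
  moreover have "c' = c" if "\<forall>t\<in>tclass s. (\<lambda>k. psn (t k)) \<longlonglongrightarrow> c'" for c'
    using that in_tclass[OF s] c LIMSEQ_unique by blast
  ultimately have "(THE c. \<forall>t\<in>tclass s. (\<lambda>k. psn (t k)) \<longlonglongrightarrow> c) = c"
    by (intro the_equality) auto
  with c show ?thesis by (simp add: ctensor_def)
qed

lemma pure_tensor_eq: "pure_tensor R M N m n = tclass (\<lambda>k. [(m, n)])"
  by (simp add: pure_tensor_def tclass_def)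

subsection \<open>Elements as absolutely convergent series\<close>

lemma series_cauchy:
  assumes z: "\<And>i. z i \<in> carrier M \<times> carrier N"
    and sm: "summable (\<lambda>i. mnorm M (fst (z i)) * mnorm N (snd (z i)))"
  shows "(\<lambda>k. map z [0..<k]) \<in> TC"
proof (rule cauchyI)
  have v: "valid (map z [k..<l])" for k l by (simp add: z image_subset_iff)
  show "valid (map z [0..<k])" for k by (rule v)
  obtain C where C: "C > 0" "\<And>xs ys. valid xs \<Longrightarrow> valid ys \<Longrightarrow> pdist ys xs \<le> C * pdist xs ys"
    by (rule pdist_sym_bound) blast
  show "\<exists>k0. \<forall>k\<ge>k0. \<forall>l\<ge>k0. pdist (map z [0..<k]) (map z [0..<l]) < e" if "e > 0" for e
  proof (rule cauchy_partial_sums[OF sm _ C(1) C(2)[OF v v] that])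
    fix k l :: nat assume "k \<le> l"
    then have "map z [0..<l] = map z [0..<k] @ map z [k..<l]"
      by (metis le_add_diff_inverse map_append upt_add_eq_append zero_le)
    then show "pdist (map z [0..<l]) (map z [0..<k])
        \<le> (\<Sum>i=k..<l. mnorm M (fst (z i)) * mnorm N (snd (z i)))"
      using pdist_prefix[OF v[of 0 k] v[of k l]] by (simp add: rep_norm_map)
  qed
qed

end

text \<open>Infinitely many nonempty lists are concatenated into one sequence \<open>z\<close>, whose initial segments
  include all finite concatenations.\<close>

lemma concat_sequence:
  fixes ys :: "nat \<Rightarrow> 'b list"
  assumes ne: "\<And>j. ys j \<noteq> []" and F: "\<And>j. F j = concat (map ys [0..<j])"
  obtains z where "\<And>j. map z [0..<length (F j)] = F j" "\<And>i. \<exists>j. z i \<in> set (ys j)"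
    "\<And>j. j \<le> length (F j)"
proof -
  have FS: "F (Suc j) = F j @ ys j" for j by (simp add: F)
  have len: "j \<le> length (F j)" for j
  proof (induction j)
    case (Suc j)
    have "length (ys j) \<ge> 1" using ne[of j] by (cases "ys j") auto
    with Suc show ?case by (simp add: FS)
  qed simp
  have ext: "F b ! i = F a ! i" if "a \<le> b" "i < length (F a)" for a b i
    using that
  proof (induction rule: dec_induct)
    case (step n)
    have "length (F a) \<le> length (F n)"
      using step.hyps(1) by (induction rule: dec_induct) (auto simp: FS)
    with step show ?case by (simp add: FS nth_append)
  qed simp
  define z where "z = (\<lambda>i. F (Suc i) ! i)"
  have zF: "z i = F j ! i" if "i < length (F j)" for i j
    using ext[of "Suc i" j i] ext[of j "Suc i" i] that len[of "Suc i"]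
    by (cases "Suc i \<le> j") (auto simp: z_def)
  show ?thesis
  proof (rule that)
    show "map z [0..<length (F j)] = F j" for j by (rule nth_equalityI) (auto simp: zF)
    show "\<exists>j. z i \<in> set (ys j)" for i
      using nth_mem[of i "F (Suc i)"] len[of "Suc i"] by (auto simp: z_def F)
  qed (rule len)
qed

context banach_mod_pair
begin

text \<open>Every element of the completed tensor product is the sum of a series of elementary tensors
  with \<open>\<Sum> \<parallel>m\<^sub>i\<parallel> \<parallel>n\<^sub>i\<parallel>\<close> finite: pass to a subsequence whose successive differences have seminorm less
  than \<open>2 ^ (- j)\<close> and represent each difference by a list of norm less than that.\<close>

lemma series_representation:
  assumes s: "s \<in> TC"
  obtains z where "\<And>i. z i \<in> carrier M \<times> carrier N"
    "summable (\<lambda>i. mnorm M (fst (z i)) * mnorm N (snd (z i)))"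
    "(s, \<lambda>k. map z [0..<k]) \<in> null_rel"
proof -
  have "\<exists>k0. \<forall>k\<ge>k0. \<forall>l\<ge>k0. pdist (s k) (s l) < (1/2) ^ j" for j :: nat
    by (rule cauchyD[OF s]) simp
  then obtain K where K: "\<And>j k l. k \<ge> K j \<Longrightarrow> l \<ge> K j \<Longrightarrow> pdist (s k) (s l) < (1/2) ^ j"
    by metis
  \<comment> \<open>an increasing choice of indices that dominates both \<open>K\<close> and the identity\<close>
  define q where "q = (\<lambda>j. (\<Sum>i\<le>j. K i) + j)"
  have q: "q j \<ge> K j" "q (Suc j) \<ge> K j" "q j \<ge> j" for j
    using member_le_sum[of j "{..j}" K] by (auto simp: q_def)
  have "\<exists>ys. teq (s (q (Suc j)) @ neg_rep M (s (q j))) ys \<and> rep_norm M N ys < (1/2) ^ j" for j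
  proof -
    define e where "e = (1/2) ^ j - pdist (s (q (Suc j))) (s (q j))"
    have e: "e > 0" using K[OF q(2) q(1), of j] by (simp add: e_def)
    have "valid (s (q (Suc j)) @ neg_rep M (s (q j)))"
      using cauchy_valid[OF s] valid_neg_rep[OF cauchy_valid[OF s]] by auto
    from psn_approx[OF this e] obtain ys where "teq (s (q (Suc j)) @ neg_rep M (s (q j))) ys"
      "rep_norm M N ys < psn (s (q (Suc j)) @ neg_rep M (s (q j))) + e" .
    then show ?thesis by (auto simp: e_def proj_dist_eq)
  qed
  then obtain Y where Y: "\<And>j. teq (s (q (Suc j)) @ neg_rep M (s (q j))) (Y j)"
      "\<And>j. rep_norm M N (Y j) < (1/2) ^ j"
    by metis
  \<comment> \<open>a zero tensor is added to each list, because \<open>concat_sequence\<close> needs nonempty lists\<close>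
  let ?o = "[(\<zero>\<^bsub>M\<^esub>, \<zero>\<^bsub>N\<^esub>)]"
  define ys where "ys = (\<lambda>j. (case j of 0 \<Rightarrow> s (q 0) | Suc i \<Rightarrow> Y i) @ ?o)"
  have o: "teq ?o []" by (simp add: tensor_eq.zero)
  have ne: "ys j \<noteq> []" for j by (simp add: ys_def)
  have yv: "valid (ys j)" for j
    using teq_valid[OF Y(1)] cauchy_valid[OF s, of "q 0"] by (auto simp: ys_def split: nat.split)
  define F where "F j = concat (map ys [0..<j])" for j
  obtain z where z: "\<And>j. map z [0..<length (F j)] = F j" "\<And>i. \<exists>j. z i \<in> set (ys j)"
    "\<And>j. j \<le> length (F j)"
    by (rule concat_sequence[of ys F, OF ne F_def]) blast
  have FS: "F (Suc j) = F j @ ys j" for j by (simp add: F_def)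
  have Fs: "teq (F (Suc j)) (s (q j))" for j
  proof (induction j)
    case 0
    show ?case using teq_append_cancel[OF cauchy_valid[OF s] o, of "q 0"] by (simp add: F_def ys_def)
  next
    case (Suc j)
    have v: "valid (s k)" "valid (neg_rep M (s k))" for k by (simp_all add: cauchy_valid[OF s])
    have "teq (ys (Suc j)) (Y j)"
      using teq_append_cancel[OF _ o, of "Y j"] teq_valid[OF Y(1)] by (simp add: ys_def)
    also have "teq (Y j) (s (q (Suc j)) @ neg_rep M (s (q j)))" by (rule tensor_eq.sym[OF Y(1)])
    finally
    have "teq (F (Suc j) @ ys (Suc j)) (s (q j) @ (s (q (Suc j)) @ neg_rep M (s (q j))))"
      by (rule tensor_eq.append[OF Suc.IH])
    also have "teq \<dots> (s (q (Suc j)) @ (s (q j) @ neg_rep M (s (q j))))"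
      using v by (intro teq_perm) auto
    also have "teq \<dots> (s (q (Suc j)))" using v by (intro teq_append_cancel teq_neg_cancel)
    finally show ?case by (simp add: FS)
  qed
  have zc: "z i \<in> carrier M \<times> carrier N" for i using z(2)[of i] yv by blast
  let ?w = "\<lambda>i. mnorm M (fst (z i)) * mnorm N (snd (z i))"
  have w0: "0 \<le> ?w i" for i using zc[of i] by (auto simp: mem_Times_iff)
  have sm: "summable ?w"
  proof (rule summableI_nonneg_bounded[OF w0])
    fix n
    have "(\<Sum>i<n. ?w i) \<le> (\<Sum>i<length (F n). ?w i)"
      using z(3)[of n] w0 by (intro sum_mono2) auto
    also have "\<dots> = rep_norm M N (F n)"
      using rep_norm_map[of M N z 0 "length (F n)"] by (simp add: z(1) atLeast0LessThan)
    \<comment> \<open>the first list has no smallness bound, so the geometric estimate starts at \<open>F (Suc 0)\<close>\<close>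
    also have "\<dots> \<le> rep_norm M N (F (Suc n))" using rep_norm_nonneg[OF yv[of n]] by (simp add: FS)
    also have "\<dots> \<le> rep_norm M N (s (q 0)) + 2 - 2 * (1/2) ^ n"
    proof (induction n)
      case (Suc n)
      have "rep_norm M N (F (Suc (Suc n))) = rep_norm M N (F (Suc n)) + rep_norm M N (Y n)"
        by (subst FS) (simp add: ys_def)
      with Suc Y(2)[of n] show ?case by simp
    qed (simp add: F_def ys_def)
    also have "\<dots> \<le> rep_norm M N (s (q 0)) + 2" by simp
    finally show "(\<Sum>i<n. ?w i) \<le> rep_norm M N (s (q 0)) + 2" .
  qed
  have tc: "(\<lambda>k. map z [0..<k]) \<in> TC" by (rule series_cauchy[OF zc sm])
  have "(\<lambda>k. pdist (s k) (map z [0..<k])) \<longlonglongrightarrow> 0"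
  proof (rule LIMSEQ_I)
    fix e :: real assume "e > 0"
    then have e: "e / 2 > 0" by simp
    obtain k0 where k0: "\<And>k l. k \<ge> k0 \<Longrightarrow> l \<ge> k0 \<Longrightarrow> pdist (s k) (s l) < e / 2"
      using cauchyD[OF s e] by blast
    obtain k1 where k1: "\<And>k l. k \<ge> k1 \<Longrightarrow> l \<ge> k1 \<Longrightarrow> pdist (map z [0..<k]) (map z [0..<l]) < e / 2"
      using cauchyD[OF tc e] by blast
    define j where "j = max k0 k1"
    define L where "L = length (F (Suc j))"
    have jk: "q j \<ge> k0" "L \<ge> k1" using q(3)[of j] z(3)[of "Suc j"] by (auto simp: j_def L_def)
    \<comment> \<open>compare through the index \<open>q j\<close> of \<open>s\<close> and the length \<open>L\<close>, where both sequences represent the same tensor\<close>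
    have "pdist (s k) (map z [0..<k]) < e" if "k \<ge> j" for k
    proof -
      note v = cauchy_valid[OF s] cauchy_valid[OF tc]
      have "pdist (s k) (map z [0..<k]) \<le> pdist (s k) (s (q j)) + pdist (s (q j)) (map z [0..<k])"
        by (rule pdist_triangle[OF v(1) v(1) v(2)])
      also have "\<dots> \<le> pdist (s k) (s (q j)) +
          (pdist (s (q j)) (map z [0..<L]) + pdist (map z [0..<L]) (map z [0..<k]))"
        by (intro add_left_mono pdist_triangle[OF v(1) v(2) v(2)])
      also have "pdist (s (q j)) (map z [0..<L]) = 0"
        unfolding L_def z(1) by (rule pdist_teq[OF tensor_eq.sym[OF Fs]])
      finally show ?thesis using k0[of k "q j"] k1[of L k] jk that by (simp add: j_def)
    qed
    then show "\<exists>n0. \<forall>k\<ge>n0. norm (pdist (s k) (map z [0..<k]) - 0) < e"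
      using pdist_nonneg[OF cauchy_valid[OF s] cauchy_valid[OF tc]] by (auto intro!: exI[of _ j])
  qed
  then have "(s, \<lambda>k. map z [0..<k]) \<in> null_rel" using s tc by (simp add: tensor_null_rel_def)
  with zc sm show ?thesis by (rule that)
qed

end

section \<open>The universal property of the completed tensor product\<close>

text \<open>The value \<open>\<Sum> b m\<^sub>i n\<^sub>i\<close> of a bilinear map on a representing list.\<close>

primrec tensor_eval :: "('a, 'u) normed_module \<Rightarrow> ('m \<Rightarrow> 'n \<Rightarrow> 'u) \<Rightarrow> ('m \<times> 'n) list \<Rightarrow> 'u" where
  "tensor_eval U b [] = \<zero>\<^bsub>U\<^esub>"
| "tensor_eval U b (x # xs) = b (fst x) (snd x) \<oplus>\<^bsub>U\<^esub> tensor_eval U b xs"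

text \<open>A bounded \<open>R\<close>-bilinear map \<open>b\<close> from \<open>M \<times> N\<close> to a Banach module \<open>U\<close>.\<close>

locale balanced_map = banach_mod_pair R M N + U: banach_mod R U
  for R :: "'a normed_ring" and M :: "('a, 'm) normed_module" and N :: "('a, 'n) normed_module"
    and U :: "('a, 'u) normed_module" +
  fixes b :: "'m \<Rightarrow> 'n \<Rightarrow> 'u"
  assumes b_closed [simp]: "m \<in> carrier M \<Longrightarrow> n \<in> carrier N \<Longrightarrow> b m n \<in> carrier U"
    and b_add_left: "m \<in> carrier M \<Longrightarrow> m' \<in> carrier M \<Longrightarrow> n \<in> carrier N \<Longrightarrow>
      b (m \<oplus>\<^bsub>M\<^esub> m') n = b m n \<oplus>\<^bsub>U\<^esub> b m' n"
    and b_add_right: "m \<in> carrier M \<Longrightarrow> n \<in> carrier N \<Longrightarrow> n' \<in> carrier N \<Longrightarrow>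
      b m (n \<oplus>\<^bsub>N\<^esub> n') = b m n \<oplus>\<^bsub>U\<^esub> b m n'"
    and b_smult_left: "a \<in> carrier R \<Longrightarrow> m \<in> carrier M \<Longrightarrow> n \<in> carrier N \<Longrightarrow>
      b (a \<odot>\<^bsub>M\<^esub> m) n = a \<odot>\<^bsub>U\<^esub> b m n"
    and b_smult_right: "a \<in> carrier R \<Longrightarrow> m \<in> carrier M \<Longrightarrow> n \<in> carrier N \<Longrightarrow>
      b m (a \<odot>\<^bsub>N\<^esub> n) = a \<odot>\<^bsub>U\<^esub> b m n"
    and b_bounded: "\<exists>B. \<forall>m\<in>carrier M. \<forall>n\<in>carrier N. mnorm U (b m n) \<le> B * (mnorm M m * mnorm N n)"
begin

abbreviation ev :: "('m \<times> 'n) list \<Rightarrow> 'u" where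
  "ev \<equiv> tensor_eval U b"

lemma ev_closed [simp]: "valid xs \<Longrightarrow> ev xs \<in> carrier U"
  by (induction xs) auto

lemma ev_append: "valid xs \<Longrightarrow> valid ys \<Longrightarrow> ev (xs @ ys) = ev xs \<oplus>\<^bsub>U\<^esub> ev ys"
  by (induction xs) (auto simp: U.M.a_assoc)

lemma ev_smult: "a \<in> carrier R \<Longrightarrow> valid xs \<Longrightarrow> ev (smult_rep M a xs) = a \<odot>\<^bsub>U\<^esub> ev xs"
  by (induction xs) (auto simp: b_smult_left U.smult_r_distr)

lemma ev_neg: "valid xs \<Longrightarrow> ev (neg_rep M xs) = \<ominus>\<^bsub>U\<^esub> ev xs"
  by (simp add: neg_rep_eq_smult ev_smult U.minus_eq_smult)

lemma ev_diff: "valid xs \<Longrightarrow> valid ys \<Longrightarrow> ev (xs @ neg_rep M ys) = ev xs \<ominus>\<^bsub>U\<^esub> ev ys"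
  using valid_neg_rep[of ys] by (simp add: ev_append ev_neg U.M.minus_eq)

lemma ev_teq: "teq xs ys \<Longrightarrow> ev xs = ev ys"
proof (induction rule: tensor_eq.induct)
  case (append xs xs' ys ys')
  then show ?case using teq_valid[OF append.hyps(1)] teq_valid[OF append.hyps(2)] by (simp add: ev_append)
next
  case (commute xs ys)
  then show ?case by (simp add: ev_append U.M.a_comm)
next
  case (zero n)
  then show ?case using b_smult_left[of "\<zero>\<^bsub>R\<^esub>" "\<zero>\<^bsub>M\<^esub>" n] by simp
qed (auto simp: b_add_left b_add_right b_smult_left b_smult_right)

lemma ev_bound:
  obtains B where "B \<ge> 0" "\<And>xs. valid xs \<Longrightarrow> mnorm U (ev xs) \<le> B * psn xs"
proof -
  obtain B0 where B0: "\<And>m n. m \<in> carrier M \<Longrightarrow> n \<in> carrier N \<Longrightarrow>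
      mnorm U (b m n) \<le> B0 * (mnorm M m * mnorm N n)"
    using b_bounded by blast
  define B where "B = max B0 1"
  have B: "B > 0" by (simp add: B_def)
  have bB: "mnorm U (b m n) \<le> B * (mnorm M m * mnorm N n)" if "m \<in> carrier M" "n \<in> carrier N" for m n
    using B0[OF that] mult_right_mono[of B0 B "mnorm M m * mnorm N n"] that by (simp add: B_def)
  have rep: "mnorm U (ev xs) \<le> B * rep_norm M N xs" if "valid xs" for xs
    using that
  proof (induction xs)
    case (Cons x xs)
    then have "mnorm U (ev (x # xs)) \<le> mnorm U (b (fst x) (snd x)) + mnorm U (ev xs)"
      by (auto intro!: U.norm_triangle)
    with Cons bB[of "fst x" "snd x"] show ?case by (auto simp: algebra_simps)
  qed simp
  have "mnorm U (ev xs) \<le> B * psn xs" if xs: "valid xs" for xs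
  proof (rule field_le_epsilon)
    fix e :: real assume "e > 0"
    then have "e / B > 0" using B by simp
    from psn_approx[OF xs this] obtain ys where ys: "teq xs ys" "rep_norm M N ys < psn xs + e / B" .
    have "mnorm U (ev xs) \<le> B * rep_norm M N ys"
      using rep[of ys] ev_teq[OF ys(1)] teq_valid[OF ys(1)] by simp
    also have "\<dots> \<le> B * (psn xs + e / B)" using ys(2) B by (intro mult_left_mono) auto
    finally show "mnorm U (ev xs) \<le> B * psn xs + e" using B by (simp add: distrib_left)
  qed
  with B show ?thesis by (intro that[of B]) auto
qed

lemma ev_dist_bound:
  obtains B where "B \<ge> 0"
    "\<And>xs ys. valid xs \<Longrightarrow> valid ys \<Longrightarrow> mnorm U (ev xs \<ominus>\<^bsub>U\<^esub> ev ys) \<le> B * pdist xs ys"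
proof -
  obtain B where B: "B \<ge> 0" "\<And>xs. valid xs \<Longrightarrow> mnorm U (ev xs) \<le> B * psn xs"
    by (rule ev_bound) blast
  have "mnorm U (ev xs \<ominus>\<^bsub>U\<^esub> ev ys) \<le> B * pdist xs ys" if "valid xs" "valid ys" for xs ys
    using B(2)[of "xs @ neg_rep M ys"] valid_neg_rep[OF that(2)] that by (simp add: ev_diff proj_dist_eq)
  with B(1) show ?thesis by (rule that)
qed

lemma ev_tends_ex:
  assumes s: "s \<in> TC"
  shows "\<exists>l. tends U (\<lambda>k. ev (s k)) l"
proof -
  obtain B where B: "B \<ge> 0"
    "\<And>xs ys. valid xs \<Longrightarrow> valid ys \<Longrightarrow> mnorm U (ev xs \<ominus>\<^bsub>U\<^esub> ev ys) \<le> B * pdist xs ys"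
    by (rule ev_dist_bound) blast
  have "\<exists>n0. \<forall>m\<ge>n0. \<forall>n\<ge>n0. mnorm U (ev (s m) \<ominus>\<^bsub>U\<^esub> ev (s n)) < e" if "e > 0" for e
    by (rule cauchy_scale[OF cauchyD[OF s] B(1) B(2)[OF cauchy_valid[OF s] cauchy_valid[OF s]] that])
  then show ?thesis
    using U.cauchy_tends[of "\<lambda>k. ev (s k)"] cauchy_valid[OF s] by (metis ev_closed)
qed

lemma ev_tends_class:
  assumes st: "(s, t) \<in> null_rel" and l: "tends U (\<lambda>k. ev (s k)) l"
  shows "tends U (\<lambda>k. ev (t k)) l"
proof -
  have ts: "(t, s) \<in> null_rel" using st equiv_null_rel by (auto elim: equivE dest: symD)
  note D = null_relD[OF ts]
  obtain B where B: "B \<ge> 0"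
    "\<And>xs ys. valid xs \<Longrightarrow> valid ys \<Longrightarrow> mnorm U (ev xs \<ominus>\<^bsub>U\<^esub> ev ys) \<le> B * pdist xs ys"
    by (rule ev_dist_bound) blast
  show ?thesis
  proof (rule U.tends_transfer[OF l])
    show "ev (t n) \<in> carrier U" for n using D by (simp add: cauchy_valid)
    show "(\<lambda>n. mnorm U (ev (t n) \<ominus>\<^bsub>U\<^esub> ev (s n))) \<longlonglongrightarrow> 0"
    proof (rule null_squeeze)
      show "mnorm U (ev (t n) \<ominus>\<^bsub>U\<^esub> ev (s n)) \<le> B * pdist (t n) (s n)" for n
        by (intro B cauchy_valid D)
      show "(\<lambda>n. B * pdist (t n) (s n)) \<longlonglongrightarrow> 0"
        using tendsto_mult_left[OF D(3), of B] by simp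
    qed (simp add: cauchy_valid D)
  qed
qed

text \<open>The induced map on the completed tensor product, the limit of the values on representing
  Cauchy sequences.  It will turn out to be \<^const>\<open>tensor_lift\<close>.\<close>

definition lift :: "(nat \<Rightarrow> ('m \<times> 'n) list) set \<Rightarrow> 'u" where
  "lift = (\<lambda>p\<in>carrier (ctensor R M N). THE l. \<exists>s\<in>p. tends U (\<lambda>k. ev (s k)) l)"

lemma lift_tends:
  assumes s: "s \<in> TC"
  shows "tends U (\<lambda>k. ev (s k)) (lift (tclass s))"
proof -
  obtain l where l: "tends U (\<lambda>k. ev (s k)) l" using ev_tends_ex[OF s] by blast
  have "(THE l. \<exists>t\<in>tclass s. tends U (\<lambda>k. ev (t k)) l) = l"
  proof (rule the_equality)
    show "\<exists>t\<in>tclass s. tends U (\<lambda>k. ev (t k)) l" using in_tclass[OF s] l by blast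
    fix l' assume "\<exists>t\<in>tclass s. tends U (\<lambda>k. ev (t k)) l'"
    then obtain t where t: "(s, t) \<in> null_rel" "tends U (\<lambda>k. ev (t k)) l'" by (auto simp: tclass_def)
    from U.tends_unique[OF t(2) ev_tends_class[OF t(1) l]] show "l' = l" .
  qed
  then show ?thesis using l s by (simp add: lift_def)
qed

lemma lift_hom: "lift \<in> bounded_hom R (ctensor R M N) U"
proof -
  obtain B where B: "B \<ge> 0" "\<And>xs. valid xs \<Longrightarrow> mnorm U (ev xs) \<le> B * psn xs"
    by (rule ev_bound) blast
  have closed: "lift p \<in> carrier U" if "p \<in> carrier (ctensor R M N)" for p
    using that U.tendsD(2)[OF lift_tends] by (auto simp: ctensor_carrier)
  have add: "lift (p \<oplus>\<^bsub>ctensor R M N\<^esub> q) = lift p \<oplus>\<^bsub>U\<^esub> lift q"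
    if pq: "p \<in> carrier (ctensor R M N)" "q \<in> carrier (ctensor R M N)" for p q
  proof -
    obtain s t where st: "s \<in> TC" "t \<in> TC" "p = tclass s" "q = tclass t"
      using pq by (auto simp: ctensor_carrier)
    have "tends U (\<lambda>k. ev (s k @ t k)) (lift p \<oplus>\<^bsub>U\<^esub> lift q)"
      using U.tends_add[OF lift_tends[OF st(1)] lift_tends[OF st(2)]] st
      by (simp add: ev_append cauchy_valid)
    from U.tends_unique[OF lift_tends[OF cauchy_append[OF st(1,2)]] this] show ?thesis
      using st by (simp add: ctensor_add)
  qed
  have smult: "lift (a \<odot>\<^bsub>ctensor R M N\<^esub> p) = a \<odot>\<^bsub>U\<^esub> lift p"
    if a: "a \<in> carrier R" and p: "p \<in> carrier (ctensor R M N)" for a p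
  proof -
    obtain s where s: "s \<in> TC" "p = tclass s" using p by (auto simp: ctensor_carrier)
    have "tends U (\<lambda>k. ev (smult_rep M a (s k))) (a \<odot>\<^bsub>U\<^esub> lift p)"
      using U.tends_smult[OF a lift_tends[OF s(1)]] s a by (simp add: ev_smult cauchy_valid)
    from U.tends_unique[OF lift_tends[OF cauchy_smult[OF a s(1)]] this] show ?thesis
      using s a by (simp add: ctensor_smult)
  qed
  have bnd: "mnorm U (lift p) \<le> B * mnorm (ctensor R M N) p" if p: "p \<in> carrier (ctensor R M N)" for p
  proof -
    obtain s where s: "s \<in> TC" "p = tclass s" using p by (auto simp: ctensor_carrier)
    show ?thesis
    proof (rule U.tends_norm_le)
      show "tends U (\<lambda>k. ev (s k)) (lift p)" using lift_tends s by simp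
      show "mnorm U (ev (s k)) \<le> B * psn (s k)" for k by (intro B cauchy_valid s)
      show "(\<lambda>k. B * psn (s k)) \<longlonglongrightarrow> B * mnorm (ctensor R M N) p"
        using tendsto_mult_left[OF ctensor_norm[OF s(1)], of B] s by simp
    qed
  qed
  have "lift \<in> extensional (carrier (ctensor R M N))" by (simp add: lift_def)
  moreover from bnd have "\<exists>C. \<forall>p\<in>carrier (ctensor R M N). mnorm U (lift p) \<le> C * mnorm (ctensor R M N) p"
    by blast
  ultimately show ?thesis
    unfolding bounded_hom_def using closed add smult by (auto simp: PiE_iff)
qed

lemma lift_pure:
  assumes "m \<in> carrier M" "n \<in> carrier N"
  shows "lift (pure_tensor R M N m n) = b m n"
proof -
  have c: "(\<lambda>k::nat. [(m, n)]) \<in> TC" using assms by (intro cauchy_const) auto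
  have "tends U (\<lambda>k. ev [(m, n)]) (b m n)" using U.tends_const[of "b m n"] assms by simp
  from U.tends_unique[OF lift_tends[OF c] this] show ?thesis by (simp add: pure_tensor_eq)
qed

text \<open>A bounded map that agrees with \<open>b\<close> on elementary tensors has the value \<open>ev (s k)\<close> at the class
  of the constant sequence \<open>s k\<close>, and these classes tend to the class of \<open>s\<close>.\<close>

lemma lift_unique:
  assumes f: "f \<in> bounded_hom R (ctensor R M N) U"
    and pure: "\<And>m n. m \<in> carrier M \<Longrightarrow> n \<in> carrier N \<Longrightarrow> f (pure_tensor R M N m n) = b m n"
  shows "f = lift"
proof -
  let ?T = "ctensor R M N"
  have closed: "f p \<in> carrier U" if "p \<in> carrier ?T" for p
    using f that by (auto simp: bounded_hom_def)
  have add: "f (p \<oplus>\<^bsub>?T\<^esub> q) = f p \<oplus>\<^bsub>U\<^esub> f q" if "p \<in> carrier ?T" "q \<in> carrier ?T" for p q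
    using f that by (auto simp: bounded_hom_def)
  obtain B0 where B0: "\<And>p. p \<in> carrier ?T \<Longrightarrow> mnorm U (f p) \<le> B0 * mnorm ?T p"
    using f unfolding bounded_hom_def by blast
  have const: "f (tclass (\<lambda>k. xs)) = ev xs" if "valid xs" for xs
    using that
  proof (induction xs)
    case Nil
    let ?z = "tclass (\<lambda>k. [])"
    have c: "(\<lambda>k::nat. []) \<in> TC" by (rule cauchy_const) simp
    have "f ?z = f ?z \<oplus>\<^bsub>U\<^esub> f ?z"
      using add[of ?z ?z] ctensor_add[OF c c] c by simp
    then show ?case using closed[of ?z] c by simp
  next
    case (Cons x xs)
    obtain m n where x: "x = (m, n)" by (cases x)
    have v: "valid [x]" "valid xs" "m \<in> carrier M" "n \<in> carrier N" using Cons.prems x by auto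
    have "f (tclass (\<lambda>k. [x] @ xs)) = f (tclass (\<lambda>k. [x])) \<oplus>\<^bsub>U\<^esub> f (tclass (\<lambda>k. xs))"
      using add[of "tclass (\<lambda>k. [x])" "tclass (\<lambda>k. xs)"] ctensor_add cauchy_const[OF v(1)] cauchy_const[OF v(2)]
      by simp
    then show ?case using Cons.IH[OF v(2)] pure[OF v(3,4)] by (simp add: x pure_tensor_eq)
  qed
  have lim: "f (tclass s) = lift (tclass s)" if s: "s \<in> TC" for s
  proof -
    have v: "valid (s k)" for k by (rule cauchy_valid[OF s])
    have nc: "(\<lambda>l. neg_rep M (s l)) \<in> TC"
      using cauchy_smult[OF _ s, of "\<ominus>\<^bsub>R\<^esub> \<one>\<^bsub>R\<^esub>"] by (simp add: neg_rep_eq_smult v)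
    have dc: "(\<lambda>l. s k @ neg_rep M (s l)) \<in> TC" for k
      by (intro cauchy_append cauchy_const v nc)
    have eq: "ev (s k) \<ominus>\<^bsub>U\<^esub> f (tclass s) = f (tclass (\<lambda>l. s k @ neg_rep M (s l)))" for k
    proof -
      have "teq (s l @ (s k @ neg_rep M (s l))) (s k)" for l
      proof -
        have "teq (s l @ (s k @ neg_rep M (s l))) (s k @ (s l @ neg_rep M (s l)))"
          using v valid_neg_rep[OF v] by (intro teq_perm) auto
        also have "teq \<dots> (s k)" using v by (intro teq_append_cancel teq_neg_cancel)
        finally show ?thesis .
      qed
      then have "tclass (\<lambda>l. s l @ (s k @ neg_rep M (s l))) = tclass (\<lambda>l. s k)"
        by (simp add: tclass_eq_iff cauchy_append s dc cauchy_const v null_rel_teq)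
      then have "ev (s k) = f (tclass s) \<oplus>\<^bsub>U\<^esub> f (tclass (\<lambda>l. s k @ neg_rep M (s l)))"
        using add[of "tclass s" "tclass (\<lambda>l. s k @ neg_rep M (s l))"] ctensor_add[OF s dc[of k]]
          const[OF v[of k]] s dc
        by simp
      then show ?thesis
        using closed[OF tclass_carrier[OF s]] closed[OF tclass_carrier[OF dc[of k]]]
        by (simp add: U.M.minus_eq U.M.a_comm[of "f (tclass s)"] U.M.a_assoc U.M.r_neg)
    qed
    have "(\<lambda>k. mnorm U (ev (s k) \<ominus>\<^bsub>U\<^esub> f (tclass s))) \<longlonglongrightarrow> 0"
    proof (rule LIMSEQ_I)
      fix e :: real assume e: "e > 0"
      define B where "B = max B0 0 + 1"
      have B: "B > 0" by (simp add: B_def)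
      then have "e / (2 * B) > 0" using e by simp
      from cauchyD[OF s this] obtain k0 where
        k0: "\<And>k l. k \<ge> k0 \<Longrightarrow> l \<ge> k0 \<Longrightarrow> pdist (s k) (s l) < e / (2 * B)" by blast
      have "mnorm U (ev (s k) \<ominus>\<^bsub>U\<^esub> f (tclass s)) < e" if k: "k \<ge> k0" for k
      proof -
        let ?d = "tclass (\<lambda>l. s k @ neg_rep M (s l))"
        have lim: "(\<lambda>l. pdist (s k) (s l)) \<longlonglongrightarrow> mnorm ?T ?d"
          using ctensor_norm[OF dc[of k]] by (simp add: proj_dist_eq)
        have up: "mnorm ?T ?d \<le> e / (2 * B)"
          using k0[OF k] by (intro LIMSEQ_le_const2[OF lim]) (auto intro!: exI[of _ k0] less_imp_le)
        have low: "0 \<le> mnorm ?T ?d"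
          by (rule LIMSEQ_le_const[OF lim]) (auto simp: pdist_nonneg v)
        have "mnorm U (f ?d) \<le> B0 * mnorm ?T ?d" by (intro B0 tclass_carrier dc)
        also have "\<dots> \<le> B * mnorm ?T ?d" using low by (intro mult_right_mono) (auto simp: B_def)
        also have "\<dots> \<le> B * (e / (2 * B))" using up B by (intro mult_left_mono) auto
        also have "\<dots> < e" using B e by simp
        finally show ?thesis by (simp add: eq)
      qed
      then show "\<exists>k0. \<forall>k\<ge>k0. norm (mnorm U (ev (s k) \<ominus>\<^bsub>U\<^esub> f (tclass s)) - 0) < e"
        using closed[OF tclass_carrier[OF s]] v by (auto intro!: exI[of _ k0])
    qed
    then have "tends U (\<lambda>k. ev (s k)) (f (tclass s))"
      using closed[OF tclass_carrier[OF s]] v by (auto simp: tends_def)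
    from U.tends_unique[OF this lift_tends[OF s]] show ?thesis .
  qed
  show ?thesis
  proof (rule extensionalityI)
    show "f \<in> extensional (carrier ?T)" "lift \<in> extensional (carrier ?T)"
      using f lift_hom by (auto simp: bounded_hom_def PiE_iff)
    show "f p = lift p" if "p \<in> carrier ?T" for p
      using that lim by (auto simp: ctensor_carrier)
  qed
qed

theorem tensor_lift_eq: "tensor_lift R M N U b = lift"
  unfolding tensor_lift_def
  by (rule the_equality) (auto simp: lift_hom lift_pure intro!: lift_unique)

lemma ev_map:
  assumes "\<And>i. z i \<in> carrier M \<times> carrier N"
  shows "ev (map z [0..<k]) = finsum U (\<lambda>i. b (fst (z i)) (snd (z i))) {..<k}"
proof (induction k)
  case (Suc k)
  have zi: "fst (z i) \<in> carrier M" "snd (z i) \<in> carrier N" for i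
    using assms[of i] by (auto simp: mem_Times_iff)
  have "valid (map z [0..<k])" "valid [z k]" using assms by (auto simp: image_subset_iff)
  then have "ev (map z [0..<Suc k]) = ev (map z [0..<k]) \<oplus>\<^bsub>U\<^esub> b (fst (z k)) (snd (z k))"
    using zi by (simp add: ev_append)
  also have "\<dots> = finsum U (\<lambda>i. b (fst (z i)) (snd (z i))) {..<Suc k}"
    using zi Suc.IH by (simp add: lessThan_Suc U.finsum_insert U.M.a_comm U.finsum_closed Pi_def)
  finally show ?case .
qed simp

end

section \<open>Nuclear maps\<close>

lemma nuclear_map_bounded: "nuclear_map R V W f \<Longrightarrow> f \<in> bounded_hom R V W"
  by (simp add: nuclear_map_def)

context banach_mod_pair
begin

lemma dual_simps:
  "carrier (dual R M) = bounded_hom R M (unit_module R)"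
  "l \<oplus>\<^bsub>dual R M\<^esub> l' = (\<lambda>x\<in>carrier M. l x \<oplus>\<^bsub>R\<^esub> l' x)"
  "a \<odot>\<^bsub>dual R M\<^esub> l = (\<lambda>x\<in>carrier M. a \<otimes>\<^bsub>R\<^esub> l x)"
  by (simp_all add: dual_def)

lemma banach_dual: "banach_module R (dual R M)"
  by (rule dual_banach[OF M.banach_ring M.banach_module])

lemma dualD:
  assumes "l \<in> carrier (dual R M)"
  shows "x \<in> carrier M \<Longrightarrow> l x \<in> carrier R"
    and "x \<in> carrier M \<Longrightarrow> y \<in> carrier M \<Longrightarrow> l (x \<oplus>\<^bsub>M\<^esub> y) = l x \<oplus>\<^bsub>R\<^esub> l y"
    and "a \<in> carrier R \<Longrightarrow> x \<in> carrier M \<Longrightarrow> l (a \<odot>\<^bsub>M\<^esub> x) = a \<otimes>\<^bsub>R\<^esub> l x"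
    and "x \<in> carrier M \<Longrightarrow> rnorm R (l x) \<le> mnorm (dual R M) l * mnorm M x"
    and "0 \<le> mnorm (dual R M) l"
proof -
  interpret E: banach_mod_pair R M "unit_module R"
    using M.banach_ring by unfold_locales (auto intro: weighted_copy_banach)
  show "x \<in> carrier M \<Longrightarrow> l x \<in> carrier R"
    and "x \<in> carrier M \<Longrightarrow> y \<in> carrier M \<Longrightarrow> l (x \<oplus>\<^bsub>M\<^esub> y) = l x \<oplus>\<^bsub>R\<^esub> l y"
    and "a \<in> carrier R \<Longrightarrow> x \<in> carrier M \<Longrightarrow> l (a \<odot>\<^bsub>M\<^esub> x) = a \<otimes>\<^bsub>R\<^esub> l x"
    and "x \<in> carrier M \<Longrightarrow> rnorm R (l x) \<le> mnorm (dual R M) l * mnorm M x"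
    and "0 \<le> mnorm (dual R M) l"
    using assms E.bounded_homD[of l] E.op_norm_bound[of l x] E.op_norm_nonneg[of l]
    by (simp_all add: dual_def)
qed

text \<open>The map \<open>x \<mapsto> l(x) v\<close>, the image of the elementary tensor of \<open>l\<close> and \<open>v\<close> under the canonical map.\<close>

definition rank_one :: "('m \<Rightarrow> 'a) \<Rightarrow> 'n \<Rightarrow> 'm \<Rightarrow> 'n" where
  "rank_one l v = (\<lambda>x\<in>carrier M. l x \<odot>\<^bsub>N\<^esub> v)"

lemma rank_one_balanced: "balanced_map R (dual R M) N (internal_hom R M N) rank_one"
proof -
  interpret D: banach_mod R "dual R M" using M.banach_ring banach_dual by unfold_locales
  interpret H: banach_mod R "internal_hom R M N" using M.banach_ring internal_hom_banach by unfold_locales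
  obtain C where C: "C > 0"
    "\<And>a x. a \<in> carrier R \<Longrightarrow> x \<in> carrier N \<Longrightarrow> mnorm N (a \<odot>\<^bsub>N\<^esub> x) \<le> C * rnorm R a * mnorm N x"
    by (rule N.smult_bound) blast
  have bnd: "mnorm N (rank_one l v x) \<le> C * (mnorm (dual R M) l * mnorm N v) * mnorm M x"
    if l: "l \<in> carrier (dual R M)" and v: "v \<in> carrier N" and x: "x \<in> carrier M" for l v x
  proof -
    have "mnorm N (rank_one l v x) \<le> C * rnorm R (l x) * mnorm N v"
      using C(2)[OF dualD(1)[OF l x] v] x by (simp add: rank_one_def)
    also have "\<dots> \<le> C * (mnorm (dual R M) l * mnorm M x) * mnorm N v"
      using C(1) v by (intro mult_right_mono mult_left_mono dualD(4) l x) auto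
    finally show ?thesis by (simp add: mult_ac)
  qed
  have hom: "rank_one l v \<in> bounded_hom R M N" if l: "l \<in> carrier (dual R M)" and v: "v \<in> carrier N" for l v
  proof (rule bounded_homI[OF _ _ _ _ bnd[OF l v]])
    show "rank_one l v (x \<oplus>\<^bsub>M\<^esub> y) = rank_one l v x \<oplus>\<^bsub>N\<^esub> rank_one l v y"
      if "x \<in> carrier M" "y \<in> carrier M" for x y
      using that l v by (simp add: rank_one_def dualD N.smult_l_distr)
    show "rank_one l v (a \<odot>\<^bsub>M\<^esub> x) = a \<odot>\<^bsub>N\<^esub> rank_one l v x" if "a \<in> carrier R" "x \<in> carrier M" for a x
      using that l v by (simp add: rank_one_def dualD N.smult_assoc1)
  qed (use l v in \<open>auto simp: rank_one_def dualD extensional_def\<close>)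
  show ?thesis
  proof unfold_locales
    show "\<exists>B. \<forall>m\<in>carrier (dual R M). \<forall>n\<in>carrier N.
        mnorm (internal_hom R M N) (rank_one m n) \<le> B * (mnorm (dual R M) m * mnorm N n)"
      using C(1) bnd dualD(5) by (intro exI[of _ C]) (auto intro!: op_norm_le)
    fix l l' v v' a assume *: "l \<in> carrier (dual R M)" "v \<in> carrier N"
    show "rank_one l v \<in> carrier (internal_hom R M N)" using hom * by simp
    show "rank_one (l \<oplus>\<^bsub>dual R M\<^esub> l') v = rank_one l v \<oplus>\<^bsub>internal_hom R M N\<^esub> rank_one l' v"
      if "l' \<in> carrier (dual R M)"
      using * that by (auto simp: rank_one_def dual_simps(2,3) fun_eq_iff dualD N.smult_l_distr)
    show "rank_one l (v \<oplus>\<^bsub>N\<^esub> v') = rank_one l v \<oplus>\<^bsub>internal_hom R M N\<^esub> rank_one l v'"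
      if "v' \<in> carrier N"
      using * that by (auto simp: rank_one_def fun_eq_iff dualD N.smult_r_distr)
    assume a: "a \<in> carrier R"
    show "rank_one (a \<odot>\<^bsub>dual R M\<^esub> l) v = a \<odot>\<^bsub>internal_hom R M N\<^esub> rank_one l v"
      using * a by (auto simp: rank_one_def dual_simps(2,3) fun_eq_iff dualD N.smult_assoc1)
    have "l x \<odot>\<^bsub>N\<^esub> (a \<odot>\<^bsub>N\<^esub> v) = a \<odot>\<^bsub>N\<^esub> (l x \<odot>\<^bsub>N\<^esub> v)" if x: "x \<in> carrier M" for x
      using N.smult_assoc1[of "l x" a v] N.smult_assoc1[of a "l x" v] dualD(1)[OF *(1) x] a *
      by (simp add: M.R.m_comm)
    then show "rank_one l (a \<odot>\<^bsub>N\<^esub> v) = a \<odot>\<^bsub>internal_hom R M N\<^esub> rank_one l v"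
      by (auto simp: rank_one_def fun_eq_iff)
  qed
qed

text \<open>The map \<open>f\<close> is the sum \<open>x \<mapsto> \<Sum>\<^sub>i l\<^sub>i(x) w\<^sub>i\<close> of a series with \<open>\<Sum>\<^sub>i \<parallel>l\<^sub>i\<parallel> \<parallel>w\<^sub>i\<parallel>\<close> finite.  The values of
  \<open>f\<close> outside of the carrier are not constrained.\<close>

definition nuclear_series :: "(nat \<Rightarrow> 'm \<Rightarrow> 'a) \<Rightarrow> (nat \<Rightarrow> 'n) \<Rightarrow> ('m \<Rightarrow> 'n) \<Rightarrow> bool" where
  "nuclear_series l w f \<longleftrightarrow>
     (\<forall>i. l i \<in> carrier (dual R M)) \<and> (\<forall>i. w i \<in> carrier N) \<and>
     summable (\<lambda>i. mnorm (dual R M) (l i) * mnorm N (w i)) \<and>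
     (\<forall>x\<in>carrier M. tends N (\<lambda>k. finsum N (\<lambda>i. l i x \<odot>\<^bsub>N\<^esub> w i) {..<k}) (f x))"

lemma canonical_map_series:
  assumes ser: "(\<And>i. z i \<in> carrier (dual R M) \<times> carrier N)"
    "summable (\<lambda>i. mnorm (dual R M) (fst (z i)) * mnorm N (snd (z i)))"
  shows "canonical_map R M N (tensor_null_rel R (dual R M) N `` {\<lambda>k. map z [0..<k]}) \<in> bounded_hom R M N"
    and "nuclear_series (\<lambda>i. fst (z i)) (\<lambda>i. snd (z i))
      (canonical_map R M N (tensor_null_rel R (dual R M) N `` {\<lambda>k. map z [0..<k]}))"
proof -
  interpret B: balanced_map R "dual R M" N "internal_hom R M N" rank_one by (rule rank_one_balanced)
  let ?s = "\<lambda>k. map z [0..<k]"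
  have s: "?s \<in> B.TC" by (rule B.series_cauchy[OF ser])
  have "canonical_map R M N = tensor_lift R (dual R M) N (internal_hom R M N) rank_one"
    by (simp add: canonical_map_def rank_one_def[abs_def])
  then have can: "canonical_map R M N = B.lift" by (simp only: B.tensor_lift_eq)
  have lim: "tends (internal_hom R M N) (\<lambda>k. B.ev (?s k)) (B.lift (B.tclass ?s))"
    by (rule B.lift_tends[OF s])
  have zi: "fst (z i) \<in> carrier (dual R M)" "snd (z i) \<in> carrier N" for i
    using ser(1)[of i] by (auto simp: mem_Times_iff)
  show mem: "canonical_map R M N (tensor_null_rel R (dual R M) N `` {?s}) \<in> bounded_hom R M N"
    using B.U.tendsD(2)[OF lim] by (simp add: can B.tclass_def)
  have "tends N (\<lambda>k. finsum N (\<lambda>i. fst (z i) x \<odot>\<^bsub>N\<^esub> snd (z i)) {..<k}) (B.lift (B.tclass ?s) x)"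
    if x: "x \<in> carrier M" for x
  proof -
    have evm: "B.ev (?s k) \<in> bounded_hom R M N" for k using B.U.tendsD(1)[OF lim] by simp
    have "mnorm N (B.ev (?s k) x \<ominus>\<^bsub>N\<^esub> B.lift (B.tclass ?s) x)
        \<le> mnorm (internal_hom R M N) (B.ev (?s k) \<ominus>\<^bsub>internal_hom R M N\<^esub> B.lift (B.tclass ?s)) * mnorm M x" for k
      using op_norm_bound[OF _ x, of "B.ev (?s k) \<ominus>\<^bsub>internal_hom R M N\<^esub> B.lift (B.tclass ?s)"]
        B.U.M.minus_closed[OF B.U.tendsD(1)[OF lim, of k] B.U.tendsD(2)[OF lim]] evm[of k] mem x
      by (simp add: internal_hom_diff can B.tclass_def)
    then have "tends N (\<lambda>k. B.ev (?s k) x) (B.lift (B.tclass ?s) x)"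
    proof (rule N.tends_sandwich[rotated 2])
      show "(\<lambda>k. mnorm (internal_hom R M N)
          (B.ev (?s k) \<ominus>\<^bsub>internal_hom R M N\<^esub> B.lift (B.tclass ?s)) * mnorm M x) \<longlonglongrightarrow> 0"
        using tendsto_mult_right[OF B.U.tendsD(3)[OF lim], of "mnorm M x"] by simp
      show "B.ev (?s k) x \<in> carrier N" for k by (rule bounded_homD(1)[OF evm x])
      show "B.lift (B.tclass ?s) x \<in> carrier N"
        using bounded_homD(1)[OF mem x] by (simp add: can B.tclass_def)
    qed
    moreover have "B.ev (?s k) x = finsum N (\<lambda>i. fst (z i) x \<odot>\<^bsub>N\<^esub> snd (z i)) {..<k}" for k
    proof (induction k)
      case 0
      then show ?case using x by simp
    next
      case (Suc k)
      have "B.ev (?s (Suc k)) = B.ev (?s k) \<oplus>\<^bsub>internal_hom R M N\<^esub> rank_one (fst (z k)) (snd (z k))"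
        using B.ev_map[of z, OF ser(1), of "Suc k"] B.ev_map[of z, OF ser(1), of k] zi B.b_closed
        by (simp add: lessThan_Suc B.U.finsum_insert B.U.finsum_closed Pi_def B.U.M.a_comm del: internal_hom_simps)
      then have "B.ev (?s (Suc k)) x = B.ev (?s k) x \<oplus>\<^bsub>N\<^esub> rank_one (fst (z k)) (snd (z k)) x"
        using x by simp
      also have "\<dots> = finsum N (\<lambda>i. fst (z i) x \<odot>\<^bsub>N\<^esub> snd (z i)) {..<Suc k}"
        unfolding Suc.IH using x zi dualD(1)[OF zi(1) x]
        by (simp add: lessThan_Suc N.finsum_insert N.finsum_closed Pi_def N.M.a_comm rank_one_def)
      finally show ?case .
    qed
    ultimately show ?thesis by simp
  qed
  then show "nuclear_series (\<lambda>i. fst (z i)) (\<lambda>i. snd (z i))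
      (canonical_map R M N (tensor_null_rel R (dual R M) N `` {?s}))"
    using zi ser(2) by (simp add: nuclear_series_def can B.tclass_def)
qed

theorem canonical_map_image:
  assumes "t \<in> carrier (ctensor R (dual R M) N)"
  shows "canonical_map R M N t \<in> bounded_hom R M N"
    and "\<exists>l w. nuclear_series l w (canonical_map R M N t)"
proof -
  interpret T: banach_mod_pair R "dual R M" N
    using M.banach_ring banach_dual by unfold_locales
  obtain s where s: "s \<in> T.TC" "t = T.tclass s" using assms by (auto simp: T.ctensor_carrier)
  obtain z where z: "\<And>i. z i \<in> carrier (dual R M) \<times> carrier N"
    "summable (\<lambda>i. mnorm (dual R M) (fst (z i)) * mnorm N (snd (z i)))"
    "(s, \<lambda>k. map z [0..<k]) \<in> T.null_rel"
    by (rule T.series_representation[OF s(1)]) blast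
  have "t = T.null_rel `` {\<lambda>k. map z [0..<k]}"
    using T.tclass_eq_iff[of s "\<lambda>k. map z [0..<k]"] T.null_relD[OF z(3)] z(3) s(2) by (simp add: T.tclass_def)
  with canonical_map_series[OF z(1,2)] show "canonical_map R M N t \<in> bounded_hom R M N"
    and "\<exists>l w. nuclear_series l w (canonical_map R M N t)" by auto
qed

lemma teq_smult_add:
  "a \<in> carrier R \<Longrightarrow> c \<in> carrier R \<Longrightarrow> valid xs \<Longrightarrow>
    teq (smult_rep M (a \<oplus>\<^bsub>R\<^esub> c) xs) (smult_rep M a xs @ smult_rep M c xs)"
proof (induction xs)
  case (Cons x xs)
  let ?m = "fst x" and ?n = "snd x"
  have v: "?m \<in> carrier M" "?n \<in> carrier N" "valid xs" using Cons.prems by auto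
  have "teq ([((a \<oplus>\<^bsub>R\<^esub> c) \<odot>\<^bsub>M\<^esub> ?m, ?n)] @ smult_rep M (a \<oplus>\<^bsub>R\<^esub> c) xs)
      ([(a \<odot>\<^bsub>M\<^esub> ?m, ?n), (c \<odot>\<^bsub>M\<^esub> ?m, ?n)] @ (smult_rep M a xs @ smult_rep M c xs))"
    using Cons v by (intro tensor_eq.append) (simp_all add: M.smult_l_distr tensor_eq.add_left)
  also have "teq \<dots> (smult_rep M a (x # xs) @ smult_rep M c (x # xs))"
    using Cons.prems(1,2) v valid_smult_rep[of a xs] valid_smult_rep[of c xs]
    by (intro teq_perm) auto
  finally show ?case by simp
qed (simp add: tensor_eq.refl)

text \<open>This map takes the value \<open>t\<close> at \<open>1\<close>, so it turns an element of the completed tensor product into a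
  morphism from \<open>R\<close>, as the definition of nuclear maps requires.\<close>

lemma smult_hom:
  assumes "t \<in> carrier (ctensor R M N)"
  shows "(\<lambda>a\<in>carrier R. a \<odot>\<^bsub>ctensor R M N\<^esub> t) \<in> bounded_hom R (unit_module R) (ctensor R M N)"
proof -
  obtain s where s: "s \<in> TC" and t: "t = tclass s" using assms by (auto simp: ctensor_carrier)
  have v: "valid (s k)" for k by (rule cauchy_valid[OF s])
  have 1: "(a \<oplus>\<^bsub>R\<^esub> c) \<odot>\<^bsub>ctensor R M N\<^esub> t = a \<odot>\<^bsub>ctensor R M N\<^esub> t \<oplus>\<^bsub>ctensor R M N\<^esub> c \<odot>\<^bsub>ctensor R M N\<^esub> t"
    if "a \<in> carrier R" "c \<in> carrier R" for a c
    using that s v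
    by (simp add: t ctensor_smult ctensor_add cauchy_smult tclass_eq_iff cauchy_append null_rel_teq teq_smult_add)
  have 2: "(a \<otimes>\<^bsub>R\<^esub> c) \<odot>\<^bsub>ctensor R M N\<^esub> t = a \<odot>\<^bsub>ctensor R M N\<^esub> (c \<odot>\<^bsub>ctensor R M N\<^esub> t)"
    if ac: "a \<in> carrier R" "c \<in> carrier R" for a c
  proof -
    have "smult_rep M (a \<otimes>\<^bsub>R\<^esub> c) xs = smult_rep M a (smult_rep M c xs)" if "valid xs" for xs
      using that ac by (induction xs) (auto simp: M.smult_assoc1)
    then show ?thesis using s ac v by (simp add: t ctensor_smult cauchy_smult)
  qed
  obtain C where C: "C > 0"
    "\<And>a xs. a \<in> carrier R \<Longrightarrow> valid xs \<Longrightarrow> psn (smult_rep M a xs) \<le> C * rnorm R a * psn xs"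
    by (rule psn_smult_bound) blast
  have 3: "mnorm (ctensor R M N) (a \<odot>\<^bsub>ctensor R M N\<^esub> t) \<le> (C * mnorm (ctensor R M N) t) * rnorm R a"
    if a: "a \<in> carrier R" for a
  proof (rule LIMSEQ_le)
    show "(\<lambda>k. psn (smult_rep M a (s k))) \<longlonglongrightarrow> mnorm (ctensor R M N) (a \<odot>\<^bsub>ctensor R M N\<^esub> t)"
      using ctensor_norm[OF cauchy_smult[OF a s]] by (simp add: t ctensor_smult a s)
    show "(\<lambda>k. (C * psn (s k)) * rnorm R a) \<longlonglongrightarrow> (C * mnorm (ctensor R M N) t) * rnorm R a"
      unfolding t by (intro tendsto_mult_left tendsto_mult_right ctensor_norm s)
    show "\<exists>N. \<forall>k\<ge>N. psn (smult_rep M a (s k)) \<le> (C * psn (s k)) * rnorm R a"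
      using C(2)[OF a v] by (auto simp: mult_ac)
  qed
  have 4: "a \<odot>\<^bsub>ctensor R M N\<^esub> t \<in> carrier (ctensor R M N)" if "a \<in> carrier R" for a
    using that s by (simp add: t ctensor_smult cauchy_smult)
  from 3 have "\<exists>C. \<forall>a\<in>carrier R. mnorm (ctensor R M N) (a \<odot>\<^bsub>ctensor R M N\<^esub> t) \<le> C * rnorm R a"
    by blast
  with 1 2 4 show ?thesis
    unfolding bounded_hom_def by (auto simp: PiE_iff)
qed

text \<open>Nuclear maps are exactly the bounded maps that are sums of such series.\<close>

theorem nuclear_map_iff:
  "nuclear_map R M N f \<longleftrightarrow> f \<in> bounded_hom R M N \<and> (\<exists>l w. nuclear_series l w f)"
proof (intro iffI conjI)
  assume nuc: "nuclear_map R M N f"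
  then show f: "f \<in> bounded_hom R M N" by (simp add: nuclear_map_def)
  from nuc obtain h where h: "h \<in> bounded_hom R (unit_module R) (ctensor R (dual R M) N)"
    "f = compose (carrier R) (canonical_map R M N) h \<one>\<^bsub>R\<^esub>"
    by (auto simp: nuclear_map_def)
  then have "h \<one>\<^bsub>R\<^esub> \<in> carrier (ctensor R (dual R M) N)" by (auto simp: bounded_hom_def)
  with h(2) canonical_map_image(2)[of "h \<one>\<^bsub>R\<^esub>"] show "\<exists>l w. nuclear_series l w f"
    by (simp add: compose_def)
next
  assume "f \<in> bounded_hom R M N \<and> (\<exists>l w. nuclear_series l w f)"
  then obtain l w where f: "f \<in> bounded_hom R M N" and ser: "nuclear_series l w f" by blast
  interpret T: banach_mod_pair R "dual R M" N
    using M.banach_ring banach_dual by unfold_locales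
  define z where "z i = (l i, w i)" for i
  have lw: "(\<lambda>i. fst (z i)) = l" "(\<lambda>i. snd (z i)) = w" by (simp_all add: z_def)
  have z: "z i \<in> carrier (dual R M) \<times> carrier N" for i using ser by (simp add: z_def nuclear_series_def)
  have sm: "summable (\<lambda>i. mnorm (dual R M) (fst (z i)) * mnorm N (snd (z i)))"
    using ser by (simp add: z_def nuclear_series_def)
  define s where "s k = map z [0..<k]" for k
  have s: "s \<in> T.TC" unfolding s_def[abs_def] by (rule T.series_cauchy[OF z sm])
  have "canonical_map R M N (T.tclass s) \<in> bounded_hom R M N"
    and ser': "nuclear_series l w (canonical_map R M N (T.tclass s))"
    using canonical_map_series[OF z sm] by (simp_all add: T.tclass_def s_def[abs_def] lw)
  then have f_eq: "f = canonical_map R M N (T.tclass s)"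
    using f ser N.tends_unique by (intro bounded_hom_ext) (auto simp: nuclear_series_def)
  let ?h = "\<lambda>a\<in>carrier R. a \<odot>\<^bsub>ctensor R (dual R M) N\<^esub> T.tclass s"
  have "\<one>\<^bsub>R\<^esub> \<odot>\<^bsub>ctensor R (dual R M) N\<^esub> T.tclass s = T.tclass s"
  proof -
    have "smult_rep (dual R M) \<one>\<^bsub>R\<^esub> xs = xs" if "T.valid xs" for xs
      using that by (induction xs) auto
    then show ?thesis using s by (simp add: T.ctensor_smult T.cauchy_valid)
  qed
  then have "f = compose (carrier R) (canonical_map R M N) ?h \<one>\<^bsub>R\<^esub>"
    by (simp add: compose_def f_eq)
  with T.smult_hom[OF T.tclass_carrier[OF s]] f show "nuclear_map R M N f"
    unfolding nuclear_map_def by blast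
qed

end

section \<open>Countable coproducts of weighted copies\<close>

text \<open>The coproduct of the weighted copies of \<open>R\<close> with weights \<open>r s\<close>, that is, the module of all
  sequences \<open>x\<close> in \<open>R\<close> with \<open>\<Sum>\<^sub>s r s \<bar>x s\<bar>\<close> finite.  All coproducts below are indexed by the whole of
  the natural numbers.\<close>

definition weighted_l1 :: "'a normed_ring \<Rightarrow> (nat \<Rightarrow> real) \<Rightarrow> ('a, nat \<Rightarrow> 'a) normed_module" where
  "weighted_l1 R r = coprod_le1 UNIV (\<lambda>s. weighted_copy R (r s))"

lemma weighted_l1_simps [simp]:
  "\<zero>\<^bsub>weighted_l1 R r\<^esub> = (\<lambda>s. \<zero>\<^bsub>R\<^esub>)"
  "x \<oplus>\<^bsub>weighted_l1 R r\<^esub> y = (\<lambda>s. x s \<oplus>\<^bsub>R\<^esub> y s)"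
  "a \<odot>\<^bsub>weighted_l1 R r\<^esub> x = (\<lambda>s. a \<otimes>\<^bsub>R\<^esub> x s)"
  by (auto simp: weighted_l1_def coprod_le1_def)

lemma nonneg_summable_on_nat_iff:
  fixes f :: "nat \<Rightarrow> real"
  assumes "\<And>n. 0 \<le> f n"
  shows "f summable_on UNIV \<longleftrightarrow> summable f" and "summable f \<Longrightarrow> infsum f UNIV = suminf f"
proof -
  have sum: "(f has_sum suminf f) UNIV" if "summable f"
    by (rule sums_nonneg_imp_has_sum[OF summable_sums[OF that] assms])
  then show "summable f \<Longrightarrow> infsum f UNIV = suminf f" by (rule infsumI)
  show "f summable_on UNIV \<longleftrightarrow> summable f"
    using sum has_sum_infsum has_sum_imp_sums sums_summable unfolding summable_on_def by blast
qed

locale weighted_l1_space =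
  fixes R :: "'a normed_ring" and r :: "nat \<Rightarrow> real"
  assumes banach_ring: "banach_ring R" and weight_pos: "0 < r s"
begin

sublocale cring R using banach_ring by (simp add: banach_ring_def)

sublocale V: banach_mod R "weighted_copy R (r s)" for s
  using banach_ring weight_pos by unfold_locales (auto intro: weighted_copy_banach)

abbreviation L :: "('a, nat \<Rightarrow> 'a) normed_module" where
  "L \<equiv> weighted_l1 R r"

lemma carrier_iff:
  "x \<in> carrier L \<longleftrightarrow> (\<forall>s. x s \<in> carrier R) \<and> summable (\<lambda>s. r s * rnorm R (x s))"
proof (cases "\<forall>s. x s \<in> carrier R")
  case True
  then have "0 \<le> r s * rnorm R (x s)" for s using V.norm_nonneg[of "x s" s] by simp
  from nonneg_summable_on_nat_iff(1)[of "\<lambda>s. r s * rnorm R (x s)", OF this] True show ?thesis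
    by (simp add: weighted_l1_def coprod_le1_def PiE_UNIV_domain)
qed (auto simp: weighted_l1_def coprod_le1_def PiE_UNIV_domain)

lemma carrierD:
  assumes "x \<in> carrier L"
  shows "x s \<in> carrier R" "summable (\<lambda>s. r s * rnorm R (x s))" "0 \<le> r s * rnorm R (x s)"
  using assms V.norm_nonneg[of "x s" s] by (simp_all add: carrier_iff)

lemma norm_eq:
  assumes "x \<in> carrier L"
  shows "mnorm L x = (\<Sum>s. r s * rnorm R (x s))"
  using nonneg_summable_on_nat_iff(2)[of "\<lambda>s. r s * rnorm R (x s)", OF carrierD(3)[OF assms] carrierD(2)[OF assms]]
  by (simp add: weighted_l1_def coprod_le1_def)

lemma carrierI:
  assumes "\<And>s. x s \<in> carrier R" "\<And>s. r s * rnorm R (x s) \<le> g s" "summable g"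
  shows "x \<in> carrier L" "mnorm L x \<le> suminf g"
proof -
  have "0 \<le> r s * rnorm R (x s)" for s using V.norm_nonneg[of "x s" s] assms(1) by simp
  then have sm: "summable (\<lambda>s. r s * rnorm R (x s))"
    using assms(2) by (intro summable_comparison_test'[OF assms(3), of 0]) simp
  then show x: "x \<in> carrier L" using assms(1) by (simp add: carrier_iff)
  show "mnorm L x \<le> suminf g"
    unfolding norm_eq[OF x] by (intro suminf_le assms sm)
qed

lemma coord_le: "x \<in> carrier L \<Longrightarrow> r s * rnorm R (x s) \<le> mnorm L x"
  using sum_le_suminf[of "\<lambda>s. r s * rnorm R (x s)" "{s}"] carrierD[of x] by (simp add: norm_eq)

lemma rnorm_add: "a \<in> carrier R \<Longrightarrow> b \<in> carrier R \<Longrightarrow> rnorm R (a \<oplus>\<^bsub>R\<^esub> b) \<le> rnorm R a + rnorm R b"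
  using banach_ring by (simp add: banach_ring_def complete_norm_def)

lemma rnorm_zero: "rnorm R \<zero>\<^bsub>R\<^esub> = 0"
  using banach_ring by (simp add: banach_ring_def complete_norm_def)

lemma zero_seq_closed: "(\<lambda>s. \<zero>\<^bsub>R\<^esub>) \<in> carrier L"
  by (simp add: carrier_iff rnorm_zero)

lemma add_closed:
  assumes "x \<in> carrier L" "y \<in> carrier L"
  shows "(\<lambda>s. x s \<oplus>\<^bsub>R\<^esub> y s) \<in> carrier L"
    and "mnorm L (\<lambda>s. x s \<oplus>\<^bsub>R\<^esub> y s) \<le> mnorm L x + mnorm L y"
proof -
  note D = carrierD[OF assms(1)] carrierD[OF assms(2)]
  have le: "r s * rnorm R (x s \<oplus>\<^bsub>R\<^esub> y s) \<le> r s * rnorm R (x s) + r s * rnorm R (y s)" for s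
    using mult_left_mono[OF rnorm_add[OF D(1)[of s] D(4)[of s]], of "r s"] weight_pos[of s]
    by (simp add: distrib_left)
  show "(\<lambda>s. x s \<oplus>\<^bsub>R\<^esub> y s) \<in> carrier L"
    by (rule carrierI(1)[OF _ le]) (simp_all add: D summable_add)
  have "mnorm L (\<lambda>s. x s \<oplus>\<^bsub>R\<^esub> y s) \<le> (\<Sum>s. r s * rnorm R (x s) + r s * rnorm R (y s))"
    by (rule carrierI(2)[OF _ le]) (simp_all add: D summable_add)
  then show "mnorm L (\<lambda>s. x s \<oplus>\<^bsub>R\<^esub> y s) \<le> mnorm L x + mnorm L y"
    using suminf_add[OF D(2) D(5)] by (simp add: norm_eq assms)
qed

lemma smult_bounded:
  obtains C where "C > 0"
    "\<And>a x. a \<in> carrier R \<Longrightarrow> x \<in> carrier L \<Longrightarrow> (\<lambda>s. a \<otimes>\<^bsub>R\<^esub> x s) \<in> carrier L"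
    "\<And>a x. a \<in> carrier R \<Longrightarrow> x \<in> carrier L \<Longrightarrow> mnorm L (\<lambda>s. a \<otimes>\<^bsub>R\<^esub> x s) \<le> C * rnorm R a * mnorm L x"
proof -
  obtain C where C: "C > 0" "\<And>a b. a \<in> carrier R \<Longrightarrow> b \<in> carrier R \<Longrightarrow>
      rnorm R (a \<otimes>\<^bsub>R\<^esub> b) \<le> C * rnorm R a * rnorm R b"
    using banach_ring by (auto simp: banach_ring_def)
  have le: "r s * rnorm R (a \<otimes>\<^bsub>R\<^esub> x s) \<le> C * rnorm R a * (r s * rnorm R (x s))"
    if a: "a \<in> carrier R" and x: "x \<in> carrier L" for a x s
    using mult_left_mono[OF C(2)[OF a carrierD(1)[OF x, of s]], of "r s"] weight_pos[of s]
    by (simp add: mult_ac)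
  show ?thesis
  proof (rule that[OF C(1)])
    fix a x assume a: "a \<in> carrier R" and x: "x \<in> carrier L"
    note I = carrierI[OF _ le[OF a x]]
    show "(\<lambda>s. a \<otimes>\<^bsub>R\<^esub> x s) \<in> carrier L"
      using a x by (intro I(1)) (simp_all add: carrierD summable_mult)
    have "mnorm L (\<lambda>s. a \<otimes>\<^bsub>R\<^esub> x s) \<le> (\<Sum>s. C * rnorm R a * (r s * rnorm R (x s)))"
      using a x by (intro I(2)) (simp_all add: carrierD summable_mult)
    then show "mnorm L (\<lambda>s. a \<otimes>\<^bsub>R\<^esub> x s) \<le> C * rnorm R a * mnorm L x"
      using suminf_mult[OF carrierD(2)[OF x]] by (simp add: norm_eq x)
  qed
qed

lemma smult_seq_closed: "a \<in> carrier R \<Longrightarrow> x \<in> carrier L \<Longrightarrow> (\<lambda>s. a \<otimes>\<^bsub>R\<^esub> x s) \<in> carrier L"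
  by (rule smult_bounded) blast

lemma module_L: "Module.module R L"
proof (rule moduleI[OF is_cring abelian_groupI])
  fix x assume x: "x \<in> carrier L"
  have "(\<lambda>s. (\<ominus>\<^bsub>R\<^esub> \<one>\<^bsub>R\<^esub>) \<otimes>\<^bsub>R\<^esub> x s) \<oplus>\<^bsub>L\<^esub> x = \<zero>\<^bsub>L\<^esub>"
    using carrierD(1)[OF x] by (auto simp: l_minus l_neg)
  then show "\<exists>y\<in>carrier L. y \<oplus>\<^bsub>L\<^esub> x = \<zero>\<^bsub>L\<^esub>" using smult_seq_closed[OF _ x] by blast
qed (auto simp: add_closed zero_seq_closed smult_seq_closed carrierD(1) a_ac l_distr r_distr m_assoc)

lemma diff_eq:
  assumes "x \<in> carrier L" "y \<in> carrier L"
  shows "x \<ominus>\<^bsub>L\<^esub> y = (\<lambda>s. x s \<ominus>\<^bsub>R\<^esub> y s)"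
proof -
  interpret L: Module.module R L by (rule module_L)
  have "\<ominus>\<^bsub>L\<^esub> y = (\<ominus>\<^bsub>R\<^esub> \<one>\<^bsub>R\<^esub>) \<odot>\<^bsub>L\<^esub> y"
    using assms by (subst L.smult_l_minus) (simp_all del: weighted_l1_simps(3))
  then show ?thesis using carrierD(1)[OF assms(2)] by (simp add: L.minus_eq minus_eq l_minus fun_eq_iff)
qed

lemma complete_L:
  assumes X: "\<And>n. X n \<in> carrier L"
    and cauchy: "\<And>e. e > 0 \<Longrightarrow> \<exists>n0. \<forall>m\<ge>n0. \<forall>n\<ge>n0. mnorm L (X m \<ominus>\<^bsub>L\<^esub> X n) < e"
  shows "\<exists>l\<in>carrier L. (\<lambda>n. mnorm L (X n \<ominus>\<^bsub>L\<^esub> l)) \<longlonglongrightarrow> 0"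
proof -
  interpret L: Module.module R L by (rule module_L)
  have Xc: "X n s \<in> carrier R" for n s by (rule carrierD(1)[OF X])
  have coord: "r s * rnorm R (X m s \<ominus>\<^bsub>R\<^esub> X n s) \<le> mnorm L (X m \<ominus>\<^bsub>L\<^esub> X n)" for m n s
    using coord_le[OF L.minus_closed[OF X X], of s m n] by (simp add: diff_eq X)
  have "\<exists>l. tends (weighted_copy R (r s)) (\<lambda>n. X n s) l" for s
  proof -
    have "\<exists>n0. \<forall>m\<ge>n0. \<forall>n\<ge>n0. mnorm (weighted_copy R (r s)) (X m s \<ominus>\<^bsub>weighted_copy R (r s)\<^esub> X n s) < e"
      if "e > 0" for e
      using cauchy[OF that] coord[of s] by
        (simp add: weighted_copy_diff[OF banach_ring Xc Xc], meson order_le_less_trans)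
    then show ?thesis using V.cauchy_tends[of "\<lambda>n. X n s" s] Xc by simp metis
  qed
  then obtain l where l: "\<And>s. tends (weighted_copy R (r s)) (\<lambda>n. X n s) (l s)" by metis
  have lc: "l s \<in> carrier R" for s using V.tendsD(2)[OF l, of s] by simp
  have lim: "(\<lambda>n. r s * rnorm R (X n s \<ominus>\<^bsub>R\<^esub> l s)) \<longlonglongrightarrow> 0" for s
    using V.tendsD(3)[OF l, of s] by (simp add: weighted_copy_diff[OF banach_ring Xc lc])
  have tri: "r s * rnorm R (a \<ominus>\<^bsub>R\<^esub> c) \<le> r s * rnorm R (a \<ominus>\<^bsub>R\<^esub> b) + r s * rnorm R (b \<ominus>\<^bsub>R\<^esub> c)"
    if "a \<in> carrier R" "b \<in> carrier R" "c \<in> carrier R" for a b c s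
    using V.diff_triangle[of a s b c] that by (simp add: weighted_copy_diff[OF banach_ring])
  have part: "(\<Sum>s<K. r s * rnorm R (X n s \<ominus>\<^bsub>R\<^esub> l s)) \<le> e"
    if n0: "\<And>m n. m \<ge> n0 \<Longrightarrow> n \<ge> n0 \<Longrightarrow> mnorm L (X m \<ominus>\<^bsub>L\<^esub> X n) < e" and n: "n \<ge> n0" for e n0 n K
  proof (rule LIMSEQ_le_const)
    show "(\<lambda>m. e + (\<Sum>s<K. r s * rnorm R (X m s \<ominus>\<^bsub>R\<^esub> l s))) \<longlonglongrightarrow> e"
      using tendsto_add[OF tendsto_const[of e] tendsto_sum[of "{..<K}", OF lim]] by simp
    have "(\<Sum>s<K. r s * rnorm R (X n s \<ominus>\<^bsub>R\<^esub> l s)) \<le> e + (\<Sum>s<K. r s * rnorm R (X m s \<ominus>\<^bsub>R\<^esub> l s))"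
      if m: "m \<ge> n0" for m
    proof -
      have d: "X n \<ominus>\<^bsub>L\<^esub> X m \<in> carrier L" by (rule L.minus_closed[OF X X])
      have "(\<Sum>s<K. r s * rnorm R (X n s \<ominus>\<^bsub>R\<^esub> X m s)) \<le> mnorm L (X n \<ominus>\<^bsub>L\<^esub> X m)"
        using sum_le_suminf[OF carrierD(2)[OF d], of "{..<K}"] carrierD(3)[OF d]
        unfolding norm_eq[OF d] by (simp add: diff_eq X)
      also have "\<dots> < e" by (rule n0[OF n m])
      finally have "(\<Sum>s<K. r s * rnorm R (X n s \<ominus>\<^bsub>R\<^esub> X m s)) \<le> e" by simp
      moreover have "(\<Sum>s<K. r s * rnorm R (X n s \<ominus>\<^bsub>R\<^esub> l s)) \<le>
          (\<Sum>s<K. r s * rnorm R (X n s \<ominus>\<^bsub>R\<^esub> X m s) + r s * rnorm R (X m s \<ominus>\<^bsub>R\<^esub> l s))"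
        by (intro sum_mono tri Xc lc)
      ultimately show ?thesis by (simp add: sum.distrib)
    qed
    then show "\<exists>N. \<forall>m\<ge>N. (\<Sum>s<K. r s * rnorm R (X n s \<ominus>\<^bsub>R\<^esub> l s))
        \<le> e + (\<Sum>s<K. r s * rnorm R (X m s \<ominus>\<^bsub>R\<^esub> l s))" by blast
  qed
  have dm: "(\<lambda>s. X n s \<ominus>\<^bsub>R\<^esub> l s) \<in> carrier L" "mnorm L (\<lambda>s. X n s \<ominus>\<^bsub>R\<^esub> l s) \<le> e"
    if n0: "\<And>m n. m \<ge> n0 \<Longrightarrow> n \<ge> n0 \<Longrightarrow> mnorm L (X m \<ominus>\<^bsub>L\<^esub> X n) < e" and n: "n \<ge> n0" for e n0 n
  proof -
    have nn: "0 \<le> r s * rnorm R (X n s \<ominus>\<^bsub>R\<^esub> l s)" for s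
      using V.norm_nonneg[of "X n s \<ominus>\<^bsub>R\<^esub> l s" s] Xc lc by simp
    have sm: "summable (\<lambda>s. r s * rnorm R (X n s \<ominus>\<^bsub>R\<^esub> l s))"
      by (rule summableI_nonneg_bounded[OF nn part[OF n0 n]])
    then show d: "(\<lambda>s. X n s \<ominus>\<^bsub>R\<^esub> l s) \<in> carrier L" using Xc lc by (simp add: carrier_iff)
    show "mnorm L (\<lambda>s. X n s \<ominus>\<^bsub>R\<^esub> l s) \<le> e"
      unfolding norm_eq[OF d] by (rule suminf_le_const[OF sm part[OF n0 n]])
  qed
  have lL: "l \<in> carrier L"
  proof -
    obtain n0 where n0: "\<And>m n. m \<ge> n0 \<Longrightarrow> n \<ge> n0 \<Longrightarrow> mnorm L (X m \<ominus>\<^bsub>L\<^esub> X n) < 1"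
      using cauchy[of 1] by auto
    have "X n0 \<ominus>\<^bsub>L\<^esub> (\<lambda>s. X n0 s \<ominus>\<^bsub>R\<^esub> l s) \<in> carrier L"
      by (intro L.minus_closed X dm(1)[OF n0 order.refl])
    moreover have "X n0 s \<ominus>\<^bsub>R\<^esub> (X n0 s \<ominus>\<^bsub>R\<^esub> l s) = l s" for s
      using Xc[of n0 s] lc[of s] by (simp add: minus_eq minus_add r_neg2)
    ultimately show ?thesis using dm(1)[OF n0 order.refl] by (simp add: diff_eq X)
  qed
  have "(\<lambda>n. mnorm L (X n \<ominus>\<^bsub>L\<^esub> l)) \<longlonglongrightarrow> 0"
  proof (rule LIMSEQ_I)
    fix e :: real assume e: "e > 0"
    then obtain n0 where n0: "\<And>m n. m \<ge> n0 \<Longrightarrow> n \<ge> n0 \<Longrightarrow> mnorm L (X m \<ominus>\<^bsub>L\<^esub> X n) < e / 2"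
      using cauchy[of "e / 2"] by auto
    have "norm (mnorm L (X n \<ominus>\<^bsub>L\<^esub> l) - 0) < e" if n: "n \<ge> n0" for n
    proof -
      have d: "X n \<ominus>\<^bsub>L\<^esub> l \<in> carrier L" by (rule L.minus_closed[OF X lL])
      have "0 \<le> mnorm L (X n \<ominus>\<^bsub>L\<^esub> l)"
        unfolding norm_eq[OF d] by (rule suminf_nonneg[OF carrierD(2,3)[OF d]])
      with dm(2)[OF n0 n] e show ?thesis by (simp add: diff_eq X lL)
    qed
    then show "\<exists>n0. \<forall>n\<ge>n0. norm (mnorm L (X n \<ominus>\<^bsub>L\<^esub> l) - 0) < e" by blast
  qed
  with lL show ?thesis by blast
qed

theorem banach_L: "banach_module R L"
proof -
  have "0 \<le> mnorm L x" if "x \<in> carrier L" for x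
    unfolding norm_eq[OF that] by (rule suminf_nonneg[OF carrierD(2,3)[OF that]])
  moreover have "mnorm L x = 0 \<longleftrightarrow> x = (\<lambda>s. \<zero>\<^bsub>R\<^esub>)" if x: "x \<in> carrier L" for x
  proof -
    have "mnorm L x = 0 \<longleftrightarrow> (\<forall>s. r s * rnorm R (x s) = 0)"
      unfolding norm_eq[OF x] by (rule suminf_eq_zero_iff[OF carrierD(2,3)[OF x]])
    also have "\<dots> \<longleftrightarrow> (\<forall>s. x s = \<zero>\<^bsub>R\<^esub>)"
      using V.norm_eq_zero_iff carrierD(1)[OF x] by simp
    finally show ?thesis by auto
  qed
  ultimately have "complete_norm L (mnorm L)"
    unfolding complete_norm_def
    by (intro conjI ballI allI impI) (auto simp: add_closed range_subsetD intro!: complete_L)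
  moreover obtain C where "C > 0"
    "\<And>a x. a \<in> carrier R \<Longrightarrow> x \<in> carrier L \<Longrightarrow> mnorm L (\<lambda>s. a \<otimes>\<^bsub>R\<^esub> x s) \<le> C * rnorm R a * mnorm L x"
    by (rule smult_bounded) blast
  ultimately show ?thesis unfolding banach_module_def using module_L by auto
qed

text \<open>Bounded maps out of \<^const>\<open>weighted_l1\<close> are given by the images of the unit vectors.\<close>

lemma hom_from_L:
  assumes N: "banach_module R N" and w: "\<And>i. w i \<in> carrier N" "\<And>i. mnorm N (w i) \<le> r i"
  obtains c where "c \<in> bounded_hom R L N"
    "\<And>x. x \<in> carrier L \<Longrightarrow> tends N (\<lambda>k. finsum N (\<lambda>i. x i \<odot>\<^bsub>N\<^esub> w i) {..<k}) (c x)"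
proof -
  interpret LN: banach_mod_pair R L N using banach_ring banach_L N by unfold_locales
  obtain C where C: "C > 0"
    "\<And>a x. a \<in> carrier R \<Longrightarrow> x \<in> carrier N \<Longrightarrow> mnorm N (a \<odot>\<^bsub>N\<^esub> x) \<le> C * rnorm R a * mnorm N x"
    by (rule LN.N.smult_bound) blast
  have xw: "x i \<odot>\<^bsub>N\<^esub> w i \<in> carrier N" if "x \<in> carrier L" for x i
    using carrierD(1)[OF that] w(1) by simp
  have le: "mnorm N (x i \<odot>\<^bsub>N\<^esub> w i) \<le> C * (r i * rnorm R (x i))" if x: "x \<in> carrier L" for x i
  proof -
    have "mnorm N (x i \<odot>\<^bsub>N\<^esub> w i) \<le> C * rnorm R (x i) * mnorm N (w i)"
      by (rule C(2)[OF carrierD(1)[OF x] w(1)])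
    also have "\<dots> \<le> C * rnorm R (x i) * r i"
      using C(1) carrierD(1)[OF x] by (intro mult_left_mono w) simp
    finally show ?thesis by (simp add: mult_ac)
  qed
  have ex: "\<exists>y. tends N (\<lambda>k. finsum N (\<lambda>i. x i \<odot>\<^bsub>N\<^esub> w i) {..<k}) y \<and> mnorm N y \<le> C * mnorm L x"
    if x: "x \<in> carrier L" for x
  proof -
    have sC: "summable (\<lambda>i. C * (r i * rnorm R (x i)))" by (rule summable_mult[OF carrierD(2)[OF x]])
    have sm: "summable (\<lambda>i. mnorm N (x i \<odot>\<^bsub>N\<^esub> w i))"
      by (rule summable_comparison_test'[OF sC, of 0]) (use le[OF x] xw[OF x] in simp)
    obtain y where y: "tends N (\<lambda>k. finsum N (\<lambda>i. x i \<odot>\<^bsub>N\<^esub> w i) {..<k}) y"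
      "mnorm N y \<le> (\<Sum>i. mnorm N (x i \<odot>\<^bsub>N\<^esub> w i))"
      by (rule LN.N.tends_series[OF xw[OF x] sm])
    note y(2)
    also have "(\<Sum>i. mnorm N (x i \<odot>\<^bsub>N\<^esub> w i)) \<le> (\<Sum>i. C * (r i * rnorm R (x i)))"
      by (rule suminf_le[OF le[OF x] sm sC])
    also have "\<dots> = C * mnorm L x" using suminf_mult[OF carrierD(2)[OF x]] by (simp add: norm_eq x)
    finally show ?thesis using y(1) by blast
  qed
  define c where "c = (\<lambda>x\<in>carrier L. SOME y. tends N (\<lambda>k. finsum N (\<lambda>i. x i \<odot>\<^bsub>N\<^esub> w i) {..<k}) y \<and>
    mnorm N y \<le> C * mnorm L x)"
  have c: "tends N (\<lambda>k. finsum N (\<lambda>i. x i \<odot>\<^bsub>N\<^esub> w i) {..<k}) (c x)" "mnorm N (c x) \<le> C * mnorm L x"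
    if x: "x \<in> carrier L" for x
    using someI_ex[OF ex[OF x]] x by (simp_all add: c_def)
  have "c \<in> bounded_hom R L N"
  proof (rule LN.bounded_homI[OF _ _ _ _ c(2)])
    show "c \<in> extensional (carrier L)" by (simp add: c_def)
    show "c x \<in> carrier N" if "x \<in> carrier L" for x using LN.N.tendsD(2)[OF c(1)[OF that]] .
    fix x assume x: "x \<in> carrier L"
    show "c (x \<oplus>\<^bsub>L\<^esub> y) = c x \<oplus>\<^bsub>N\<^esub> c y" if y: "y \<in> carrier L" for y
    proof -
      have "finsum N (\<lambda>i. (x \<oplus>\<^bsub>L\<^esub> y) i \<odot>\<^bsub>N\<^esub> w i) {..<k} =
          finsum N (\<lambda>i. x i \<odot>\<^bsub>N\<^esub> w i) {..<k} \<oplus>\<^bsub>N\<^esub> finsum N (\<lambda>i. y i \<odot>\<^bsub>N\<^esub> w i) {..<k}" for k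
        using xw[OF x] xw[OF y] carrierD(1)[OF x] carrierD(1)[OF y] w(1)
        by (simp add: LN.N.smult_l_distr LN.N.finsum_addf Pi_def)
      with LN.N.tends_add[OF c(1)[OF x] c(1)[OF y]] LN.N.tends_unique[OF c(1)[of "x \<oplus>\<^bsub>L\<^esub> y"]] show ?thesis
        using add_closed(1)[OF x y] by simp
    qed
    show "c (a \<odot>\<^bsub>L\<^esub> x) = a \<odot>\<^bsub>N\<^esub> c x" if a: "a \<in> carrier R" for a
    proof -
      have "finsum N (\<lambda>i. (a \<odot>\<^bsub>L\<^esub> x) i \<odot>\<^bsub>N\<^esub> w i) {..<k} = a \<odot>\<^bsub>N\<^esub> finsum N (\<lambda>i. x i \<odot>\<^bsub>N\<^esub> w i) {..<k}" for k
        using xw[OF x] carrierD(1)[OF x] w(1) a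
        by (simp add: LN.N.smult_assoc1 LN.N.finsum_smult_ldistr)
      with LN.N.tends_smult[OF a c(1)[OF x]] LN.N.tends_unique[OF c(1)[of "a \<odot>\<^bsub>L\<^esub> x"]] show ?thesis
        using smult_seq_closed[OF a x] by simp
    qed
  qed
  with c(1) show ?thesis by (intro that)
qed

text \<open>The generator of the \<open>i\<close>-th summand, of norm \<open>r i \<bar>1\<bar>\<close>.\<close>

definition unit_vector :: "nat \<Rightarrow> nat \<Rightarrow> 'a" where
  "unit_vector i = (\<lambda>j. if j = i then \<one>\<^bsub>R\<^esub> else \<zero>\<^bsub>R\<^esub>)"

lemma unit_vector_norm: "unit_vector i \<in> carrier L" "mnorm L (unit_vector i) = r i * rnorm R \<one>\<^bsub>R\<^esub>"
proof -
  have eq: "(\<lambda>s. r s * rnorm R (unit_vector i s)) = (\<lambda>s. if s = i then r i * rnorm R \<one>\<^bsub>R\<^esub> else 0)"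
    by (auto simp: unit_vector_def rnorm_zero)
  show u: "unit_vector i \<in> carrier L"
    by (simp add: carrier_iff eq) (simp add: unit_vector_def)
  show "mnorm L (unit_vector i) = r i * rnorm R \<one>\<^bsub>R\<^esub>"
    unfolding norm_eq[OF u] eq using sums_unique[OF sums_single[of i "\<lambda>_. r i * rnorm R \<one>\<^bsub>R\<^esub>"]] by simp
qed

text \<open>Each element is the limit of its finite truncations.\<close>

lemma truncation:
  assumes x: "x \<in> carrier L"
  shows "tends L (\<lambda>k. finsum L (\<lambda>i. x i \<odot>\<^bsub>L\<^esub> unit_vector i) {..<k}) x"
proof -
  interpret L: banach_mod R L using banach_ring banach_L by unfold_locales
  interpret U: banach_mod R "unit_module R"
    using banach_ring by unfold_locales (auto intro: weighted_copy_banach)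
  have xc: "x s \<in> carrier R" for s by (rule carrierD(1)[OF x])
  let ?u = "\<lambda>i. x i \<odot>\<^bsub>L\<^esub> unit_vector i" and ?f = "\<lambda>s. r s * rnorm R (x s)"
  have u: "?u i \<in> carrier L" for i by (intro L.smult_closed xc unit_vector_norm)
  have fc: "finsum L ?u {..<k} \<in> carrier L" for k using u by (intro L.finsum_closed) auto
  have fin: "finsum L ?u {..<k} = (\<lambda>s. if s < k then x s else \<zero>\<^bsub>R\<^esub>)" for k
  proof (induction k)
    case (Suc k)
    have "finsum L ?u {..<Suc k} = ?u k \<oplus>\<^bsub>L\<^esub> finsum L ?u {..<k}"
      unfolding lessThan_Suc using u by (intro L.finsum_insert) auto
    then show ?case unfolding Suc.IH using xc by (auto simp: unit_vector_def fun_eq_iff less_Suc_eq)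
  qed simp
  obtain C where C: "C > 0" "\<And>a. a \<in> carrier R \<Longrightarrow> rnorm R (\<zero>\<^bsub>R\<^esub> \<ominus>\<^bsub>R\<^esub> a) \<le> C * rnorm R a"
  proof (rule U.minus_bound)
    fix C assume C: "C > 0" "\<And>a. a \<in> carrier (unit_module R) \<Longrightarrow>
        mnorm (unit_module R) (\<ominus>\<^bsub>unit_module R\<^esub> a) \<le> C * mnorm (unit_module R) a"
    have "rnorm R (\<zero>\<^bsub>R\<^esub> \<ominus>\<^bsub>R\<^esub> a) \<le> C * rnorm R a" if a: "a \<in> carrier R" for a
    proof -
      have "\<zero>\<^bsub>R\<^esub> \<ominus>\<^bsub>R\<^esub> a = \<zero>\<^bsub>unit_module R\<^esub> \<ominus>\<^bsub>unit_module R\<^esub> a"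
        using a by (simp add: weighted_copy_diff[OF banach_ring])
      also have "\<dots> = \<ominus>\<^bsub>unit_module R\<^esub> a"
        using a U.M.l_zero[of "\<ominus>\<^bsub>unit_module R\<^esub> a"] U.M.a_inv_closed[of a]
        by (simp add: U.M.minus_eq del: weighted_copy_simps(2,3))
      finally show ?thesis using C(2)[of a] a by simp
    qed
    with C(1) show thesis by (rule that)
  qed
  show ?thesis
  proof (rule L.tends_sandwich[OF fc x])
    fix k
    define d where "d = finsum L ?u {..<k} \<ominus>\<^bsub>L\<^esub> x"
    have d: "d \<in> carrier L" unfolding d_def by (rule L.M.minus_closed[OF fc x])
    have ds: "d s = (if s < k then \<zero>\<^bsub>R\<^esub> else \<zero>\<^bsub>R\<^esub> \<ominus>\<^bsub>R\<^esub> x s)" for s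
      unfolding d_def diff_eq[OF fc x] unfolding fin using xc[of s] by (simp add: minus_eq r_neg)
    have "mnorm L d = (\<Sum>s. r (s + k) * rnorm R (d (s + k))) + (\<Sum>s<k. r s * rnorm R (d s))"
      unfolding norm_eq[OF d] by (rule suminf_split_initial_segment[OF carrierD(2)[OF d]])
    also have "\<dots> = (\<Sum>s. r (s + k) * rnorm R (d (s + k)))"
      by (simp add: ds rnorm_zero)
    also have "\<dots> \<le> (\<Sum>s. C * ?f (s + k))"
    proof (rule suminf_le)
      show "r (s + k) * rnorm R (d (s + k)) \<le> C * ?f (s + k)" for s
        using mult_left_mono[OF C(2)[OF xc[of "s + k"]], of "r (s + k)"] weight_pos[of "s + k"]
        by (simp add: ds mult_ac)
      show "summable (\<lambda>s. r (s + k) * rnorm R (d (s + k)))"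
        using summable_ignore_initial_segment[OF carrierD(2)[OF d]] .
      show "summable (\<lambda>s. C * ?f (s + k))"
        by (intro summable_mult summable_ignore_initial_segment[OF carrierD(2)[OF x]])
    qed
    also have "\<dots> = C * (suminf ?f - (\<Sum>s<k. ?f s))"
      using suminf_mult[OF summable_ignore_initial_segment[OF carrierD(2)[OF x], of k], of C]
        suminf_minus_initial_segment[OF carrierD(2)[OF x], of k] by simp
    finally show "mnorm L (finsum L ?u {..<k} \<ominus>\<^bsub>L\<^esub> x) \<le> C * (suminf ?f - (\<Sum>s<k. ?f s))" by (simp only: d_def)
  next
    show "(\<lambda>k. C * (suminf ?f - (\<Sum>s<k. ?f s))) \<longlonglongrightarrow> 0"
      using tendsto_mult_left[OF tendsto_diff[OF tendsto_const summable_LIMSEQ[OF carrierD(2)[OF x]]],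
          of C "suminf ?f"] by simp
  qed
qed

end

section \<open>Factorization of nuclear maps\<close>

context banach_mod_pair
begin

text \<open>The sum of \<open>l\<^sub>i \<otimes> w\<^sub>i\<close> factors as \<open>x \<mapsto> (l\<^sub>i(x))\<^sub>i\<close> into the coproduct with weights \<open>r i\<close>, followed by
  \<open>(y\<^sub>i)\<^sub>i \<mapsto> \<Sum> y\<^sub>i w\<^sub>i\<close>.  The first factor is the sum of \<open>l\<^sub>i \<otimes> e\<^sub>i\<close> with \<open>e\<^sub>i\<close> the unit vectors, hence is again
  nuclear.\<close>

theorem nuclear_map_factorization:
  assumes "nuclear_map R M N f"
  obtains r a c where "\<And>i. 0 < r i" "nuclear_map R M (weighted_l1 R r) a"
    "c \<in> bounded_hom R (weighted_l1 R r) N" "f = compose (carrier M) c a"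
proof -
  obtain l w where f: "f \<in> bounded_hom R M N" and ser: "nuclear_series l w f"
    using assms unfolding nuclear_map_iff by blast
  have l: "l i \<in> carrier (dual R M)" and w: "w i \<in> carrier N" for i
    using ser by (simp_all add: nuclear_series_def)
  let ?n = "\<lambda>i. mnorm (dual R M) (l i)"
  have n: "0 \<le> ?n i" for i by (rule dualD(5)[OF l])
  \<comment> \<open>\<open>\<parallel>w\<^sub>i\<parallel> \<le> r\<^sub>i\<close> bounds the second factor and \<open>\<Sum> \<parallel>l\<^sub>i\<parallel> r\<^sub>i\<close> is finite for the first;
    the second summand makes the weights positive even if \<open>w\<^sub>i = 0\<close>\<close>
  define r where "r i = mnorm N (w i) + (1/2) ^ i / (1 + ?n i)" for i
  have rpos: "0 < r i" for i using n[of i] w[of i] by (auto simp: r_def intro!: add_nonneg_pos)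
  interpret W: weighted_l1_space R r using M.banach_ring rpos by unfold_locales
  interpret MW: banach_mod_pair R M "W.L" using M.banach_ring M.banach_module W.banach_L by unfold_locales
  have rn: "?n i * r i \<le> ?n i * mnorm N (w i) + (1/2) ^ i" for i
  proof -
    have "b * (h / (1 + b)) \<le> h" if "0 \<le> b" "0 \<le> h" for b h :: real
      using that by (simp add: field_simps)
    from this[OF n, of "(1/2) ^ i" i] have "?n i * ((1/2) ^ i / (1 + ?n i)) \<le> (1/2) ^ i" by simp
    then show ?thesis by (simp add: r_def distrib_left)
  qed
  have smb: "summable (\<lambda>i. ?n i * mnorm N (w i) + (1/2) ^ i)"
    using ser by (intro summable_add summable_geometric) (simp_all add: nuclear_series_def)
  have sm: "summable (\<lambda>i. ?n i * r i)"
    by (rule summable_comparison_test'[OF smb, of 0]) (use rn n rpos in \<open>simp add: less_imp_le\<close>)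
  define a where "a = (\<lambda>x\<in>carrier M. \<lambda>i. l i x)"
  have ale: "r i * rnorm R (l i x) \<le> mnorm M x * (?n i * r i)" if x: "x \<in> carrier M" for x i
    using mult_left_mono[OF dualD(4)[OF l x], of "r i" i] rpos[of i] by (simp add: mult_ac)
  note aI = W.carrierI[OF _ ale summable_mult[OF sm]]
  have aL: "(\<lambda>i. l i x) \<in> carrier W.L" if "x \<in> carrier M" for x
    by (rule aI(1)[OF _ that]) (rule dualD(1)[OF l that])
  have a: "a \<in> bounded_hom R M W.L"
  proof (rule MW.bounded_homI)
    show "mnorm W.L (a x) \<le> suminf (\<lambda>i. ?n i * r i) * mnorm M x" if x: "x \<in> carrier M" for x
      using aI(2)[OF dualD(1)[OF l x] x] suminf_mult[OF sm, of "mnorm M x"] x by (simp add: a_def mult_ac)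
  qed (auto simp: a_def aL dualD[OF l] extensional_def)
  have "MW.nuclear_series l W.unit_vector a"
    unfolding MW.nuclear_series_def
  proof (intro conjI allI ballI)
    show "summable (\<lambda>i. ?n i * mnorm W.L (W.unit_vector i))"
      using summable_mult2[OF sm, of "rnorm R \<one>\<^bsub>R\<^esub>"] by (simp add: W.unit_vector_norm mult.assoc)
    show "tends W.L (\<lambda>k. finsum W.L (\<lambda>i. l i x \<odot>\<^bsub>W.L\<^esub> W.unit_vector i) {..<k}) (a x)" if "x \<in> carrier M" for x
      using W.truncation[OF aL[OF that]] that by (simp add: a_def)
  qed (simp_all add: l W.unit_vector_norm)
  then have nuc: "nuclear_map R M W.L a" unfolding MW.nuclear_map_iff using a by blast
  obtain c where c: "c \<in> bounded_hom R W.L N"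
    "\<And>x. x \<in> carrier W.L \<Longrightarrow> tends N (\<lambda>k. finsum N (\<lambda>i. x i \<odot>\<^bsub>N\<^esub> w i) {..<k}) (c x)"
    by (rule W.hom_from_L[OF N.banach_module, of w]) (use w n in \<open>auto simp: r_def\<close>)
  have "f = compose (carrier M) c a"
  proof (rule bounded_hom_ext[OF f])
    show "compose (carrier M) c a \<in> bounded_hom R M N"
      using bounded_hom_compose(1)[OF M.banach_ring M.banach_module W.banach_L N.banach_module a c(1)] .
    fix x assume x: "x \<in> carrier M"
    have "tends N (\<lambda>k. finsum N (\<lambda>i. l i x \<odot>\<^bsub>N\<^esub> w i) {..<k}) (f x)"
      using ser x by (simp add: nuclear_series_def)
    from N.tends_unique[OF this c(2)[OF aL[OF x]]] show "f x = compose (carrier M) c a x"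
      using x by (simp add: compose_def a_def)
  qed
  with rpos nuc c(1) show ?thesis by (rule that)
qed

end

lemma nuclear_map_compose:
  assumes R: "banach_ring R" and "banach_module R X" "banach_module R Y" "banach_module R Z"
    and g: "g \<in> bounded_hom R X Y" and f: "nuclear_map R Y Z f"
  shows "nuclear_map R X Z (compose (carrier X) f g)"
proof -
  interpret XY: banach_mod_pair R X Y using assms by unfold_locales
  interpret XZ: banach_mod_pair R X Z using assms by unfold_locales
  interpret YZ: banach_mod_pair R Y Z using assms by unfold_locales
  obtain l w where fh: "f \<in> bounded_hom R Y Z" and ser: "YZ.nuclear_series l w f"
    using f unfolding YZ.nuclear_map_iff by blast
  have l: "l i \<in> bounded_hom R Y (unit_module R)" and w: "w i \<in> carrier Z" for i
    using ser by (simp_all add: YZ.nuclear_series_def YZ.dual_simps)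
  have u: "banach_module R (unit_module R)" using R by (simp add: weighted_copy_banach)
  let ?l = "\<lambda>i. compose (carrier X) (l i) g"
  note lc = bounded_hom_compose[OF R assms(2,3) u g l]
  have "XZ.nuclear_series ?l w (compose (carrier X) f g)"
    unfolding XZ.nuclear_series_def
  proof (intro conjI allI ballI)
    show "?l i \<in> carrier (dual R X)" for i using lc(1) by (simp add: XZ.dual_simps)
    have sm: "summable (\<lambda>i. op_norm X Y g * (mnorm (dual R Y) (l i) * mnorm Z (w i)))"
      using ser by (intro summable_mult) (simp add: YZ.nuclear_series_def)
    show "summable (\<lambda>i. mnorm (dual R X) (?l i) * mnorm Z (w i))"
    proof (rule summable_comparison_test'[OF sm, of 0])
      fix i
      have "op_norm X (unit_module R) (?l i) * mnorm Z (w i)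
          \<le> (op_norm Y (unit_module R) (l i) * op_norm X Y g) * mnorm Z (w i)"
        by (intro mult_right_mono lc(2) XZ.N.norm_nonneg w)
      then show "norm (mnorm (dual R X) (?l i) * mnorm Z (w i))
          \<le> op_norm X Y g * (mnorm (dual R Y) (l i) * mnorm Z (w i))"
        using XZ.dualD(5)[of "?l i"] lc(1)[of i] w[of i] by (simp add: dual_def mult_ac)
    qed
    show "tends Z (\<lambda>k. finsum Z (\<lambda>i. ?l i x \<odot>\<^bsub>Z\<^esub> w i) {..<k}) (compose (carrier X) f g x)"
      if x: "x \<in> carrier X" for x
      using ser XY.bounded_homD(1)[OF g x] x by (simp add: YZ.nuclear_series_def compose_def)
  qed (rule w)
  then show ?thesis
    unfolding XZ.nuclear_map_iff using bounded_hom_compose(1)[OF assms(1-4) g fh] by blast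
qed

section \<open>Ind-objects indexed by directed posets\<close>

lemma bex2I: "x \<in> A \<Longrightarrow> y \<in> B \<Longrightarrow> P x y \<Longrightarrow> \<exists>x\<in>A. \<exists>y\<in>B. P x y"
  by blast

lemma bounded_hom_closed: "f \<in> bounded_hom R M N \<Longrightarrow> x \<in> carrier M \<Longrightarrow> f x \<in> carrier N"
  by (auto simp: bounded_hom_def)

lemma bounded_hom_id:
  assumes "banach_ring R" "banach_module R M"
  shows "(\<lambda>x\<in>carrier M. x) \<in> bounded_hom R M M"
proof -
  interpret banach_mod_pair R M M using assms by unfold_locales
  show ?thesis by (rule bounded_homI[where C = 1]) auto
qed

lemma poset_cat_simps [simp]:
  "Ob (poset_cat I L) = I" "Ar (poset_cat I L) = L" "Dom (poset_cat I L) u = fst u"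
  "Cod (poset_cat I L) u = snd u" "Idt (poset_cat I L) i = (i, i)"
  "Cmp (poset_cat I L) v u = (fst u, snd v)"
  by (simp_all add: poset_cat_def)

lemma filtered_poset_cat:
  assumes "partial_order_on I L" "I \<noteq> {}" "\<forall>i\<in>I. \<forall>j\<in>I. \<exists>k\<in>I. (i, k) \<in> L \<and> (j, k) \<in> L"
  shows "filtered_category (poset_cat I L)"
proof -
  note po = partial_order_onD[OF assms(1)]
  have sub: "fst u \<in> I" "snd u \<in> I" if "u \<in> L" for u using po(4) that by auto
  have rf: "(i, i) \<in> L" if "i \<in> I" for i using po(1) that by (simp add: refl_onD)
  have tr: "(fst u, snd v) \<in> L" if "u \<in> L" "v \<in> L" "fst v = snd u" for u v
    using po(2) that by (metis prod.collapse transD)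
  have "category (poset_cat I L)"
    unfolding category_def poset_cat_simps
    by (intro conjI ballI impI; (simp only: fst_conv snd_conv prod.collapse)?; blast intro: sub rf tr)
  moreover have "\<exists>f\<in>L. \<exists>g\<in>L. fst f = i \<and> fst g = j \<and> snd f = snd g" if ij: "i \<in> I" "j \<in> I" for i j
  proof -
    obtain k where k: "(i, k) \<in> L" "(j, k) \<in> L" using assms(3) ij by blast
    have "fst (i, k) = i \<and> fst (j, k) = j \<and> snd (i, k) = snd (j, k)" by simp
    then show ?thesis using k by blast
  qed
  moreover have "\<exists>h\<in>L. fst h = snd f \<and> (fst f, snd h) = (fst g, snd h)"
    if "f \<in> L" "g \<in> L" "fst f = fst g" for f g
  proof
    show "(snd f, snd f) \<in> L" by (rule rf[OF sub(2)[OF that(1)]])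
    show "fst (snd f, snd f) = snd f \<and> (fst f, snd (snd f, snd f)) = (fst g, snd (snd f, snd f))"
      using that(3) by simp
  qed
  ultimately show ?thesis unfolding filtered_category_def using assms(2) by auto
qed

lemma colim_rel_self:
  assumes "j \<in> Ob (idx F)" "g \<in> bounded_hom R A (obj F j)" "u \<in> Ar (idx F)" "Dom (idx F) u = j"
  shows "((j, g), (j, g)) \<in> colim_rel R A F"
  unfolding colim_rel_def mem_Collect_eq case_prod_conv using assms by blast

text \<open>A functor from a directed poset to Banach modules.\<close>

locale poset_functor =
  fixes R :: "'a normed_ring" and I :: "'i set" and L :: "'i rel"
    and F :: "('i, 'i \<times> 'i, 'a, 'n) ind_obj"
  assumes banach_ring: "banach_ring R"
    and order: "partial_order_on I L"
    and directed: "\<And>i j. i \<in> I \<Longrightarrow> j \<in> I \<Longrightarrow> \<exists>k\<in>I. (i, k) \<in> L \<and> (j, k) \<in> L"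
    and idx_eq: "idx F = poset_cat I L"
    and is_functor: "ban_functor R F"
begin

lemma le_refl: "i \<in> I \<Longrightarrow> (i, i) \<in> L"
  using partial_order_onD(1)[OF order] by (simp add: refl_onD)

lemma le_trans: "(i, j) \<in> L \<Longrightarrow> (j, k) \<in> L \<Longrightarrow> (i, k) \<in> L"
  using partial_order_onD(2)[OF order] by (rule transD)

lemma le_mem: "(i, j) \<in> L \<Longrightarrow> i \<in> I" "(i, j) \<in> L \<Longrightarrow> j \<in> I"
  using partial_order_onD(4)[OF order] by auto

lemma obj_banach: "i \<in> I \<Longrightarrow> banach_module R (obj F i)"
  using is_functor by (simp add: ban_functor_def idx_eq)

lemma tr_hom: "(i, j) \<in> L \<Longrightarrow> tr F (i, j) \<in> bounded_hom R (obj F i) (obj F j)"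
  using is_functor by (force simp: ban_functor_def idx_eq)

lemma tr_id: "i \<in> I \<Longrightarrow> x \<in> carrier (obj F i) \<Longrightarrow> tr F (i, i) x = x"
  using is_functor by (simp add: ban_functor_def idx_eq)

lemma tr_comp:
  assumes "(i, j) \<in> L" "(j, k) \<in> L" "x \<in> carrier (obj F i)"
  shows "tr F (j, k) (tr F (i, j) x) = tr F (i, k) x"
proof -
  have "tr F (i, k) = compose (carrier (obj F i)) (tr F (j, k)) (tr F (i, j))"
    using is_functor assms(1,2) unfolding ban_functor_def idx_eq by force
  then show ?thesis using assms(3) by (simp add: compose_def)
qed

lemma colim_rel_iff:
  "((j, g), (j', g')) \<in> colim_rel R A F \<longleftrightarrow>
     g \<in> bounded_hom R A (obj F j) \<and> g' \<in> bounded_hom R A (obj F j') \<and>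
     (\<exists>k. (j, k) \<in> L \<and> (j', k) \<in> L \<and> (\<forall>x\<in>carrier A. tr F (j, k) (g x) = tr F (j', k) (g' x)))"
  (is "?l \<longleftrightarrow> ?r")
proof
  assume ?l
  then obtain u u' where u: "u \<in> L" "u' \<in> L" "fst u = j" "fst u' = j'" "snd u = snd u'"
    "compose (carrier A) (tr F u) g = compose (carrier A) (tr F u') g'"
    and g: "g \<in> bounded_hom R A (obj F j)" "g' \<in> bounded_hom R A (obj F j')"
    by (auto simp: colim_rel_def idx_eq)
  have "tr F (j, snd u) (g x) = tr F (j', snd u) (g' x)" if "x \<in> carrier A" for x
    using fun_cong[OF u(6), of x] that u(3-5) by (cases u; cases u') (simp add: compose_def)
  then show ?r using g u by (intro conjI exI[of _ "snd u"]) (auto simp: prod_eq_iff, (metis prod.collapse)+)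
next
  assume ?r
  then obtain k where k: "(j, k) \<in> L" "(j', k) \<in> L" "\<forall>x\<in>carrier A. tr F (j, k) (g x) = tr F (j', k) (g' x)"
    and g: "g \<in> bounded_hom R A (obj F j)" "g' \<in> bounded_hom R A (obj F j')" by blast
  have "compose (carrier A) (tr F (j, k)) g = compose (carrier A) (tr F (j', k)) g'"
    using k(3) by (auto simp: compose_def fun_eq_iff)
  then have "\<exists>u\<in>L. \<exists>u'\<in>L. fst u = j \<and> fst u' = j' \<and> snd u = snd u' \<and>
      compose (carrier A) (tr F u) g = compose (carrier A) (tr F u') g'"
    by (intro bex2I[OF k(1,2)]) simp
  then show ?l
    unfolding colim_rel_def using g le_mem[OF k(1)] le_mem[OF k(2)] by (simp add: idx_eq)
qed

text \<open>Directedness makes the relation that defines the filtered colimit transitive.\<close>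

lemma equiv_colim_rel: "equiv (SIGMA j:I. bounded_hom R A (obj F j)) (colim_rel R A F)"
proof (rule equivI)
  show "colim_rel R A F \<subseteq> (SIGMA j:I. bounded_hom R A (obj F j)) \<times> (SIGMA j:I. bounded_hom R A (obj F j))"
    by (auto simp: colim_rel_def idx_eq)
  show "refl_on (SIGMA j:I. bounded_hom R A (obj F j)) (colim_rel R A F)"
  proof (rule refl_onI)
    fix x assume "x \<in> (SIGMA j:I. bounded_hom R A (obj F j))"
    then show "(x, x) \<in> colim_rel R A F" using le_refl by (cases x) (force simp: colim_rel_iff)
  qed
  show "sym (colim_rel R A F)"
    by (rule symI) (force simp: colim_rel_iff)
  show "trans (colim_rel R A F)"
  proof (rule transI)
    fix x y z assume xy: "(x, y) \<in> colim_rel R A F" and yz: "(y, z) \<in> colim_rel R A F"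
    obtain j1 g1 j2 g2 j3 g3 where e: "x = (j1, g1)" "y = (j2, g2)" "z = (j3, g3)"
      by (cases x; cases y; cases z) auto
    obtain k where k: "(j1, k) \<in> L" "(j2, k) \<in> L" "\<forall>x\<in>carrier A. tr F (j1, k) (g1 x) = tr F (j2, k) (g2 x)"
      using xy by (auto simp: e colim_rel_iff)
    obtain k' where k': "(j2, k') \<in> L" "(j3, k') \<in> L" "\<forall>x\<in>carrier A. tr F (j2, k') (g2 x) = tr F (j3, k') (g3 x)"
      using yz by (auto simp: e colim_rel_iff)
    have g: "g1 \<in> bounded_hom R A (obj F j1)" "g2 \<in> bounded_hom R A (obj F j2)" "g3 \<in> bounded_hom R A (obj F j3)"
      using xy yz by (auto simp: e colim_rel_iff)
    obtain m where m: "(k, m) \<in> L" "(k', m) \<in> L"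
      using directed le_mem[OF k(1)] le_mem[OF k'(1)] by blast
    have "tr F (j1, m) (g1 x) = tr F (j3, m) (g3 x)" if x: "x \<in> carrier A" for x
    proof -
      note c = bounded_hom_closed[OF g(1) x] bounded_hom_closed[OF g(2) x] bounded_hom_closed[OF g(3) x]
      have "tr F (j1, m) (g1 x) = tr F (k, m) (tr F (j2, k) (g2 x))"
        using tr_comp[OF k(1) m(1) c(1)] k(3) x by simp
      also have "\<dots> = tr F (k', m) (tr F (j2, k') (g2 x))"
        using tr_comp[OF k(2) m(1) c(2)] tr_comp[OF k'(1) m(2) c(2)] by simp
      also have "\<dots> = tr F (j3, m) (g3 x)" using tr_comp[OF k'(2) m(2) c(3)] k'(3) x by simp
      finally show ?thesis .
    qed
    then show "(x, z) \<in> colim_rel R A F"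
      unfolding e colim_rel_iff using g le_trans[OF k(1) m(1)] le_trans[OF k'(2) m(2)] by blast
  qed
qed

lemma colim_rel_refl: "j \<in> I \<Longrightarrow> g \<in> bounded_hom R A (obj F j) \<Longrightarrow> ((j, g), (j, g)) \<in> colim_rel R A F"
  using le_refl by (force simp: colim_rel_iff)

lemma colim_rel_sym: "(x, y) \<in> colim_rel R A F \<Longrightarrow> (y, x) \<in> colim_rel R A F"
  using equiv_colim_rel[of A] by (auto elim: equivE dest: symD)

lemma colim_rel_trans:
  "(x, y) \<in> colim_rel R A F \<Longrightarrow> (y, z) \<in> colim_rel R A F \<Longrightarrow> (x, z) \<in> colim_rel R A F"
  using equiv_colim_rel[of A] by (auto elim: equivE dest: transD)

lemma colim_rel_precompose:
  assumes "banach_module R A" "banach_module R B" "((j, g), (j', g')) \<in> colim_rel R A F"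
    and f: "f \<in> bounded_hom R B A"
  shows "((j, compose (carrier B) g f), (j', compose (carrier B) g' f)) \<in> colim_rel R B F"
proof -
  from assms(3) obtain k where k: "(j, k) \<in> L" "(j', k) \<in> L" "\<forall>x\<in>carrier A. tr F (j, k) (g x) = tr F (j', k) (g' x)"
    and g: "g \<in> bounded_hom R A (obj F j)" "g' \<in> bounded_hom R A (obj F j')"
    by (auto simp: colim_rel_iff)
  note b = obj_banach[OF le_mem(1)[OF k(1)]] obj_banach[OF le_mem(1)[OF k(2)]]
  show ?thesis
    unfolding colim_rel_iff
    using bounded_hom_compose(1)[OF banach_ring assms(2,1) b(1) f g(1)]
      bounded_hom_compose(1)[OF banach_ring assms(2,1) b(2) f g(2)] k bounded_hom_closed[OF f]
    by (intro conjI exI[of _ k]) (simp_all add: compose_def)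
qed

end

text \<open>A family of maps \<open>a i\<close> from \<open>E i\<close> to \<open>F (\<alpha> i)\<close> that represents an element of the limit over
  \<open>i\<close> of the colimits of \<open>Hom(E i, F j)\<close>.  Compatibility with a transition map is only required in the
  colimit, and \<open>\<alpha>\<close> need not be monotone.\<close>

definition compatible_family ::
  "'a normed_ring \<Rightarrow> ('i, 'i \<times> 'i, 'a, 'm) ind_obj \<Rightarrow> ('j, 'j \<times> 'j, 'a, 'n) ind_obj
     \<Rightarrow> ('i \<Rightarrow> 'j) \<Rightarrow> ('i \<Rightarrow> 'm \<Rightarrow> 'n) \<Rightarrow> bool" where
  "compatible_family R E F \<alpha> a \<longleftrightarrow>
     (\<forall>i\<in>Ob (idx E). \<alpha> i \<in> Ob (idx F) \<and> a i \<in> bounded_hom R (obj E i) (obj F (\<alpha> i))) \<and>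
     (\<forall>(i, i')\<in>Ar (idx E). ((\<alpha> i, a i), (\<alpha> i', compose (carrier (obj E i)) (a i') (tr E (i, i'))))
        \<in> colim_rel R (obj E i) F)"

text \<open>The morphism of ind-objects represented by such a family.\<close>

definition induced_morphism ::
  "'a normed_ring \<Rightarrow> ('i, 'i \<times> 'i, 'a, 'm) ind_obj \<Rightarrow> ('j, 'j \<times> 'j, 'a, 'n) ind_obj
     \<Rightarrow> ('i \<Rightarrow> 'j) \<Rightarrow> ('i \<Rightarrow> 'm \<Rightarrow> 'n) \<Rightarrow> 'i \<Rightarrow> ('j \<times> ('m \<Rightarrow> 'n)) set" where
  "induced_morphism R E F \<alpha> a = (\<lambda>i\<in>Ob (idx E). colim_rel R (obj E i) F `` {(\<alpha> i, a i)})"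

lemma induced_morphism_hom:
  assumes "poset_functor R I LE E" "poset_functor R J LF F" and comp: "compatible_family R E F \<alpha> a"
  shows "induced_morphism R E F \<alpha> a \<in> ind_hom R E F"
proof -
  interpret E: poset_functor R I LE E by fact
  interpret F: poset_functor R J LF F by fact
  have a: "\<alpha> i \<in> J" "a i \<in> bounded_hom R (obj E i) (obj F (\<alpha> i))" if "i \<in> I" for i
    using comp that by (auto simp: compatible_family_def E.idx_eq F.idx_eq)
  have nat: "((\<alpha> i, a i), (\<alpha> i', compose (carrier (obj E i)) (a i') (tr E (i, i')))) \<in> colim_rel R (obj E i) F"
    if "(i, i') \<in> LE" for i i'
    using comp that by (auto simp: compatible_family_def E.idx_eq)
  have 1: "induced_morphism R E F \<alpha> a \<in> (\<Pi>\<^sub>E i\<in>I. colim_hom R (obj E i) F)"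
    using a by (auto simp: induced_morphism_def E.idx_eq F.idx_eq colim_hom_def intro!: quotientI)
  have 2: "(j, compose (carrier (obj E i)) g (tr E (i, i'))) \<in> induced_morphism R E F \<alpha> a i"
    if le: "(i, i') \<in> LE" and g: "(j, g) \<in> induced_morphism R E F \<alpha> a i'" for i i' j g
  proof -
    note m = E.le_mem[OF le]
    have "((\<alpha> i', a i'), (j, g)) \<in> colim_rel R (obj E i') F"
      using g m by (simp add: induced_morphism_def E.idx_eq)
    then have "((\<alpha> i', compose (carrier (obj E i)) (a i') (tr E (i, i'))),
        (j, compose (carrier (obj E i)) g (tr E (i, i')))) \<in> colim_rel R (obj E i) F"
      by (rule F.colim_rel_precompose[OF E.obj_banach[OF m(2)] E.obj_banach[OF m(1)] _ E.tr_hom[OF le]])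
    from F.colim_rel_trans[OF nat[OF le] this] show ?thesis
      using m by (simp add: induced_morphism_def E.idx_eq)
  qed
  show ?thesis unfolding ind_hom_def using 1 2 by (auto simp: E.idx_eq)
qed

lemma induced_morphism_comp:
  assumes "poset_functor R I LE E" "poset_functor R J LF F" "poset_functor R K LG G"
    and ca: "compatible_family R E F \<alpha> a" and cb: "compatible_family R F G \<beta> b"
  shows "ind_comp R E G (induced_morphism R F G \<beta> b) (induced_morphism R E F \<alpha> a) =
    induced_morphism R E G (\<lambda>i. \<beta> (\<alpha> i)) (\<lambda>i. compose (carrier (obj E i)) (b (\<alpha> i)) (a i))"
proof -
  interpret E: poset_functor R I LE E by fact
  interpret F: poset_functor R J LF F by fact
  interpret G: poset_functor R K LG G by fact
  have a: "\<alpha> i \<in> J" "a i \<in> bounded_hom R (obj E i) (obj F (\<alpha> i))" if "i \<in> I" for i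
    using ca that by (auto simp: compatible_family_def E.idx_eq F.idx_eq)
  have b: "\<beta> j \<in> K" "b j \<in> bounded_hom R (obj F j) (obj G (\<beta> j))" if "j \<in> J" for j
    using cb that by (auto simp: compatible_family_def G.idx_eq F.idx_eq)
  have natb: "((\<beta> j, b j), (\<beta> j', compose (carrier (obj F j)) (b j') (tr F (j, j')))) \<in> colim_rel R (obj F j) G"
    if "(j, j') \<in> LF" for j j'
    using cb that by (auto simp: compatible_family_def F.idx_eq)
  have key: "colim_rel R (obj E i) G `` {(k, compose (carrier (obj E i)) h g)} =
      colim_rel R (obj E i) G `` {(\<beta> (\<alpha> i), compose (carrier (obj E i)) (b (\<alpha> i)) (a i))}"
    if i: "i \<in> I" and jg: "((\<alpha> i, a i), (j, g)) \<in> colim_rel R (obj E i) F"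
      and kh: "((\<beta> j, b j), (k, h)) \<in> colim_rel R (obj F j) G" for i j g k h
  proof -
    obtain m where m: "(\<alpha> i, m) \<in> LF" "(j, m) \<in> LF"
        "\<forall>x\<in>carrier (obj E i). tr F (\<alpha> i, m) (a i x) = tr F (j, m) (g x)"
      and g: "g \<in> bounded_hom R (obj E i) (obj F j)"
      using jg by (auto simp: F.colim_rel_iff)
    note mem = F.le_mem[OF m(1)] F.le_mem[OF m(2)]
    note B = E.obj_banach[OF i] F.obj_banach[OF mem(1)] F.obj_banach[OF mem(3)]
    have s1: "((k, compose (carrier (obj E i)) h g), (\<beta> j, compose (carrier (obj E i)) (b j) g))
        \<in> colim_rel R (obj E i) G"
      by (rule G.colim_rel_precompose[OF B(3,1) G.colim_rel_sym[OF kh] g])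
    have s2: "((\<beta> j, compose (carrier (obj E i)) (b j) g), (\<beta> m, compose (carrier (obj E i))
          (compose (carrier (obj F j)) (b m) (tr F (j, m))) g)) \<in> colim_rel R (obj E i) G"
      by (rule G.colim_rel_precompose[OF B(3,1) natb[OF m(2)] g])
    have s3: "((\<beta> (\<alpha> i), compose (carrier (obj E i)) (b (\<alpha> i)) (a i)), (\<beta> m, compose (carrier (obj E i))
          (compose (carrier (obj F (\<alpha> i))) (b m) (tr F (\<alpha> i, m))) (a i))) \<in> colim_rel R (obj E i) G"
      by (rule G.colim_rel_precompose[OF B(2,1) natb[OF m(1)] a(2)[OF i]])
    have "compose (carrier (obj E i)) (compose (carrier (obj F j)) (b m) (tr F (j, m))) g =
        compose (carrier (obj E i)) (compose (carrier (obj F (\<alpha> i))) (b m) (tr F (\<alpha> i, m))) (a i)"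
      using m(3) bounded_hom_closed[OF g] bounded_hom_closed[OF a(2)[OF i]]
      by (auto simp: compose_def fun_eq_iff)
    with G.colim_rel_trans[OF G.colim_rel_trans[OF s1 s2]] G.colim_rel_sym[OF s3]
    show ?thesis by (intro equiv_class_eq[OF G.equiv_colim_rel]) simp
  qed
  show ?thesis
  proof (rule ext)
    fix i
    show "ind_comp R E G (induced_morphism R F G \<beta> b) (induced_morphism R E F \<alpha> a) i =
      induced_morphism R E G (\<lambda>i. \<beta> (\<alpha> i)) (\<lambda>i. compose (carrier (obj E i)) (b (\<alpha> i)) (a i)) i"
    proof (cases "i \<in> I")
      case i: True
      let ?c = "colim_rel R (obj E i) G `` {(\<beta> (\<alpha> i), compose (carrier (obj E i)) (b (\<alpha> i)) (a i))}"
      have inner: "(\<Union>(k, h)\<in>induced_morphism R F G \<beta> b j.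
          colim_rel R (obj E i) G `` {(k, compose (carrier (obj E i)) h g)}) = ?c"
        if jg: "(j, g) \<in> induced_morphism R E F \<alpha> a i" for j g
      proof -
        have jg': "((\<alpha> i, a i), (j, g)) \<in> colim_rel R (obj E i) F"
          using jg i by (simp add: induced_morphism_def E.idx_eq)
        then have j: "j \<in> J" using F.le_mem by (auto simp: F.colim_rel_iff)
        have "(\<beta> j, b j) \<in> induced_morphism R F G \<beta> b j"
          using G.colim_rel_refl[OF b[OF j]] j by (simp add: induced_morphism_def F.idx_eq)
        moreover have "colim_rel R (obj E i) G `` {(k, compose (carrier (obj E i)) h g)} = ?c"
          if "(k, h) \<in> induced_morphism R F G \<beta> b j" for k h
          using that j by (intro key[OF i jg']) (simp add: induced_morphism_def F.idx_eq)
        ultimately show ?thesis by (intro SUP_eq_const) auto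
      qed
      have "(\<alpha> i, a i) \<in> induced_morphism R E F \<alpha> a i"
        using F.colim_rel_refl[OF a[OF i]] i by (simp add: induced_morphism_def E.idx_eq)
      then have "(\<Union>(j, g)\<in>induced_morphism R E F \<alpha> a i. \<Union>(k, h)\<in>induced_morphism R F G \<beta> b j.
          colim_rel R (obj E i) G `` {(k, compose (carrier (obj E i)) h g)}) = ?c"
        using inner by (intro SUP_eq_const) auto
      then show ?thesis using i by (simp add: ind_comp_def induced_morphism_def[of R E G] E.idx_eq)
    qed (simp add: ind_comp_def induced_morphism_def[of R E G] E.idx_eq)
  qed
qed

theorem ind_isoI:
  assumes "poset_functor R I LE E" "poset_functor R J LF F"
    and ca: "compatible_family R E F \<alpha> a" and cb: "compatible_family R F E \<beta> b"
    and E1: "\<And>i. i \<in> I \<Longrightarrow> ((\<beta> (\<alpha> i), compose (carrier (obj E i)) (b (\<alpha> i)) (a i)),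
      (i, \<lambda>x\<in>carrier (obj E i). x)) \<in> colim_rel R (obj E i) E"
    and E2: "\<And>j. j \<in> J \<Longrightarrow> ((\<alpha> (\<beta> j), compose (carrier (obj F j)) (a (\<beta> j)) (b j)),
      (j, \<lambda>x\<in>carrier (obj F j). x)) \<in> colim_rel R (obj F j) F"
  shows "ind_iso R E F (induced_morphism R E F \<alpha> a)"
proof -
  interpret E: poset_functor R I LE E by fact
  interpret F: poset_functor R J LF F by fact
  have "ind_comp R E E (induced_morphism R F E \<beta> b) (induced_morphism R E F \<alpha> a) = ind_id R E"
    by (subst induced_morphism_comp[OF assms(1,2,1) ca cb], unfold induced_morphism_def ind_id_def, rule restrict_ext)
      (auto simp: E.idx_eq intro!: equiv_class_eq[OF E.equiv_colim_rel] E1)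
  moreover have "ind_comp R F F (induced_morphism R E F \<alpha> a) (induced_morphism R F E \<beta> b) = ind_id R F"
    by (subst induced_morphism_comp[OF assms(2,1,2) cb ca], unfold induced_morphism_def ind_id_def, rule restrict_ext)
      (auto simp: F.idx_eq intro!: equiv_class_eq[OF F.equiv_colim_rel] E2)
  ultimately show ?thesis
    unfolding ind_iso_def
    using induced_morphism_hom[OF assms(1,2) ca] induced_morphism_hom[OF assms(2,1) cb] by blast
qed

section \<open>Nuclear ind-objects\<close>

context poset_functor
begin

text \<open>Take \<open>X = F i\<close> in the definition of nuclearity.  A representative at stage \<open>i\<close> of the inverse of
  the canonical morphism sends the identity of \<open>F i\<close> to an element \<open>t\<close> of the tensor product of the dual
  of \<open>F i\<close> with some \<open>F j\<close>.  That the two morphisms compose to the identity means that the image of \<open>t\<close>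
  in \<open>Hom(F i, F j)\<close> and the identity of \<open>F i\<close> become equal at a later stage \<open>p\<close>.\<close>

lemma ind_nuclear_transition:
  assumes nuc: "ind_nuclear R F" and i: "i \<in> I"
  obtains j p t where "(j, p) \<in> L" "(i, p) \<in> L" "t \<in> carrier (ctensor R (dual R (obj F i)) (obj F j))"
    "\<And>x. x \<in> carrier (obj F i) \<Longrightarrow>
      tr F (i, p) x = tr F (j, p) (canonical_map R (obj F i) (obj F j) t x)"
proof -
  let ?X = "obj F i"
  let ?T = "ind_tensor R (dual R ?X) F" and ?H = "ind_internal_hom R ?X F"
  let ?\<kappa> = "ind_canonical_map R ?X F" and ?A = "obj (ind_internal_hom R ?X F) i"
  have simps [simp]: "idx ?T = poset_cat I L" "idx ?H = poset_cat I L"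
    "obj ?T j = ctensor R (dual R ?X) (obj F j)" "obj ?H j = internal_hom R ?X (obj F j)" for j
    by (simp_all add: ind_tensor_def ind_internal_hom_def idx_eq)
  have trH: "tr ?H (j, k) g x = tr F (j, k) (g x)" if "g \<in> bounded_hom R ?X (obj F j)" "x \<in> carrier ?X" for j k g x
    using that by (simp add: ind_internal_hom_def idx_eq compose_def)
  have X: "banach_module R ?X" by (rule obj_banach[OF i])
  interpret XX: banach_mod_pair R ?X ?X using banach_ring X by unfold_locales
  have "ind_iso R ?T ?H ?\<kappa>" using nuc X by (simp add: ind_nuclear_def)
  then obtain \<psi> where \<psi>: "\<psi> \<in> ind_hom R ?H ?T" and "ind_comp R ?H ?H ?\<kappa> \<psi> = ind_id R ?H"
    by (auto simp: ind_iso_def)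
  then have eq: "ind_comp R ?H ?H ?\<kappa> \<psi> i = ind_id R ?H i" by simp
  let ?id = "\<lambda>g\<in>carrier ?A. g"
  have "banach_module R ?A" using XX.internal_hom_banach by simp
  then have idm: "?id \<in> bounded_hom R ?A ?A" by (rule bounded_hom_id[OF banach_ring])
  have "((i, ?id), (i, ?id)) \<in> colim_rel R ?A ?H"
    by (rule colim_rel_self[where u = "(i, i)"]) (use idm i le_refl[OF i] in simp_all)
  then have "(i, ?id) \<in> ind_comp R ?H ?H ?\<kappa> \<psi> i" unfolding eq by (simp add: ind_id_def i)
  then obtain j g k h where jg: "(j, g) \<in> \<psi> i" and kh: "(k, h) \<in> ?\<kappa> j"
    and comp: "((k, compose (carrier ?A) h g), (i, ?id)) \<in> colim_rel R ?A ?H"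
    using i by (auto simp: ind_comp_def)
  have "\<psi> i \<in> colim_hom R ?A ?T" using \<psi> i by (auto simp: ind_hom_def)
  then have "(j, g) \<in> Range (colim_rel R ?A ?T)" using jg by (auto simp: colim_hom_def quotient_def)
  then have j: "j \<in> I" and g: "g \<in> bounded_hom R ?A (obj ?T j)"
    by (auto simp: colim_rel_def)
  have "((j, canonical_map R ?X (obj F j)), (k, h)) \<in> colim_rel R (obj ?T j) ?H"
    using kh j by (simp add: ind_canonical_map_def idx_eq)
  then obtain m where m: "(j, m) \<in> L" "(k, m) \<in> L" and h: "h \<in> bounded_hom R (obj ?T j) (obj ?H k)"
    and hm: "compose (carrier (obj ?T j)) (tr ?H (j, m)) (canonical_map R ?X (obj F j)) =
      compose (carrier (obj ?T j)) (tr ?H (k, m)) h"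
    by (auto simp: colim_rel_def)
  obtain n where n: "(k, n) \<in> L" "(i, n) \<in> L"
    and hn: "compose (carrier ?A) (tr ?H (k, n)) (compose (carrier ?A) h g) =
      compose (carrier ?A) (tr ?H (i, n)) ?id"
    using comp by (auto simp: colim_rel_def)
  obtain p where p: "(m, p) \<in> L" "(n, p) \<in> L"
    using directed le_mem[OF m(1)] le_mem[OF n(1)] by blast
  define e where "e = (\<lambda>x\<in>carrier ?X. x)"
  have e: "e \<in> bounded_hom R ?X ?X" unfolding e_def by (rule bounded_hom_id[OF banach_ring X])
  define t where "t = g e"
  have t: "t \<in> carrier (ctensor R (dual R ?X) (obj F j))"
    using bounded_hom_closed[OF g, of e] e by (simp add: t_def)
  interpret Xj: banach_mod_pair R ?X "obj F j" using banach_ring X obj_banach[OF j] by unfold_locales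
  have c: "canonical_map R ?X (obj F j) t \<in> bounded_hom R ?X (obj F j)"
    by (rule Xj.canonical_map_image(1)[OF t])
  have ht: "h t \<in> bounded_hom R ?X (obj F k)" using bounded_hom_closed[OF h, of t] t by simp
  show ?thesis
  proof (rule that[OF le_trans[OF m(1) p(1)] le_trans[OF n(2) p(2)] t])
    fix x assume x: "x \<in> carrier ?X"
    have 1: "tr F (j, m) (canonical_map R ?X (obj F j) t x) = tr F (k, m) (h t x)"
      using fun_cong[OF fun_cong[OF hm, of t], of x] t x trH[OF c x] trH[OF ht x] by (simp add: compose_def)
    have 2: "tr F (k, n) (h t x) = tr F (i, n) x"
      using fun_cong[OF fun_cong[OF hn, of e], of x] e x trH[OF ht x] trH[OF e x]
      by (simp add: compose_def t_def[symmetric]) (simp add: e_def)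
    note cx = bounded_hom_closed[OF c x] and hx = bounded_hom_closed[OF ht x]
    have "tr F (i, p) x = tr F (n, p) (tr F (k, n) (h t x))" using tr_comp[OF n(2) p(2) x] 2 by simp
    also have "\<dots> = tr F (m, p) (tr F (k, m) (h t x))"
      using tr_comp[OF n(1) p(2) hx] tr_comp[OF m(2) p(1) hx] by simp
    also have "\<dots> = tr F (j, p) (canonical_map R ?X (obj F j) t x)"
      using tr_comp[OF m(1) p(1) cx] 1 by simp
    finally show "tr F (i, p) x = tr F (j, p) (canonical_map R ?X (obj F j) t x)" .
  qed
qed

text \<open>Every term maps to some later term through a coproduct of weighted copies of \<open>R\<close>, and the
  first factor of this map is nuclear.\<close>

theorem ind_nuclear_factorization:
  assumes nuc: "ind_nuclear R F" and i: "i \<in> I"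
  obtains p r a b where "(i, p) \<in> L" "\<And>s. 0 < r s" "nuclear_map R (obj F i) (weighted_l1 R r) a"
    "b \<in> bounded_hom R (weighted_l1 R r) (obj F p)"
    "\<And>x. x \<in> carrier (obj F i) \<Longrightarrow> b (a x) = tr F (i, p) x"
proof -
  obtain j p t where jp: "(j, p) \<in> L" and ip: "(i, p) \<in> L"
    and t: "t \<in> carrier (ctensor R (dual R (obj F i)) (obj F j))"
    and eq: "\<And>x. x \<in> carrier (obj F i) \<Longrightarrow>
      tr F (i, p) x = tr F (j, p) (canonical_map R (obj F i) (obj F j) t x)"
    by (rule ind_nuclear_transition[OF nuc i]) blast
  interpret B: banach_mod_pair R "obj F i" "obj F j"
    using banach_ring obj_banach[OF i] obj_banach[OF le_mem(1)[OF jp]] by unfold_locales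
  have "nuclear_map R (obj F i) (obj F j) (canonical_map R (obj F i) (obj F j) t)"
    unfolding B.nuclear_map_iff using B.canonical_map_image[OF t] by blast
  then obtain r a c where r: "\<And>s. 0 < r s" and a: "nuclear_map R (obj F i) (weighted_l1 R r) a"
    and c: "c \<in> bounded_hom R (weighted_l1 R r) (obj F j)"
    and ca: "canonical_map R (obj F i) (obj F j) t = compose (carrier (obj F i)) c a"
    by (rule B.nuclear_map_factorization) blast
  interpret W: weighted_l1_space R r using banach_ring r by unfold_locales
  have am: "a \<in> bounded_hom R (obj F i) (weighted_l1 R r)" using a by (simp add: nuclear_map_def)
  let ?b = "compose (carrier (weighted_l1 R r)) (tr F (j, p)) c"
  have "?b \<in> bounded_hom R (weighted_l1 R r) (obj F p)"
    by (rule bounded_hom_compose(1)[OF banach_ring W.banach_L obj_banach[OF le_mem(1)[OF jp]]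
          obj_banach[OF le_mem(2)[OF jp]] c tr_hom[OF jp]])
  moreover have "?b (a x) = tr F (i, p) x" if "x \<in> carrier (obj F i)" for x
    using eq[OF that] that bounded_hom_closed[OF am that] by (simp add: compose_def ca)
  ultimately show ?thesis using ip r a by (intro that)
qed

end

section \<open>Cardinalities of infinite index sets\<close>

lemma infinite_times_self_eqpoll:
  assumes "infinite A"
  shows "A \<times> A \<approx> A"
  using card_of_Times_same_infinite[OF assms] by (simp add: eqpoll_iff_card_of_ordIso)

lemma infinite_times_nat_eqpoll:
  assumes "infinite A"
  shows "A \<times> (UNIV :: nat set) \<approx> A"
proof (rule lepoll_antisym)
  have "A \<times> (UNIV :: nat set) \<lesssim> A \<times> A"
    using assms by (intro times_lepoll_mono) (auto simp: infinite_le_lepoll)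
  also have "\<dots> \<approx> A" by (rule infinite_times_self_eqpoll[OF assms])
  finally show "A \<times> (UNIV :: nat set) \<lesssim> A" .
  show "A \<lesssim> A \<times> (UNIV :: nat set)" by (rule lepoll_times1) simp
qed

lemma reflexive_relation_eqpoll:
  assumes "infinite A" "r \<subseteq> A \<times> A" "refl_on A r"
  shows "r \<approx> A"
proof (rule lepoll_antisym)
  have "r \<lesssim> A \<times> A" by (rule subset_imp_lepoll[OF assms(2)])
  also have "\<dots> \<approx> A" by (rule infinite_times_self_eqpoll[OF assms(1)])
  finally show "r \<lesssim> A" .
  show "A \<lesssim> r"
    unfolding lepoll_def using assms(3)
    by (intro exI[of _ "\<lambda>x. (x, x)"]) (auto simp: inj_on_def refl_on_def)
qed

section \<open>Presentation by nuclear maps between coproducts of weighted copies\<close>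

theorem lemma4p17:
  fixes R :: "'a normed_ring"
    and I :: "'i set" and ord_rel :: "'i rel"
    and W :: "('i, 'i \<times> 'i, 'a, 'm) ind_obj"
  assumes "banach_ring R"
    and "infinite I"
    and "partial_order_on I ord_rel"
    and "\<forall>i\<in>I. \<forall>j\<in>I. \<exists>k\<in>I. (i, k) \<in> ord_rel \<and> (j, k) \<in> ord_rel"
    and "idx W = poset_cat I ord_rel"
    and "ban_functor R W"
    and "ind_nuclear R W"
  shows "\<exists>(K :: ('i, 'i \<times> 'i) cat) (P :: ('i, 'i \<times> 'i, 'a, nat \<Rightarrow> 'a) ind_obj).
           filtered_category K \<and>
           Ob K \<approx> Ob (poset_cat I ord_rel) \<and> Ar K \<approx> Ar (poset_cat I ord_rel) \<and>
           idx P = K \<and> ban_functor R P \<and>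
           (\<exists>\<phi>. ind_iso R W P \<phi>) \<and>
           (\<forall>k\<in>Ob K. \<exists>(S :: nat set) r.
              (\<forall>s\<in>S. 0 < r s) \<and> obj P k = coprod_le1 S (\<lambda>s. weighted_copy R (r s))) \<and>
           (\<forall>u\<in>Ar K. u \<notin> Idt K ` Ob K \<longrightarrow>
              nuclear_map R (obj P (Dom K u)) (obj P (Cod K u)) (tr P u))"
proof -
  interpret W: poset_functor R I ord_rel W
    using assms(1-6) by unfold_locales auto
  \<comment> \<open>for each \<open>i\<close>, a nuclear map \<open>a i\<close> from \<open>W i\<close> to a coproduct, followed by \<open>b i\<close> to \<open>W (s i)\<close>\<close>
  have "\<forall>i\<in>I. \<exists>p r a b. (i, p) \<in> ord_rel \<and> (\<forall>n::nat. 0 < r n) \<and>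
      nuclear_map R (obj W i) (weighted_l1 R r) a \<and> b \<in> bounded_hom R (weighted_l1 R r) (obj W p) \<and>
      (\<forall>x\<in>carrier (obj W i). b (a x) = tr W (i, p) x)"
    by (meson W.ind_nuclear_factorization[OF assms(7)])
  then obtain s r a b where
    s: "\<And>i. i \<in> I \<Longrightarrow> (i, s i) \<in> ord_rel" and
    r: "\<And>i n. i \<in> I \<Longrightarrow> 0 < r i n" and
    a_nuc: "\<And>i. i \<in> I \<Longrightarrow> nuclear_map R (obj W i) (weighted_l1 R (r i)) (a i)" and
    b: "\<And>i. i \<in> I \<Longrightarrow> b i \<in> bounded_hom R (weighted_l1 R (r i)) (obj W (s i))" and
    ba: "\<And>i x. i \<in> I \<Longrightarrow> x \<in> carrier (obj W i) \<Longrightarrow> b i (a i x) = tr W (i, s i) x"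
    by metis
  have a: "a i \<in> bounded_hom R (obj W i) (weighted_l1 R (r i))" if "i \<in> I" for i
    using a_nuc[OF that] by (simp add: nuclear_map_def)
  have ax: "a i x \<in> carrier (weighted_l1 R (r i))" if "i \<in> I" "x \<in> carrier (obj W i)" for i x
    using bounded_hom_closed[OF a] that by blast
  have bx: "b i x \<in> carrier (obj W (s i))" if "i \<in> I" "x \<in> carrier (weighted_l1 R (r i))" for i x
    using bounded_hom_closed[OF b] that by blast
  have sI: "s i \<in> I" if "i \<in> I" for i using W.le_mem(2)[OF s[OF that]] .
  have trx: "tr W (i, j) x \<in> carrier (obj W j)" if "(i, j) \<in> ord_rel" "x \<in> carrier (obj W i)" for i j x
    using bounded_hom_closed[OF W.tr_hom] that by blast
  have l1: "banach_module R (weighted_l1 R (r i))" if "i \<in> I" for i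
  proof -
    interpret weighted_l1_space R "r i" using assms(1) r[OF that] by unfold_locales
    show ?thesis by (rule banach_L)
  qed

  \<comment> \<open>The new index poset is \<open>I \<times> \<nat>\<close>, transported to \<open>I\<close> by a bijection; an index \<open>k\<close> has components
    \<open>p k\<close> and \<open>q k\<close>.  Without the second one, a greatest element \<open>i\<close> of \<open>I\<close> would have no arrow but its
    identity, while the idempotent \<open>a i \<circ> b i\<close> must become the identity in the colimit.\<close>
  obtain e where "bij_betw e I (I \<times> (UNIV :: nat set))"
    using eqpoll_sym[OF infinite_times_nat_eqpoll[OF assms(2)]] by (auto simp: eqpoll_def)
  define p where "p k = fst (e k)" for k
  define q where "q k = snd (e k)" for k
  have pI: "p k \<in> I" if "k \<in> I" for k
    using bij_betwE[OF \<open>bij_betw e I (I \<times> UNIV)\<close>] that by (force simp: p_def mem_Times_iff)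
  have surj: "\<exists>k\<in>I. p k = j \<and> q k = n" if "j \<in> I" for j n
  proof -
    have "(j, n) \<in> e ` I" using \<open>bij_betw e I (I \<times> UNIV)\<close> that by (auto simp: bij_betw_def)
    then obtain k where "k \<in> I" "e k = (j, n)" by (metis imageE)
    then show ?thesis by (intro bexI[of _ k]) (simp_all add: p_def q_def)
  qed

  define L where "L = {(k, k'). k \<in> I \<and> k' \<in> I \<and> (k = k' \<or> (s (p k), p k') \<in> ord_rel \<and> q k < q k')}"
  have strict: "(s (p k), p k') \<in> ord_rel" "q k < q k'" if "(k, k') \<in> L" "k \<noteq> k'" for k k'
    using that by (auto simp: L_def)
  have L_trans: "(k, k'') \<in> L" if kk: "(k, k') \<in> L" "(k', k'') \<in> L" for k k' k''
  proof (cases "k = k' \<or> k' = k''")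
    case False
    have m: "k \<in> I" "k' \<in> I" "k'' \<in> I" using kk by (auto simp: L_def)
    have "(s (p k), s (p k')) \<in> ord_rel"
      using W.le_trans[OF strict(1)[OF kk(1)] s[OF pI[OF m(2)]]] False by blast
    then have "(s (p k), p k'') \<in> ord_rel" using W.le_trans strict(1)[OF kk(2)] False by blast
    moreover have "q k < q k''" using strict(2)[OF kk(1)] strict(2)[OF kk(2)] False by simp
    ultimately show ?thesis using m by (simp add: L_def)
  qed (use kk in auto)
  have L_order: "partial_order_on I L"
    unfolding partial_order_on_def preorder_on_def
  proof (intro conjI)
    show "L \<subseteq> I \<times> I" by (auto simp: L_def)
    show "refl_on I L" by (auto simp: L_def refl_on_def)
    show "trans L" using L_trans by (auto intro: transI)
    show "antisym L" by (rule antisymI) (auto simp: L_def)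
  qed
  have above: "\<exists>k\<in>I. (s i, p k) \<in> ord_rel \<and> (s j, p k) \<in> ord_rel \<and> n < q k \<and> m < q k"
    if ij: "i \<in> I" "j \<in> I" for i j n m
  proof -
    obtain l where l: "l \<in> I" "(s i, l) \<in> ord_rel" "(s j, l) \<in> ord_rel"
      using W.directed sI ij by blast
    obtain k where "k \<in> I" "p k = l" "q k = Suc (max n m)" using surj[OF l(1)] by blast
    with l show ?thesis by (intro bexI[of _ k]) auto
  qed
  have L_directed: "\<exists>k\<in>I. (i, k) \<in> L \<and> (j, k) \<in> L" if ij: "i \<in> I" "j \<in> I" for i j
    using above[OF pI[OF ij(1)] pI[OF ij(2)], of "q i" "q j"] ij by (auto simp: L_def)

  \<comment> \<open>the transition map of \<open>P\<close> for \<open>k < k'\<close>, the composite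
    \<open>P k \<rightarrow> W (s (p k)) \<rightarrow> W (p k') \<rightarrow> P k'\<close> with nuclear last factor\<close>
  define T where "T k k' = compose (carrier (weighted_l1 R (r (p k)))) (a (p k'))
    (compose (carrier (weighted_l1 R (r (p k)))) (tr W (s (p k), p k')) (b (p k)))" for k k'
  define P :: "('i, 'i \<times> 'i, 'a, nat \<Rightarrow> 'a) ind_obj" where
    "P = \<lparr>idx = poset_cat I L, obj = (\<lambda>k. weighted_l1 R (r (p k))),
      tr = (\<lambda>(k, k'). if k = k' then \<lambda>x\<in>carrier (weighted_l1 R (r (p k))). x else T k k')\<rparr>"
  have P_idx: "idx P = poset_cat I L" and P_obj: "obj P k = weighted_l1 R (r (p k))"
    and P_id: "tr P (k, k) = (\<lambda>x\<in>carrier (weighted_l1 R (r (p k))). x)"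
    and P_tr: "k \<noteq> k' \<Longrightarrow> tr P (k, k') = T k k'" for k k'
    by (simp_all add: P_def)
  have T_nuc: "nuclear_map R (weighted_l1 R (r (p k))) (weighted_l1 R (r (p k'))) (T k k')"
    if kk: "k \<in> I" "k' \<in> I" "(s (p k), p k') \<in> ord_rel" for k k'
  proof -
    note i = pI[OF kk(1)] and i' = pI[OF kk(2)]
    have "compose (carrier (weighted_l1 R (r (p k)))) (tr W (s (p k), p k')) (b (p k))
        \<in> bounded_hom R (weighted_l1 R (r (p k))) (obj W (p k'))"
      by (rule bounded_hom_compose(1)[OF assms(1) l1[OF i] W.obj_banach[OF sI[OF i]] W.obj_banach[OF i']
            b[OF i] W.tr_hom[OF kk(3)]])
    from nuclear_map_compose[OF assms(1) l1[OF i] W.obj_banach[OF i'] l1[OF i'] this a_nuc[OF i']]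
    show ?thesis unfolding T_def .
  qed
  have T_x: "T k k' x = a (p k') (tr W (s (p k), p k') (b (p k) x))"
    if "x \<in> carrier (weighted_l1 R (r (p k)))" for k k' x
    using that by (simp add: T_def compose_def)
  have T_b: "b (p k') (T k k' x) = tr W (s (p k), s (p k')) (b (p k) x)"
    if kk: "k \<in> I" "k' \<in> I" "(s (p k), p k') \<in> ord_rel" and x: "x \<in> carrier (weighted_l1 R (r (p k)))" for k k' x
    unfolding T_x[OF x] using kk pI bx[OF pI[OF kk(1)] x]
    by (simp add: ba trx W.tr_comp[OF kk(3) s])
  have T_a: "T k k' (a (p k) x) = a (p k') (tr W (p k, p k') x)"
    if kk: "k \<in> I" "k' \<in> I" "(s (p k), p k') \<in> ord_rel" and x: "x \<in> carrier (obj W (p k))" for k k' x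
    unfolding T_x[OF ax[OF pI[OF kk(1)] x]] using pI[OF kk(1)] x
    by (simp add: ba W.tr_comp[OF s kk(3)])
  have T_ext: "tr P (k, k') x = undefined" if "x \<notin> carrier (weighted_l1 R (r (p k)))" for k k' x
    using that by (cases "k = k'") (auto simp: P_id P_tr T_def compose_def)
  have "ban_functor R P"
    unfolding ban_functor_def P_idx poset_cat_simps
  proof (intro conjI ballI impI)
    fix k assume k: "k \<in> I"
    show "banach_module R (obj P k)" unfolding P_obj by (rule l1[OF pI[OF k]])
    show "tr P (k, k) = (\<lambda>x\<in>carrier (obj P k). x)" by (simp add: P_id P_obj)
  next
    fix u assume u: "u \<in> L"
    obtain k k' where e: "u = (k, k')" by (cases u)
    have m: "k \<in> I" "k' \<in> I" using u by (auto simp: L_def e)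
    show "tr P u \<in> bounded_hom R (obj P (fst u)) (obj P (snd u))"
    proof (cases "k = k'")
      case True
      then show ?thesis using bounded_hom_id[OF assms(1) l1[OF pI[OF m(1)]]] by (simp add: e P_id P_obj)
    next
      case False
      then show ?thesis using T_nuc[OF m strict(1)] u by (simp add: e P_tr P_obj nuclear_map_def)
    qed
    fix v assume v: "v \<in> L" and uv: "fst v = snd u"
    then obtain k'' where e': "v = (k', k'')" by (cases v) (auto simp: e)
    have m'': "k'' \<in> I" using v by (auto simp: L_def e')
    have "tr P (k, k'') x = tr P (k', k'') (tr P (k, k') x)" if x: "x \<in> carrier (weighted_l1 R (r (p k)))" for x
    proof (cases "k = k' \<or> k' = k''")
      case True
      moreover have "tr P (k, k') x \<in> carrier (weighted_l1 R (r (p k')))"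
        using bounded_hom_closed[OF \<open>tr P u \<in> _\<close>, of x] x by (simp add: e P_obj)
      ultimately show ?thesis using x by (auto simp: P_id)
    next
      case False
      have st: "(s (p k), p k') \<in> ord_rel" "(s (p k'), p k'') \<in> ord_rel"
        and q: "q k < q k'" "q k' < q k''"
        using strict[of k k'] strict[of k' k''] u v False by (auto simp: e e')
      have Tx: "T k k' x \<in> carrier (weighted_l1 R (r (p k')))"
        by (rule bounded_hom_closed[OF nuclear_map_bounded[OF T_nuc[OF m st(1)]] x])
      have "T k' k'' (T k k' x) = a (p k'') (tr W (s (p k'), p k'') (tr W (s (p k), s (p k')) (b (p k) x)))"
        using T_x[OF Tx, of k''] T_b[OF m st(1) x] by simp
      also have "\<dots> = T k k'' x"
        using W.tr_comp[OF W.le_trans[OF st(1) s[OF pI[OF m(2)]]] st(2) bx[OF pI[OF m(1)] x]] T_x[OF x] by simp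
      moreover have "k \<noteq> k''" using q by auto
      ultimately show ?thesis using False by (simp add: P_tr)
    qed
    then show "tr P (fst u, snd v) = compose (carrier (obj P (fst u))) (tr P v) (tr P u)"
      using T_ext by (auto simp: e e' compose_def fun_eq_iff P_obj)
  qed
  interpret P: poset_functor R I L P
    using assms(1) L_order L_directed P_idx \<open>ban_functor R P\<close> by unfold_locales

  \<comment> \<open>\<open>W i\<close> maps by \<open>a i\<close> to the term of \<open>P\<close> at the index \<open>\<alpha> i\<close> corresponding to \<open>(i, 0)\<close>\<close>
  have "\<forall>i. \<exists>k. i \<in> I \<longrightarrow> k \<in> I \<and> p k = i \<and> q k = 0" using surj by blast
  then obtain \<alpha> where \<alpha>: "\<And>i. i \<in> I \<Longrightarrow> \<alpha> i \<in> I" "\<And>i. i \<in> I \<Longrightarrow> p (\<alpha> i) = i"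
      "\<And>i. i \<in> I \<Longrightarrow> q (\<alpha> i) = 0"
    by metis
  have LI: "(k, k') \<in> L" "tr P (k, k') = T k k'" if "k \<in> I" "k' \<in> I" "(s (p k), p k') \<in> ord_rel" "q k < q k'" for k k'
  proof -
    have "k \<noteq> k'" using that(4) by auto
    with that show "(k, k') \<in> L" "tr P (k, k') = T k k'" by (simp_all add: L_def P_tr)
  qed
  have comp_a: "compatible_family R W P \<alpha> a"
    unfolding compatible_family_def P_idx assms(5) poset_cat_simps
  proof (intro conjI ballI, goal_cases)
    case (1 i)
    then show ?case using \<alpha> by simp
  next
    case (2 i)
    then show ?case using \<alpha> a by (simp add: P_obj)
  next
    case (3 u)
    obtain i i' where e: "u = (i, i')" by (cases u)
    have le: "(i, i') \<in> ord_rel" using 3 e by simp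
    note m = W.le_mem[OF le]
    obtain k where k: "k \<in> I" "(s i, p k) \<in> ord_rel" "(s i', p k) \<in> ord_rel" "0 < q k"
      using above[OF m, of 0 0] by blast
    have 1: "(\<alpha> i, k) \<in> L" "tr P (\<alpha> i, k) = T (\<alpha> i) k" and 2: "(\<alpha> i', k) \<in> L" "tr P (\<alpha> i', k) = T (\<alpha> i') k"
      using LI[of "\<alpha> i" k] LI[of "\<alpha> i'" k] \<alpha> m k by simp_all
    have "tr P (\<alpha> i, k) (a i x) = tr P (\<alpha> i', k) (a i' (tr W (i, i') x))" if x: "x \<in> carrier (obj W i)" for x
      using T_a[of "\<alpha> i" k x] T_a[of "\<alpha> i'" k "tr W (i, i') x"] trx[OF le x] 1 2 \<alpha> m k x
        W.tr_comp[OF le W.le_trans[OF s[OF m(2)] k(3)] x] by simp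
    then have "((\<alpha> i, a i), (\<alpha> i', compose (carrier (obj W i)) (a i') (tr W (i, i')))) \<in> colim_rel R (obj W i) P"
      unfolding P.colim_rel_iff
      using 1 2 a[OF m(1)] bounded_hom_compose(1)[OF assms(1) W.obj_banach[OF m(1)] W.obj_banach[OF m(2)]
          l1[OF m(2)] W.tr_hom[OF le] a[OF m(2)]] \<alpha> m
      by (auto simp: P_obj compose_def intro!: exI[of _ k])
    then show ?case by (simp add: e)
  qed
  have comp_b: "compatible_family R P W (\<lambda>k. s (p k)) (\<lambda>k. b (p k))"
    unfolding compatible_family_def P_idx assms(5) poset_cat_simps
  proof (intro conjI ballI, goal_cases)
    case (1 k)
    then show ?case using sI pI by simp
  next
    case (2 k)
    then show ?case using b pI by (simp add: P_obj)
  next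
    case (3 u)
    obtain k k' where e: "u = (k, k')" by (cases u)
    have kk: "(k, k') \<in> L" using 3 e by simp
    note m = P.le_mem[OF kk]
    note bm = b[OF pI[OF m(1)]] b[OF pI[OF m(2)]]
    have le: "(s (p k), s (p k')) \<in> ord_rel"
    proof (cases "k = k'")
      case False
      then show ?thesis using W.le_trans[OF strict(1)[OF kk] s[OF pI[OF m(2)]]] by blast
    qed (simp add: W.le_refl sI pI m)
    have "tr W (s (p k), s (p k')) (b (p k) x) = tr W (s (p k'), s (p k')) (b (p k') (tr P (k, k') x))"
      if x: "x \<in> carrier (weighted_l1 R (r (p k)))" for x
    proof (cases "k = k'")
      case True
      then show ?thesis using x by (simp add: P_id)
    next
      case False
      have mem: "b (p k') (T k k' x) \<in> carrier (obj W (s (p k')))"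
        using T_b[OF m strict(1)[OF kk False] x] trx[OF le bx[OF pI[OF m(1)] x]] by simp
      show ?thesis
        using W.tr_id[OF sI[OF pI[OF m(2)]] mem] T_b[OF m strict(1)[OF kk False] x] False by (simp add: P_tr)
    qed
    moreover have "compose (carrier (obj P k)) (b (p k')) (tr P (k, k')) \<in> bounded_hom R (obj P k) (obj W (s (p k')))"
      using bounded_hom_compose(1)[OF assms(1) P.obj_banach[OF m(1)] P.obj_banach[OF m(2)]
          W.obj_banach[OF sI[OF pI[OF m(2)]]] P.tr_hom[OF kk]] bm(2) by (simp add: P_obj)
    ultimately have "((s (p k), b (p k)), (s (p k'), compose (carrier (obj P k)) (b (p k')) (tr P (k, k'))))
        \<in> colim_rel R (obj P k) W"
      unfolding W.colim_rel_iff using bm(1) le W.le_refl[OF sI[OF pI[OF m(2)]]]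
      by (auto simp: P_obj compose_def intro!: exI[of _ "s (p k')"])
    then show ?case by (simp add: e)
  qed
  have "ind_iso R W P (induced_morphism R W P \<alpha> a)"
  proof (rule ind_isoI[OF W.poset_functor_axioms P.poset_functor_axioms comp_a comp_b])
    fix i assume i: "i \<in> I"
    have "compose (carrier (obj W i)) (b (p (\<alpha> i))) (a i) \<in> bounded_hom R (obj W i) (obj W (s i))"
      using bounded_hom_compose(1)[OF assms(1) W.obj_banach[OF i] l1[OF i] W.obj_banach[OF sI[OF i]] a[OF i] b[OF i]]
      by (simp add: \<alpha> i)
    then show "((s (p (\<alpha> i)), compose (carrier (obj W i)) (b (p (\<alpha> i))) (a i)), i, \<lambda>x\<in>carrier (obj W i). x)
        \<in> colim_rel R (obj W i) W"
      unfolding W.colim_rel_iff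
      using bounded_hom_id[OF assms(1) W.obj_banach[OF i]] s[OF i] W.le_refl[OF sI[OF i]] trx[OF s[OF i]]
      by (auto simp: \<alpha> i compose_def ba W.tr_id sI intro!: exI[of _ "s i"])
  next
    fix k assume k: "k \<in> I"
    let ?i = "p k"
    note i = pI[OF k] and si = sI[OF pI[OF k]]
    obtain k' where k': "k' \<in> I" "(s ?i, p k') \<in> ord_rel" "(s (s ?i), p k') \<in> ord_rel" "q k < q k'" "0 < q k'"
      using above[OF i si, of "q k" 0] by blast
    have 1: "(k, k') \<in> L" "tr P (k, k') = T k k'" using LI[OF k k'(1,2,4)] by auto
    have 2: "(\<alpha> (s ?i), k') \<in> L" "tr P (\<alpha> (s ?i), k') = T (\<alpha> (s ?i)) k'"
      using LI[of "\<alpha> (s ?i)" k'] \<alpha> si k' by simp_all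
    have "compose (carrier (obj P k)) (a (s ?i)) (b ?i) \<in> bounded_hom R (obj P k) (obj P (\<alpha> (s ?i)))"
      using bounded_hom_compose(1)[OF assms(1) l1[OF i] W.obj_banach[OF si] l1[OF si] b[OF i] a[OF si]]
      by (simp add: P_obj \<alpha> si)
    moreover have "tr P (\<alpha> (s ?i), k') (a (s ?i) (b ?i x)) = tr P (k, k') x"
      if x: "x \<in> carrier (weighted_l1 R (r ?i))" for x
      using T_a[of "\<alpha> (s ?i)" k' "b ?i x"] bx[OF i x] T_x[OF x, of k'] 1 2 \<alpha> si k' by simp
    ultimately show "((\<alpha> (s ?i), compose (carrier (obj P k)) (a (s ?i)) (b ?i)), k, \<lambda>x\<in>carrier (obj P k). x)
        \<in> colim_rel R (obj P k) P"
      unfolding P.colim_rel_iff using 1(1) 2(1) bounded_hom_id[OF assms(1) P.obj_banach[OF k]]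
      by (auto simp: P_obj compose_def intro!: exI[of _ k'])
  qed
  moreover have "L \<approx> ord_rel"
    using reflexive_relation_eqpoll[OF assms(2) partial_order_onD(4)[OF L_order] partial_order_onD(1)[OF L_order]]
      reflexive_relation_eqpoll[OF assms(2) partial_order_onD(4)[OF assms(3)] partial_order_onD(1)[OF assms(3)]]
    by (blast intro: eqpoll_trans eqpoll_sym)
  moreover have "filtered_category (poset_cat I L)"
    using L_directed assms(2) by (intro filtered_poset_cat[OF L_order]) auto
  moreover have "\<forall>k\<in>I. \<exists>(S :: nat set) \<rho>.
      (\<forall>s\<in>S. 0 < \<rho> s) \<and> obj P k = coprod_le1 S (\<lambda>s. weighted_copy R (\<rho> s))"
    using r pI unfolding P_obj weighted_l1_def by blast
  moreover have "nuclear_map R (obj P (fst u)) (obj P (snd u)) (tr P u)"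
    if u: "u \<in> L" "u \<notin> (\<lambda>i. (i, i)) ` I" for u
  proof -
    obtain k k' where e: "u = (k, k')" by (cases u)
    have "k \<in> I" "k' \<in> I" "k \<noteq> k'" using u by (auto simp: L_def e)
    then show ?thesis using T_nuc[OF _ _ strict(1)] u(1) by (simp add: e P_tr P_obj)
  qed
  ultimately show ?thesis
    using P_idx \<open>ban_functor R P\<close>
    by (intro exI[of _ "poset_cat I L"] exI[of _ P]) (auto simp: image_def)
qed

end
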